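(* Let $1<j<N$ and assume $$I(V)=\sum_{m=1}^{j}\sum_{l=j+1}^{N}|\lambda_l-\lambda_m|^{-1}\int_0^\infty |V_{ml}(\tau)|^2\,d\tau<\infty .$$ Let $\Delta_j(t,k)$ be the determinant of the upper-left $j\times j$ block of $X(t,k)$ and put $g(t,k)=\Delta_j(t,k)\exp(-ikt(\lambda_1+\dots+\lambda_j))$. Then, as $t\to\infty$, $g(t,k)$ converges for $k\in\mathbb{C}^+$ to a function $g(\infty,k)$ which is in the unit ball of $H^\infty(\mathbb{C}^+)$. Moreover, $$g(t,\cdot)-g(\infty,\cdot)\in H^2(\mathbb{C}^+),\qquad \|g(t,\cdot)-g(\infty,\cdot)\|_2\to 0\quad (t\to\infty),$$ and $$0\ge \int_{\mathbb{R}}\ln|g(\infty,k)|\,dk\ge -\pi I(V),\qquad \int_{\mathbb{R}}|1-g(\infty,k)|^p\,dk\le C(p)\,I(V),\quad 1<p<\infty,$$ where $C(p)$ depends only on $p$.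
   Context: Setting: $N\ge 3$, $\Lambda=\mathrm{diag}(\lambda_1,\dots,\lambda_N)$ with real $0=\lambda_1<\lambda_2<\dots<\lambda_N$. $V(t)=(V_{ml}(t))$, $t\ge 0$, is an $N\times N$ Hermitian matrix function with $V_{mm}(t)=0$ for all $m$ and $\|V\|\in L^2_{\rm loc}(\mathbb{R}^+)$. For $k\in\mathbb{C}$, $X(t,k)$ is the $N\times N$ matrix solution of $X_t=i(k\Lambda+V(t))X$, $X(0,k)=I$. It is entire in $k$. $\mathbb{C}^+$ is the open upper half-plane, $H^p(\mathbb{C}^+)$ the Hardy spaces, and functions in them are identified with their boundary values on $\mathbb{R}$. *)

theory Defs
  imports
    "HOL-Analysis.Analysis"
    "Jordan_Normal_Form.Schur_Decomposition"
begin

text \<open>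
  Matrices have the type \<^typ>\<open>complex mat\<close>. Indices start at 0, so
  the entry usually written \<open>V\<^sub>m\<^sub>l\<close> is \<open>V $$ (m - 1, l - 1)\<close>, and the indices
  \<open>1, \<dots>, j\<close> and \<open>j + 1, \<dots>, N\<close> become \<open>{..<j}\<close> and \<open>{j..<N}\<close>.
  \<open>Matrix.mat\<close> and \<open>Determinant.det\<close> are qualified because of the constants of the
  same name in HOL-Analysis.
\<close>

definition Lambda :: "nat \<Rightarrow> (nat \<Rightarrow> real) \<Rightarrow> complex mat" where
  "Lambda N lam = mat_diag N (\<lambda>m. complex_of_real (lam m))"

text \<open>All norms on the \<open>N \<times> N\<close> matrices are equivalent; we use the Frobenius norm.\<close>

definition mat_norm :: "complex mat \<Rightarrow> real" where
  "mat_norm A = sqrt (\<Sum>m<dim_row A. \<Sum>l<dim_col A. (cmod (A $$ (m, l)))\<^sup>2)"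

definition potential :: "nat \<Rightarrow> (real \<Rightarrow> complex mat) \<Rightarrow> bool" where
  "potential N V \<longleftrightarrow>
     (\<forall>t\<ge>0. V t \<in> carrier_mat N N \<and> mat_adjoint (V t) = V t \<and> (\<forall>m<N. V t $$ (m, m) = 0)) \<and>
     (\<forall>m<N. \<forall>l<N. set_borel_measurable lebesgue {0..} (\<lambda>t. V t $$ (m, l))) \<and>
     (\<forall>T\<ge>0. set_integrable lebesgue {0..T} (\<lambda>t. (mat_norm (V t))\<^sup>2))"

text \<open>
  As \<open>V\<close> is only locally square integrable, \<open>X\<^sub>t = \<i> (k \<Lambda> + V) X\<close>, \<open>X(0, k) = I\<close> is
  understood in the sense of Caratheodory: \<open>X\<close> is continuous in \<open>t\<close> and satisfies the
  integrated equation, i.e. it is locally absolutely continuous and satisfies the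
  differential equation for almost every \<open>t\<close>.
\<close>

definition solution ::
    "nat \<Rightarrow> (nat \<Rightarrow> real) \<Rightarrow> (real \<Rightarrow> complex mat) \<Rightarrow> (real \<Rightarrow> complex \<Rightarrow> complex mat) \<Rightarrow> bool" where
  "solution N lam V X \<longleftrightarrow>
     (\<forall>k. \<forall>t\<ge>0. X t k \<in> carrier_mat N N) \<and>
     (\<forall>k. \<forall>m<N. \<forall>l<N.
        let F = (\<lambda>s. (\<i> \<cdot>\<^sub>m ((k \<cdot>\<^sub>m Lambda N lam + V s) * X s k)) $$ (m, l)) in
        continuous_on {0..} (\<lambda>t. X t k $$ (m, l)) \<and>
        (\<forall>t\<ge>0. set_integrable lebesgue {0..t} F \<and>
               X t k $$ (m, l) = 1\<^sub>m N $$ (m, l) + (LINT s:{0..t}|lebesgue. F s)))"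

definition I_func :: "nat \<Rightarrow> (nat \<Rightarrow> real) \<Rightarrow> nat \<Rightarrow> (real \<Rightarrow> complex mat) \<Rightarrow> ennreal" where
  "I_func N lam j V =
     (\<Sum>m<j. \<Sum>l=j..<N. ennreal (1 / \<bar>lam l - lam m\<bar>) *
        (\<integral>\<^sup>+\<tau>\<in>{0..}. ennreal ((cmod (V \<tau> $$ (m, l)))\<^sup>2) \<partial>lebesgue))"

definition Delta :: "nat \<Rightarrow> (real \<Rightarrow> complex \<Rightarrow> complex mat) \<Rightarrow> real \<Rightarrow> complex \<Rightarrow> complex" where
  "Delta j X t k = Determinant.det (Matrix.mat j j (\<lambda>(m, l). X t k $$ (m, l)))"

definition g_func ::
    "(nat \<Rightarrow> real) \<Rightarrow> nat \<Rightarrow> (real \<Rightarrow> complex \<Rightarrow> complex mat) \<Rightarrow> real \<Rightarrow> complex \<Rightarrow> complex" where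
  "g_func lam j X t k =
     Delta j X t k * exp (- (\<i> * k * complex_of_real t * complex_of_real (\<Sum>m<j. lam m)))"

definition upper_half :: "complex set" where
  "upper_half = {z. 0 < Im z}"

text \<open>
  Elements of the Hardy spaces are identified with their boundary values: a member is a
  function whose value at almost every real point is the nontangential limit of its values
  on the open upper half-plane. (Values on the lower half-plane are irrelevant.)
\<close>

definition boundary_values :: "(complex \<Rightarrow> complex) \<Rightarrow> bool" where
  "boundary_values f \<longleftrightarrow>
     (AE x in lebesgue. \<forall>\<alpha>>0.
        (f \<longlongrightarrow> f (complex_of_real x))
          (at (complex_of_real x) within {z \<in> upper_half. \<bar>Re z - x\<bar> < \<alpha> * Im z}))"

definition Hardy :: "real \<Rightarrow> (complex \<Rightarrow> complex) set" where
  "Hardy p = {f. f holomorphic_on upper_half \<and> boundary_values f \<and>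
     (SUP y\<in>{0<..}. \<integral>\<^sup>+x. ennreal (cmod (f (Complex x y)) powr p) \<partial>lebesgue) < \<infinity>}"

text \<open>For \<open>f \<in> Hardy p\<close> the integral below is finite by Fatou's lemma.\<close>

definition Hardy_norm :: "real \<Rightarrow> (complex \<Rightarrow> complex) \<Rightarrow> real" where
  "Hardy_norm p f = (LINT x|lebesgue. cmod (f (complex_of_real x)) powr p) powr (1 / p)"

definition Hardy_inf :: "(complex \<Rightarrow> complex) set" where
  "Hardy_inf = {f. f holomorphic_on upper_half \<and> boundary_values f \<and> bounded (f ` upper_half)}"

definition Hardy_inf_norm :: "(complex \<Rightarrow> complex) \<Rightarrow> real" where
  "Hardy_inf_norm f = (SUP z\<in>upper_half. cmod (f z))"

end

theory Submission
  imports Defs "HOL-Complex_Analysis.Complex_Analysis" "HOL-Real_Asymp.Real_Asymp"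
begin

text \<open>
  The \<open>j \<times> j\<close> minors of the first \<open>j\<close> columns of \<open>X\<close>, multiplied by
  \<open>exp (- \<i> k t (\<lambda>\<^sub>1 + \<dots> + \<lambda>\<^sub>j))\<close>, solve a system of the same kind on the \<open>j\<close>-th exterior
  power. Its diagonal part is nonnegative and vanishes only at the coordinate \<open>g\<close>, so the norm
  of the solution decreases for \<open>Im k > 0\<close> and is constant for real \<open>k\<close>. Hence \<open>|g| \<le> 1\<close>, and
  playing the dissipation off against \<open>g'\<close> gives \<open>|1 - g(t, k)| \<le> I(V) / Im k\<close>.

  The Poisson formula, multiplied by \<open>\<pi> y\<close> and evaluated at \<open>\<i> y\<close> as \<open>y\<close> tends to infinity, turns
  this bound into \<open>\<integral> Re (1 - g) \<le> \<pi> I(V)\<close> on the line. In the same way Jensen's inequality gives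
  \<open>\<integral> ln |g| \<ge> - \<pi> I(V)\<close>, and M. Riesz' inequality for functions with nonnegative real part gives
  the bound on \<open>1 - g\<close> in \<open>L\<^sup>p\<close>. For real \<open>k\<close> unitarity yields
  \<open>|g(t) - g(s)|\<^sup>2 \<le> 2 Re (1 - g\<^sub>s\<^sub>,\<^sub>t)\<close>, where \<open>g\<^sub>s\<^sub>,\<^sub>t\<close> belongs to the system on \<open>[s, t]\<close>; so \<open>g(t)\<close>
  is Cauchy in \<open>H\<^sup>2\<close>. The nontangential maximal inequality provides the boundary values of the
  limit, and the estimates on the line pass to it by Fatou's lemma.
\<close>

section \<open>Poisson integrals in the half-plane\<close>

text \<open>For each finite time \<open>g t\<close> is entire, hence continuous on the closed
  half-plane and bounded there by 1. The Poisson and Jensen formulas are therefore proved for such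
  functions only, by carrying circles of radius below 1 over with a Cayley map and letting the
  radius tend to 1; no factorisation of Hardy functions is used. The limit has no continuity on the
  line, and this shapes the last part: an \<open>L^2\<close> limit of boundary functions would not
  yet be the nontangential limit of the function inside. Passing to a fast sequence of times makes
  both limits the same function.

  Zeros are handled by truncation: the logarithm is cut off below until after the passage to
  infinite time, and a power of \<open>1 - g\<close> is taken only after adding a small positive
  constant. The constant \<open>C(p)\<close> comes from one pointwise inequality between
  \<open>|z|^p\<close>, \<open>Re z\<close> and \<open>Re z^p\<close> on a half-disc, so it cannot
  depend on the system.

  As \<open>V\<close> is only locally square integrable, derivatives in time exist merely almost
  everywhere; all calculus is done with pairs of a function and the density of its
  increments.\<close>

definition pois :: "real \<Rightarrow> real \<Rightarrow> real" where
  "pois y s = y / (pi * (s\<^sup>2 + y\<^sup>2))"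

lemma pois_nonneg [simp]: "0 < y \<Longrightarrow> 0 \<le> pois y s"
  by (simp add: pois_def)

lemma borel_measurable_pois [measurable]: "pois y \<in> borel_measurable borel"
  unfolding pois_def by measurable

text \<open>Distribution function of the Cauchy law with centre \<open>a\<close> and scale
  \<open>y\<close>, whose density is the Poisson kernel. Read as an angle in units of
  \<open>2 pi\<close>, it is the boundary correspondence of the Cayley map that sends 0 to
  \<open>a + \<i> y\<close>.\<close>

definition cauchy_cdf :: "real \<Rightarrow> real \<Rightarrow> real \<Rightarrow> real" where
  "cauchy_cdf a y s = 1/2 + arctan ((s - a) / y) / pi"

lemma cauchy_cdf_deriv:
  assumes "0 < y"
  shows "(cauchy_cdf a y has_real_derivative pois y (s - a)) (at s)"
proof -
  have "(cauchy_cdf a y has_real_derivative (inverse (1 + ((s - a)/y)\<^sup>2) * (1 / y)) / pi) (at s)"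
    unfolding cauchy_cdf_def using assms
    by (auto intro!: derivative_eq_intros)
  also have "(inverse (1 + ((s - a)/y)\<^sup>2) * (1 / y)) / pi = pois y (s - a)"
  proof -
    have "(1 + ((s - a)/y)\<^sup>2) * y = ((s - a)\<^sup>2 + y\<^sup>2) / y"
      using assms by (simp add: field_simps power2_eq_square)
    then have "inverse ((1 + ((s - a)/y)\<^sup>2) * y) = y / ((s - a)\<^sup>2 + y\<^sup>2)"
      by simp
    then have "inverse (1 + ((s - a)/y)\<^sup>2) * (1 / y) = y / ((s - a)\<^sup>2 + y\<^sup>2)"
      by (simp add: inverse_eq_divide)
    then show ?thesis by (simp add: pois_def)
  qed
  finally show ?thesis .
qed

lemma cauchy_cdf_image:
  assumes "0 < y"
  shows "cauchy_cdf a y ` UNIV = {0<..<1}"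
proof
  show "cauchy_cdf a y ` UNIV \<subseteq> {0<..<1}"
  proof
    fix t assume "t \<in> cauchy_cdf a y ` UNIV"
    then obtain s where t: "t = 1/2 + arctan ((s - a) / y) / pi" by (auto simp: cauchy_cdf_def)
    have "- (pi/2) < arctan ((s - a) / y)" "arctan ((s - a) / y) < pi/2"
      using arctan_lbound arctan_ubound by auto
    then show "t \<in> {0<..<1}" unfolding t by (auto simp: field_simps)
  qed
  show "{0<..<1} \<subseteq> cauchy_cdf a y ` UNIV"
  proof
    fix t :: real assume t: "t \<in> {0<..<1}"
    define s where "s = a + y * tan (pi * (t - 1/2))"
    have "arctan ((s - a) / y) = pi * (t - 1/2)"
    proof -
      have *: "(s - a) / y = tan (pi * (t - 1/2))" using assms by (simp add: s_def)
      have "- (pi/2) < pi * (t - 1/2)" "pi * (t - 1/2) < pi / 2"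
        using t by (auto simp: field_simps)
      then show ?thesis unfolding * by (rule arctan_tan)
    qed
    then have "cauchy_cdf a y s = t" by (simp add: cauchy_cdf_def)
    then show "t \<in> cauchy_cdf a y ` UNIV" by auto
  qed
qed

lemma cauchy_cdf_inj: "0 < y \<Longrightarrow> inj (cauchy_cdf a y)"
  by (auto simp: inj_def cauchy_cdf_def arctan_eq_iff)

definition cayley :: "complex \<Rightarrow> complex" where
  "cayley z = \<i> * (1 + z) / (1 - z)"

text \<open>With \<open>v = arctan ((s - a) / y)\<close> the angle is \<open>pi + 2 v\<close>, so
  the point on the circle is \<open>- e\<close> for \<open>e = cis v * cis v\<close>, and
  \<open>\<i> (1 - e) / (1 + e)\<close> is \<open>tan v\<close> by the half-angle formulas.\<close>

lemma cayley_boundary: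
  assumes "0 < y"
  shows "cis (2 * pi * cauchy_cdf a y s) \<noteq> 1"
    and "of_real a + of_real y * cayley (cis (2 * pi * cauchy_cdf a y s)) = of_real s"
proof -
  define v where "v = arctan ((s - a) / y)"
  have v: "- (pi/2) < v" "v < pi/2" unfolding v_def using arctan_lbound arctan_ubound by auto
  have c0: "cos v > 0" using v by (simp add: cos_gt_zero_pi)
  have tv: "sin v / cos v = (s - a) / y" unfolding v_def using tan_arctan[of "(s-a)/y"] by (simp add: tan_def)
  have e: "cis (2 * pi * cauchy_cdf a y s) = - (cis v * cis v)"
  proof -
    have "2 * pi * cauchy_cdf a y s = pi + (v + v)" by (simp add: cauchy_cdf_def v_def field_simps)
    then have "cis (2 * pi * cauchy_cdf a y s) = cis pi * (cis v * cis v)" by (metis cis_mult)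
    then show ?thesis by simp
  qed
  have cc: "cis v * cis (-v) = 1" by (simp add: cis_mult)
  have p: "1 + cis v * cis v = cis v * of_real (2 * cos v)"
  proof -
    have "1 + cis v * cis v = cis v * (cis (-v) + cis v)" using cc by (simp add: algebra_simps)
    also have "cis (-v) + cis v = of_real (2 * cos v)" by (simp add: complex_eq_iff)
    finally show ?thesis .
  qed
  have m: "1 - cis v * cis v = - cis v * (\<i> * of_real (2 * sin v))"
  proof -
    have "1 - cis v * cis v = cis v * (cis (-v) - cis v)" using cc by (simp add: algebra_simps)
    also have "cis (-v) - cis v = - (\<i> * of_real (2 * sin v))" by (simp add: complex_eq_iff)
    finally show ?thesis by simp
  qed
  show "cis (2 * pi * cauchy_cdf a y s) \<noteq> 1"
  proof
    assume "cis (2 * pi * cauchy_cdf a y s) = 1"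
    then have "cis v * cis v = - 1" using e by (simp add: minus_equation_iff)
    then have "1 + cis v * cis v = 0" by simp
    then show False using p c0 by simp
  qed
  have "cayley (cis (2 * pi * cauchy_cdf a y s)) = \<i> * (1 - cis v * cis v) / (1 + cis v * cis v)"
    by (simp add: cayley_def e)
  also have "\<dots> = of_real (sin v / cos v)"
    unfolding p m using c0 by (simp add: field_simps)
  finally show "of_real a + of_real y * cayley (cis (2 * pi * cauchy_cdf a y s)) = of_real s"
    unfolding tv using assms by (simp add: field_simps)
qed

lemma Im_cayley:
  assumes "z \<noteq> 1"
  shows "Im (cayley z) = (1 - (cmod z)\<^sup>2) / (cmod (1 - z))\<^sup>2"
proof -
  have "cayley z = \<i> * (1 + z) * cnj (1 - z) / of_real ((cmod (1 - z))\<^sup>2)"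
    unfolding cayley_def by (subst complex_div_cnj) simp
  also have "Im \<dots> = Im (\<i> * (1 + z) * cnj (1 - z)) / (cmod (1 - z))\<^sup>2"
    by (rule Im_divide_of_real)
  also have "Im (\<i> * (1 + z) * cnj (1 - z)) = 1 - (cmod z)\<^sup>2"
    by (simp add: cmod_power2 algebra_simps) (simp add: power2_eq_square)
  finally show ?thesis .
qed


section \<open>Circle means and the Poisson formula\<close>

lemma disc_mean_Re:
  assumes "continuous_on (cball 0 r) F" "F holomorphic_on ball 0 r" "0 < r"
  shows "((\<lambda>t. Re (F (of_real r * cis (2 * pi * t)))) has_integral Re (F 0)) {0..1}"
proof -
  have "((\<lambda>u. F u / (u - 0)) has_contour_integral 2 * complex_of_real pi * \<i> * F 0) (circlepath 0 r)"
    using assms by (intro Cauchy_integral_circlepath) auto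
  then have "((\<lambda>t. F (circlepath 0 r t) / circlepath 0 r t * vector_derivative (circlepath 0 r) (at t within {0..1})) 
      has_integral 2 * complex_of_real pi * \<i> * F 0) {0..1}"
    by (simp add: has_contour_integral_def)
  then have "((\<lambda>t. (2 * pi * \<i>) * F (of_real r * cis (2 * pi * t))) has_integral 2 * complex_of_real pi * \<i> * F 0) {0..1}"
  proof (rule has_integral_eq[rotated])
    fix t :: real assume t: "t \<in> {0..1}"
    have e: "exp (2 * complex_of_real pi * \<i> * complex_of_real t) = cis (2 * pi * t)"
      by (simp add: cis_conv_exp mult_ac)
    show "F (circlepath 0 r t) / circlepath 0 r t * vector_derivative (circlepath 0 r) (at t within {0..1}) =
        (2 * pi * \<i>) * F (of_real r * cis (2 * pi * t))"
      using t \<open>0 < r\<close> by (subst vector_derivative_circlepath01) (auto simp: circlepath e)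
  qed
  then have "((\<lambda>t. inverse (2 * pi * \<i>) * ((2 * pi * \<i>) * F (of_real r * cis (2 * pi * t)))) has_integral 
      inverse (2 * pi * \<i>) * (2 * complex_of_real pi * \<i> * F 0)) {0..1}"
    by (rule has_integral_mult_right)
  then have "((\<lambda>t. F (of_real r * cis (2 * pi * t))) has_integral F 0) {0..1}"
    by (simp add: field_simps)
  from has_integral_linear[OF this bounded_linear_Re] show ?thesis by (simp add: o_def)
qed

text \<open>The Cayley transform sends 1 to infinity and 0 to \<open>a + \<i> y\<close>.\<close>

definition kpt :: "real \<Rightarrow> real \<Rightarrow> real \<Rightarrow> real \<Rightarrow> complex" where
  "kpt a y r t = of_real a + of_real y * cayley (of_real r * cis (2 * pi * t))"

lemma kpt_boundary: "0 < y \<Longrightarrow> kpt a y 1 (cauchy_cdf a y s) = of_real s"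
  using cayley_boundary(2)[of y a s] by (simp add: kpt_def)

lemma cis_neq_1:
  assumes "0 < t" "t < 1" shows "cis (2 * pi * t) \<noteq> 1"
proof -
  have "t \<in> cauchy_cdf 0 1 ` UNIV" using assms cauchy_cdf_image[of 1 0] by auto
  then show ?thesis using cayley_boundary(1)[of 1 0] by auto
qed

text \<open>The Poisson kernel is the derivative of \<open>cauchy_cdf\<close>, so substitution turns
  Lebesgue measure on the angles in \<open>(0, 1)\<close> into the kernel on the line, and circle
  means into Poisson integrals.\<close>

lemma pois_change_of_variables:
  fixes G :: "real \<Rightarrow> real"
  assumes y: "0 < y" and G: "G absolutely_integrable_on {0<..<1}"
  shows "integrable lebesgue (\<lambda>s. G (cauchy_cdf a y s) * pois y (s - a))"
    and "(LINT s|lebesgue. G (cauchy_cdf a y s) * pois y (s - a)) = integral {0<..<1} G"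
proof -
  have *: "(\<lambda>s. \<bar>pois y (s - a)\<bar> * G (cauchy_cdf a y s)) absolutely_integrable_on UNIV \<and>
    integral UNIV (\<lambda>s. \<bar>pois y (s - a)\<bar> * G (cauchy_cdf a y s)) = integral {0<..<1} G"
    using has_absolute_integral_change_of_variables_1'[of UNIV "cauchy_cdf a y" "\<lambda>s. pois y (s - a)" G "integral {0<..<1} G"]
      cauchy_cdf_deriv[OF y] cauchy_cdf_inj[OF y] G cauchy_cdf_image[OF y] by auto
  have "(\<lambda>s. \<bar>pois y (s - a)\<bar> * G (cauchy_cdf a y s)) = (\<lambda>s. G (cauchy_cdf a y s) * pois y (s - a))"
    using y by (auto simp: fun_eq_iff)
  with * have **: "(\<lambda>s. G (cauchy_cdf a y s) * pois y (s - a)) absolutely_integrable_on UNIV"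
     "integral UNIV (\<lambda>s. G (cauchy_cdf a y s) * pois y (s - a)) = integral {0<..<1} G" by auto
  show i: "integrable lebesgue (\<lambda>s. G (cauchy_cdf a y s) * pois y (s - a))"
    using **(1) by (simp add: set_integrable_def)
  show "(LINT s|lebesgue. G (cauchy_cdf a y s) * pois y (s - a)) = integral {0<..<1} G"
    using **(2) set_lebesgue_integral_eq_integral(2)[OF **(1)] by (simp add: set_lebesgue_integral_def)
qed

definition uhp :: "complex set" where "uhp = {z. 0 \<le> Im z}"

lemma upper_half_subset_uhp: "upper_half \<subseteq> uhp"
  by (auto simp: upper_half_def uhp_def)

lemma of_real_in_uhp [simp]: "of_real s \<in> uhp"
  by (simp add: uhp_def)

lemma cayley_in_upper_half:
  assumes y: "0 < y" and "cmod z < 1"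
  shows "of_real a + of_real y * cayley z \<in> upper_half"
proof -
  have ne: "z \<noteq> 1" using assms(2) by auto
  have "(cmod z)\<^sup>2 < 1" using assms(2) by (simp add: abs_square_less_1)
  then have "0 < Im (cayley z)" unfolding Im_cayley[OF ne] using ne by (intro divide_pos_pos) auto
  then show ?thesis using y by (simp add: upper_half_def)
qed

lemma kpt_in_upper_half:
  assumes "0 < y" "0 \<le> r" "r < 1"
  shows "kpt a y r t \<in> upper_half"
  unfolding kpt_def by (rule cayley_in_upper_half) (use assms in \<open>auto simp: norm_mult\<close>)

lemma kpt_in_uhp_boundary:
  assumes "0 < y" "0 < t" "t < 1"
  shows "kpt a y 1 t \<in> uhp"
proof -
  obtain s where "t = cauchy_cdf a y s" using cauchy_cdf_image[of y a] assms by (auto simp: set_eq_iff image_iff)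
  then show ?thesis using kpt_boundary[OF assms(1)] by simp
qed

text \<open>The common passage from circles to the line, used for real parts, squared moduli and
  truncated logarithms alike. The boundary angle 0 corresponds to infinity, where
  \<open>\<phi>\<close> may have no limit; boundedness and dominated convergence on the open
  interval \<open>(0, 1)\<close> take care of this.\<close>

lemma poisson_limit:
  fixes \<phi> :: "complex \<Rightarrow> real"
  assumes y: "0 < y" and c: "continuous_on uhp \<phi>" and b: "\<And>z. z \<in> uhp \<Longrightarrow> \<bar>\<phi> z\<bar> \<le> M"
  shows "integrable lebesgue (\<lambda>s. \<phi> (of_real s) * pois y (s - a))"
    and "(\<lambda>n. integral {0..1} (\<lambda>t. \<phi> (kpt a y (real (n+1) / real (n+2)) t)))
            \<longlonglongrightarrow> (LINT s|lebesgue. \<phi> (of_real s) * pois y (s - a))"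
proof -
  define r where "r n = real (n+1) / real (n+2)" for n
  have r: "0 \<le> r n" "r n < 1" for n by (auto simp: r_def field_simps)
  have r1: "r \<longlonglongrightarrow> 1" unfolding r_def by real_asymp
  have cont: "continuous_on {0..1} (\<lambda>t. \<phi> (kpt a y (r n) t))" for n
  proof -
    have "of_real (r n) * cis (2 * pi * t) \<noteq> 1" for t
    proof
      assume "of_real (r n) * cis (2 * pi * t) = 1"
      then have "cmod (of_real (r n) * cis (2 * pi * t)) = 1" by simp
      then show False using r[of n] by (simp add: norm_mult)
    qed
    then have "continuous_on {0..1} (kpt a y (r n))"
      unfolding kpt_def cayley_def by (intro continuous_intros) auto
    moreover have "kpt a y (r n) ` {0..1} \<subseteq> uhp"
      using kpt_in_upper_half[OF y r] upper_half_subset_uhp by auto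
    ultimately show ?thesis by (rule continuous_on_compose2[OF c])
  qed
  define G where "G t = \<phi> (kpt a y 1 t)" for t
  have int: "(\<lambda>t. \<phi> (kpt a y (r n) t)) integrable_on {0<..<1}" for n
    using integrable_continuous_real[OF cont] by (simp add: integrable_on_open_interval_real)
  have ku: "kpt a y (r n) t \<in> uhp" for n t
    using kpt_in_upper_half[OF y r] upper_half_subset_uhp by blast
  have inth: "(\<lambda>t::real. M) integrable_on {0<..<1}"
    using integrable_const_ivl[of M "0::real" 1] by (simp add: integrable_on_open_interval_real)
  have bd: "norm (\<phi> (kpt a y (r n) t)) \<le> M" for n t
    using b[OF ku] by simp
  have lim: "(\<lambda>n. \<phi> (kpt a y (r n) t)) \<longlonglongrightarrow> G t" if t: "t \<in> {0<..<1}" for t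
  proof -
    have "(\<lambda>n. kpt a y (r n) t) \<longlonglongrightarrow> kpt a y 1 t"
      unfolding kpt_def cayley_def using cis_neq_1[of t] t
      by (intro tendsto_intros r1) auto
    moreover have "kpt a y 1 t \<in> uhp" using kpt_in_uhp_boundary y t by auto
    moreover have "\<forall>\<^sub>F n in sequentially. kpt a y (r n) t \<in> uhp"
      using ku by simp
    ultimately show ?thesis unfolding G_def by (rule continuous_on_tendsto_compose[OF c])
  qed
  have G: "G integrable_on {0<..<1}" 
    and Gl: "(\<lambda>n. integral {0<..<1} (\<lambda>t. \<phi> (kpt a y (r n) t))) \<longlonglongrightarrow> integral {0<..<1} G"
    using dominated_convergence[OF int inth bd lim] by auto
  have "G absolutely_integrable_on {0<..<1}"
  proof (rule absolutely_integrable_integrable_bound[OF _ G inth])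
    fix t :: real assume "t \<in> {0<..<1}"
    then show "norm (G t) \<le> M" unfolding G_def using b kpt_in_uhp_boundary[OF y] by auto
  qed
  note cv = pois_change_of_variables[OF y this, of a]
  have Gs: "G (cauchy_cdf a y s) = \<phi> (of_real s)" for s
    by (simp only: G_def kpt_boundary[OF y])
  show "integrable lebesgue (\<lambda>s. \<phi> (of_real s) * pois y (s - a))"
    using cv(1) unfolding Gs .
  show "(\<lambda>n. integral {0..1} (\<lambda>t. \<phi> (kpt a y (real (n+1) / real (n+2)) t)))
            \<longlonglongrightarrow> (LINT s|lebesgue. \<phi> (of_real s) * pois y (s - a))"
    using Gl unfolding cv(2)[symmetric] Gs r_def integral_open_interval_real .
qed

lemma holomorphic_on_cayley:
  assumes y: "0 < y" and h: "f holomorphic_on upper_half"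
  shows "(\<lambda>z. f (of_real a + of_real y * cayley z)) holomorphic_on ball 0 1"
proof -
  have "(f \<circ> (\<lambda>z. of_real a + of_real y * cayley z)) holomorphic_on ball 0 1"
  proof (rule holomorphic_on_compose_gen[OF _ h])
    show "(\<lambda>z. of_real a + of_real y * cayley z) holomorphic_on ball 0 1"
      unfolding cayley_def by (intro holomorphic_intros) auto
  qed (use cayley_in_upper_half[OF y] in auto)
  then show ?thesis by (simp add: o_def)
qed

lemma kpt_mean_Re:
  assumes y: "0 < y" and r: "0 < r" "r < 1" and h: "f holomorphic_on upper_half"
  shows "integral {0..1} (\<lambda>t. Re (f (kpt a y r t))) = Re (f (Complex a y))"
proof -
  define F where "F z = f (of_real a + of_real y * cayley z)" for z
  have hF: "F holomorphic_on ball 0 1"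
    unfolding F_def by (rule holomorphic_on_cayley[OF y h])
  have "((\<lambda>t. Re (F (of_real r * cis (2 * pi * t)))) has_integral Re (F 0)) {0..1}"
  proof (rule disc_mean_Re)
    show "F holomorphic_on ball 0 r" using hF by (rule holomorphic_on_subset) (use r in auto)
    show "continuous_on (cball 0 r) F" 
      by (intro holomorphic_on_imp_continuous_on holomorphic_on_subset[OF hF]) (use r in auto)
  qed (use r in auto)
  moreover have "F 0 = f (Complex a y)" 
    by (simp add: F_def cayley_def Complex_eq mult.commute)
  ultimately show ?thesis by (simp add: F_def kpt_def integral_unique)
qed

theorem poisson_Re:
  assumes y: "0 < y" and h: "f holomorphic_on upper_half" and c: "continuous_on uhp f"
    and b: "\<forall>z\<in>uhp. cmod (f z) \<le> M"
  shows "integrable lebesgue (\<lambda>s. Re (f (of_real s)) * pois y (s - a))"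
    and "(LINT s|lebesgue. Re (f (of_real s)) * pois y (s - a)) = Re (f (Complex a y))"
proof -
  have 1: "continuous_on uhp (\<lambda>z. Re (f z))" using c by (intro continuous_intros)
  have 2: "\<bar>Re (f z)\<bar> \<le> M" if "z \<in> uhp" for z using b that abs_Re_le_cmod[of "f z"] by force
  show "integrable lebesgue (\<lambda>s. Re (f (of_real s)) * pois y (s - a))"
    using poisson_limit(1)[OF y 1 2] .
  have "integral {0..1} (\<lambda>t. Re (f (kpt a y (real (n+1) / real (n+2)) t))) = Re (f (Complex a y))" for n
    by (rule kpt_mean_Re[OF y _ _ h]) (auto simp: field_simps)
  with poisson_limit(2)[OF y 1 2, of a] show 
    "(LINT s|lebesgue. Re (f (of_real s)) * pois y (s - a)) = Re (f (Complex a y))"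
    by (simp add: LIMSEQ_const_iff)
qed

lemma pois_integral:
  assumes "0 < y"
  shows "integrable lebesgue (\<lambda>s. pois y (s - a))" "(LINT s|lebesgue. pois y (s - a)) = 1"
proof -
  have *: "(\<lambda>_. 1) holomorphic_on upper_half" "continuous_on uhp (\<lambda>_. 1::complex)" 
      "\<forall>z\<in>uhp. cmod ((\<lambda>_. 1) z) \<le> 1"
    by auto
  from poisson_Re[OF assms *, of a]
  show "integrable lebesgue (\<lambda>s. pois y (s - a))" "(LINT s|lebesgue. pois y (s - a)) = 1"
    unfolding one_complex.simps mult_1 by fast+
qed

section \<open>Jensen's inequality\<close>

lemma periodic_riemann_sum_le:
  fixes h :: "real \<Rightarrow> real"
  assumes c: "continuous_on UNIV h" and per: "\<And>t. h (t + 1) = h t" and e: "0 < e"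
  obtains n where "0 < n" "\<And>t. 0 \<le> t \<Longrightarrow> t \<le> 1 \<Longrightarrow> (\<Sum>j<n. h (t + real j / real n)) / real n \<le> integral {0..1} h + e"
proof -
  have "uniformly_continuous_on {0..2} h"
    by (rule compact_uniformly_continuous[OF continuous_on_subset[OF c]]) auto
  then obtain d where d: "0 < d" "\<And>s t. s \<in> {0..2} \<Longrightarrow> t \<in> {0..2} \<Longrightarrow> dist s t < d \<Longrightarrow> dist (h s) (h t) < e"
    using e unfolding uniformly_continuous_on_def by metis
  obtain n where n: "0 < n" "1 / real n < d" 
    using real_arch_inverse[of d] d(1) by (auto simp: inverse_eq_divide)
  have int: "h integrable_on {a..b}" for a b
    by (rule integrable_continuous_real[OF continuous_on_subset[OF c]]) auto
  \<comment> \<open>The same \<open>n\<close> must serve every starting point \<open>t\<close>,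
    since in Jensen's inequality \<open>t\<close> will be the argument of the boundary point at
    which the maximum principle is applied. Summands are compared with \<open>h\<close> on intervals
    of length \<open>1 / n\<close>; periodicity then moves \<open>{t..t+1}\<close> back to
    \<open>{0..1}\<close>.\<close>
  have "(\<Sum>j<n. h (t + real j / real n)) / real n \<le> integral {0..1} h + e" if t: "0 \<le> t" "t \<le> 1" for t
  proof -
    have "(\<Sum>j<m. h (t + real j / real n)) / real n \<le> integral {t..t + real m / real n} h + e * real m / real n" if "m \<le> n" for m
      using that
    proof (induction m)
      case (Suc m)
      define a b where "a = t + real m / real n" and "b = t + real (Suc m) / real n"
      have ab: "b = a + 1 / real n" using n by (simp add: a_def b_def field_simps)
      have b2: "b \<le> 2" 
      proof -
        have "real (Suc m) / real n \<le> 1" using Suc.prems n by simp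
        then show ?thesis using t by (simp add: b_def)
      qed
      have a0: "t \<le> a" "0 \<le> a" using t n by (auto simp: a_def)
      have "integral {t..b} h = integral {t..a} h + integral {a..b} h"
        by (rule Henstock_Kurzweil_Integration.integral_combine[symmetric]) (use a0 ab int in auto)
      moreover have "integral {a..b} (\<lambda>_. h a - e) \<le> integral {a..b} h"
      proof (rule integral_le)
        fix x assume x: "x \<in> {a..b}"
        have "x \<in> {0..2}" "a \<in> {0..2}" "dist a x < d" using x a0 b2 ab n t by (auto simp: dist_real_def)
        then have "dist (h a) (h x) < e" using d(2) by blast
        then show "h a - e \<le> h x" by (auto simp: dist_real_def)
      qed (use int in auto)
      moreover have "integral {a..b} (\<lambda>_. h a - e) = (h a - e) / real n" 
        using ab n by simp
      moreover have "(\<Sum>j<Suc m. h (t + real j / real n)) / real n = (\<Sum>j<m. h (t + real j / real n)) / real n + h a / real n"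
        by (simp add: a_def add_divide_distrib)
      moreover have "e * real (Suc m) / real n = e * real m / real n + e / real n"
        by (simp add: add_divide_distrib ring_distribs)
      moreover have "(h a - e) / real n = h a / real n - e / real n" by (simp add: diff_divide_distrib)
      ultimately show ?case using Suc unfolding a_def[symmetric] b_def[symmetric] by linarith
    qed simp
    from this[of n] n have "(\<Sum>j<n. h (t + real j / real n)) / real n \<le> integral {t..t+1} h + e"
      by simp
    also have "integral {t..t+1} h = integral {t..1} h + integral {1..t+1} h"
      by (rule Henstock_Kurzweil_Integration.integral_combine[symmetric]) (use t int in auto)
    also have "integral {1..t+1} h = integral {0..t} (\<lambda>x. h (x + 1))"
      using integral_shift_Icc_real[of 0 t h 1] by (simp add: o_def add.commute)
    also have "integral {t..1} h + integral {0..t} (\<lambda>x. h (x + 1)) = integral {0..1} h"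
      using Henstock_Kurzweil_Integration.integral_combine[of 0 t 1 h] t int by (simp add: per)
    finally show ?thesis .
  qed
  with n that show ?thesis by blast
qed

text \<open>
  Jensen's inequality without factoring out zeros: the maximum principle is applied to the
  product of \<open>F\<close> over the \<open>n\<close> rotations by multiples of \<open>2 \<pi> / n\<close>, so that the
  exponent becomes a Riemann sum.
\<close>

lemma jensen_disc:
  assumes c: "continuous_on (cball 0 r) F" and h: "F holomorphic_on ball 0 r" and r: "0 < r"
    and w: "continuous_on (sphere 0 r) w" and le: "\<And>z. cmod z = r \<Longrightarrow> cmod (F z) \<le> exp (w z)"
  shows "cmod (F 0) \<le> exp (integral {0..1} (\<lambda>t. w (of_real r * cis (2 * pi * t))))"
proof -
  define h where "h t = w (of_real r * cis (2 * pi * t))" for t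
  have ch: "continuous_on UNIV h" unfolding h_def
    by (rule continuous_on_compose2[OF w]) (use r in \<open>auto intro!: continuous_intros simp: norm_mult\<close>)
  have per: "h (t + 1) = h t" for t
  proof -
    have "2 * pi * (t + 1) = 2 * pi * t + 2 * pi" by (simp add: algebra_simps)
    then have "cis (2 * pi * (t + 1)) = cis (2 * pi * t) * cis (2 * pi)" by (simp only: cis_mult)
    then show ?thesis by (simp add: h_def)
  qed
  have main: "cmod (F 0) \<le> exp (integral {0..1} h + e)" if e: "0 < e" for e
  proof -
    obtain n where n: "0 < n" and rs: "\<And>t. 0 \<le> t \<Longrightarrow> t \<le> 1 \<Longrightarrow> (\<Sum>j<n. h (t + real j / real n)) / real n \<le> integral {0..1} h + e"
      using periodic_riemann_sum_le[OF ch per e] by blast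
    define \<omega> where "\<omega> j = cis (2 * pi * (real j / real n))" for j
    define G where "G z = (\<Prod>j<n. F (z * \<omega> j))" for z
    have \<omega>: "cmod (\<omega> j) = 1" for j by (simp add: \<omega>_def)
    have "cmod (G 0) \<le> exp (integral {0..1} h + e) ^ n"
    proof (rule maximum_modulus_frontier[of G "cball 0 r"])
      show "G holomorphic_on interior (cball 0 r)"
      proof -
        have "(\<lambda>z. F (z * \<omega> j)) holomorphic_on ball 0 r" for j
        proof -
          have "(F \<circ> (\<lambda>z. z * \<omega> j)) holomorphic_on ball 0 r"
            by (rule holomorphic_on_compose_gen[OF _ assms(2)]) 
              (auto intro!: holomorphic_intros simp: norm_mult \<omega>)
          then show ?thesis by (simp add: o_def)
        qed
        then show ?thesis unfolding G_def by (auto intro!: holomorphic_on_prod)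
      qed
      have "continuous_on (cball 0 r) (\<lambda>z. F (z * \<omega> j))" for j
        by (rule continuous_on_compose2[OF c]) (auto intro!: continuous_intros simp: norm_mult \<omega>)
      then show "continuous_on (closure (cball 0 r)) G" unfolding G_def by (auto intro!: continuous_on_prod)
      fix z :: complex assume "z \<in> frontier (cball 0 r)"
      then have zr: "cmod z = r" using r by (simp add: frontier_cball)
      obtain s where s: "0 \<le> s" "s < 2 * pi" and zs: "z / of_real r = cis s"
      proof -
        have "cmod (z / of_real r) = 1" using zr r by (simp add: norm_divide)
        then obtain s where "0 \<le> s" "s < 2 * pi" "z / of_real r = cis s" 
          using complex_unimodular_polar by (metis cis.ctr complex_eq_iff)
        then show ?thesis using that by blast
      qed
      define t where "t = s / (2 * pi)"
      have t: "0 \<le> t" "t \<le> 1" using s by (auto simp: t_def)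
      have zt: "z * \<omega> j = of_real r * cis (2 * pi * (t + real j / real n))" for j
      proof -
        have "z = of_real r * cis s" using zs r by (simp add: field_simps)
        then show ?thesis by (simp add: \<omega>_def t_def cis_mult algebra_simps)
      qed
      have "cmod (G z) \<le> (\<Prod>j<n. exp (h (t + real j / real n)))"
        unfolding G_def prod_norm[symmetric]
      proof (rule prod_mono, safe)
        fix j
        show "cmod (F (z * \<omega> j)) \<le> exp (h (t + real j / real n))"
          unfolding h_def zt[symmetric] using zr by (intro le) (simp add: norm_mult \<omega>)
      qed simp
      also have "\<dots> = exp (\<Sum>j<n. h (t + real j / real n))" by (simp add: exp_sum)
      also have "\<dots> \<le> exp (real n * (integral {0..1} h + e))"
        using rs[OF t] n by (simp add: field_simps)
      also have "\<dots> = exp (integral {0..1} h + e) ^ n" by (simp add: exp_of_nat_mult)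
      finally show "cmod (G z) \<le> exp (integral {0..1} h + e) ^ n" .
    qed (use r in auto)
    moreover have "cmod (G 0) = cmod (F 0) ^ n" by (simp add: G_def norm_power)
    ultimately show ?thesis using n by (simp add: power_mono_iff)
  qed
  have "((\<lambda>e. exp (integral {0..1} h + e)) \<longlongrightarrow> exp (integral {0..1} h + 0)) (at_right 0)"
    by (intro tendsto_intros)
  moreover have "\<forall>\<^sub>F e in at_right 0. cmod (F 0) \<le> exp (integral {0..1} h + e)"
    using main by (simp add: eventually_at_right_less eventually_at_filter)
  ultimately have "cmod (F 0) \<le> exp (integral {0..1} h + 0)" 
    by (intro tendsto_lowerbound) auto
  then show ?thesis by (simp add: h_def[abs_def])
qed

text \<open>The truncation at \<open>e\<close> makes the majorant of \<open>ln |f|\<close>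
  continuous and bounded on the whole closed half-plane even where \<open>f\<close> vanishes, so
  that its circle means converge. It does no harm to the inequality, which only asks for an upper
  bound of \<open>|f|\<close> on circles.\<close>

theorem jensen_half_plane:
  assumes y: "0 < y" and h: "f holomorphic_on upper_half" and c: "continuous_on uhp f"
    and b: "\<forall>z\<in>uhp. cmod (f z) \<le> 1" and e: "0 < e" "e < 1"
  shows "integrable lebesgue (\<lambda>s. ln (max (cmod (f (of_real s))) e) * pois y (s - a))"
    and "cmod (f (Complex a y)) \<le> exp (LINT s|lebesgue. ln (max (cmod (f (of_real s))) e) * pois y (s - a))"
proof -
  define w where "w z = ln (max (cmod (f z)) e)" for z
  have 1: "continuous_on uhp w" unfolding w_def using e by (intro continuous_intros c) auto
  have 2: "\<bar>w z\<bar> \<le> - ln e" if "z \<in> uhp" for z 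
  proof -
    have m: "0 < max (cmod (f z)) e" "max (cmod (f z)) e \<le> 1" using b that e by auto
    then have "w z \<le> 0" unfolding w_def by (simp add: ln_le_zero_iff)
    moreover have "ln e \<le> w z" unfolding w_def using m e by (subst ln_le_cancel_iff) auto
    ultimately show ?thesis by simp
  qed
  show "integrable lebesgue (\<lambda>s. ln (max (cmod (f (of_real s))) e) * pois y (s - a))"
    using poisson_limit(1)[OF y 1 2] unfolding w_def .
  have "cmod (f (Complex a y)) \<le> exp (integral {0..1} (\<lambda>t. w (kpt a y (real (n+1) / real (n+2)) t)))" for n
  proof -
    define r where "r = real (n+1) / real (n+2)"
    have r: "0 < r" "r < 1" by (auto simp: r_def field_simps)
    define F where "F z = f (of_real a + of_real y * cayley z)" for z
    have sub: "of_real a + of_real y * cayley z \<in> upper_half" if "cmod z < 1" for z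
      using cayley_in_upper_half[OF y that] .
    have hF: "F holomorphic_on ball 0 1"
      unfolding F_def by (rule holomorphic_on_cayley[OF y h])
    have F0: "F 0 = f (Complex a y)" 
      by (simp add: F_def cayley_def Complex_eq mult.commute)
    have "cmod (F 0) \<le> exp (integral {0..1} (\<lambda>t. w (of_real a + of_real y * cayley (of_real r * cis (2 * pi * t)))))"
    proof (rule jensen_disc[of r F "\<lambda>z. w (of_real a + of_real y * cayley z)"])
      show "F holomorphic_on ball 0 r" using hF by (rule holomorphic_on_subset) (use r in auto)
      show "continuous_on (cball 0 r) F" 
        by (intro holomorphic_on_imp_continuous_on holomorphic_on_subset[OF hF]) (use r in auto)
      show "continuous_on (sphere 0 r) (\<lambda>z. w (of_real a + of_real y * cayley z))"
      proof (rule continuous_on_compose2[OF 1])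
        show "continuous_on (sphere 0 r) (\<lambda>z. of_real a + of_real y * cayley z)"
          unfolding cayley_def using r by (intro continuous_intros) auto
        show "(\<lambda>z. of_real a + of_real y * cayley z) ` sphere 0 r \<subseteq> uhp"
          using sub r upper_half_subset_uhp by (auto simp: subset_iff)
      qed
      show "cmod (F z) \<le> exp (w (of_real a + of_real y * cayley z))" for z
        using e by (auto simp: F_def w_def)
    qed fact
    then show ?thesis by (simp only: F0 kpt_def r_def)
  qed
  then have "cmod (f (Complex a y)) \<le> exp (LINT s|lebesgue. w (of_real s) * pois y (s - a))"
    by (intro LIMSEQ_le_const[OF tendsto_exp[OF poisson_limit(2)[OF y 1 2]]]) auto
  then show "cmod (f (Complex a y)) \<le> exp (LINT s|lebesgue. ln (max (cmod (f (of_real s))) e) * pois y (s - a))"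
    unfolding w_def .
qed

text \<open>A constant \<open>k\<close> of modulus at most 1 rotates the square of \<open>f\<close>
  so that its value at the single point \<open>a + \<i> y\<close> has real part
  \<open>(cmod u)^2\<close>. The Poisson formula for the real part of the rotated square then
  suffices, as this real part is at most the squared modulus.\<close>

theorem poisson_cmod_power2:
  assumes y: "0 < y" and h: "f holomorphic_on upper_half" and c: "continuous_on uhp f"
    and b: "\<forall>z\<in>uhp. cmod (f z) \<le> M"
  shows "integrable lebesgue (\<lambda>s. (cmod (f (of_real s)))\<^sup>2 * pois y (s - a))"
    and "(cmod (f (Complex a y)))\<^sup>2 \<le> (LINT s|lebesgue. (cmod (f (of_real s)))\<^sup>2 * pois y (s - a))"
proof -
  have M: "0 \<le> M" using order_trans[OF norm_ge_zero, of "f 0" M] b by (simp add: uhp_def)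
  have 1: "continuous_on uhp (\<lambda>z. (cmod (f z))\<^sup>2)" by (intro continuous_intros c)
  have 2: "\<bar>(cmod (f z))\<^sup>2\<bar> \<le> M\<^sup>2" if "z \<in> uhp" for z using b that by (simp add: power_mono)
  show i: "integrable lebesgue (\<lambda>s. (cmod (f (of_real s)))\<^sup>2 * pois y (s - a))"
    using poisson_limit(1)[OF y 1 2] .
  define u where "u = f (Complex a y)"
  \<comment> \<open>For \<open>u = 0\<close> division by zero gives \<open>k = 0\<close>, which is
    why only \<open>cmod k \<le> 1\<close> is claimed.\<close>
  define k where "k = cnj (u\<^sup>2) / of_real (cmod (u\<^sup>2))"
  have k1: "cmod k \<le> 1" by (simp add: k_def norm_divide norm_power)
  have ku: "Re (k * u\<^sup>2) = (cmod u)\<^sup>2"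
  proof (cases "u = 0")
    case False
    have "k * u\<^sup>2 = of_real (cmod (u\<^sup>2))"
    proof -
      have "k * u\<^sup>2 = (u\<^sup>2 * cnj (u\<^sup>2)) / of_real (cmod (u\<^sup>2))" by (simp add: k_def mult_ac)
      also have "\<dots> = of_real (cmod (u\<^sup>2))" using False
        by (subst complex_norm_square[symmetric]) (simp add: power2_eq_square)
      finally show ?thesis .
    qed
    then show ?thesis by (simp add: norm_power)
  qed (simp add: k_def)
  have b': "\<forall>z\<in>uhp. cmod (k * (f z)\<^sup>2) \<le> M\<^sup>2"
    unfolding norm_mult norm_power using mult_mono[OF k1 2] by simp
  have h': "(\<lambda>z. k * (f z)\<^sup>2) holomorphic_on upper_half" and c': "continuous_on uhp (\<lambda>z. k * (f z)\<^sup>2)"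
    by (intro holomorphic_intros h continuous_intros c)+
  note P = poisson_Re[OF y h' c' b', of a]
  have "(cmod u)\<^sup>2 = (LINT s|lebesgue. Re (k * (f (of_real s))\<^sup>2) * pois y (s - a))"
    using P(2) ku by (simp add: u_def)
  also have "\<dots> \<le> (LINT s|lebesgue. (cmod (f (of_real s)))\<^sup>2 * pois y (s - a))"
  proof (rule integral_mono[OF P(1) i])
    fix s
    have "Re (k * (f (of_real s))\<^sup>2) \<le> cmod (k * (f (of_real s))\<^sup>2)" by (rule complex_Re_le_cmod)
    also have "\<dots> \<le> 1 * (cmod (f (of_real s)))\<^sup>2" unfolding norm_mult norm_power using k1 by (intro mult_right_mono) auto
    finally show "Re (k * (f (of_real s))\<^sup>2) * pois y (s - a) \<le> (cmod (f (of_real s)))\<^sup>2 * pois y (s - a)"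
      using y by (intro mult_right_mono) auto
  qed
  finally show "(cmod (f (Complex a y)))\<^sup>2 \<le> (LINT s|lebesgue. (cmod (f (of_real s)))\<^sup>2 * pois y (s - a))"
    by (simp add: u_def)
qed

text \<open>
  Since \<open>pi * y * pois y s\<close> increases to 1 as \<open>y\<close> tends to infinity, the behaviour of the
  Poisson integral at \<open>\<i> y\<close> controls the integral over the line.
\<close>

lemma nn_integral_le_of_poisson:
  fixes G :: "real \<Rightarrow> real"
  assumes [measurable]: "G \<in> borel_measurable lebesgue" and G0: "\<And>s. 0 \<le> G s"
    and le: "\<And>y. Y < y \<Longrightarrow> 0 < y \<Longrightarrow> (\<integral>\<^sup>+s. ennreal (G s * pois y s) \<partial>lebesgue) \<le> ennreal (c y)"
    and lim: "((\<lambda>y. pi * y * c y) \<longlongrightarrow> L) at_top"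
  shows "(\<integral>\<^sup>+s. ennreal (G s) \<partial>lebesgue) \<le> ennreal L"
proof -
  define y where "y n = real n + max Y 0 + 1" for n
  have y: "0 < y n" "Y < y n" for n by (auto simp: y_def)
  have yt: "filterlim y at_top sequentially" unfolding y_def by real_asymp
  have lim1: "(\<lambda>n. ennreal (G s * (pi * y n * pois (y n) s))) \<longlonglongrightarrow> ennreal (G s)" for s
  proof -
    have "((\<lambda>y. y\<^sup>2 / (s\<^sup>2 + y\<^sup>2)) \<longlongrightarrow> 1) at_top" by real_asymp
    then have "((\<lambda>y. pi * y * pois y s) \<longlongrightarrow> 1) at_top" by (simp add: pois_def power2_eq_square)
    from filterlim_compose[OF this yt] 
    have "(\<lambda>n. G s * (pi * y n * pois (y n) s)) \<longlonglongrightarrow> G s * 1" by (intro tendsto_intros)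
    then show ?thesis by (intro tendsto_ennrealI) simp
  qed
  have [measurable]: "pois v \<in> borel_measurable lebesgue" for v
    using measurable_completion[of "pois v" lborel borel] by simp
  have "(\<integral>\<^sup>+s. ennreal (G s) \<partial>lebesgue) = (\<integral>\<^sup>+s. liminf (\<lambda>n. ennreal (G s * (pi * y n * pois (y n) s))) \<partial>lebesgue)"
    by (intro nn_integral_cong) (use lim1 in \<open>auto intro!: lim_imp_Liminf[symmetric]\<close>)
  also have "\<dots> \<le> liminf (\<lambda>n. \<integral>\<^sup>+s. ennreal (G s * (pi * y n * pois (y n) s)) \<partial>lebesgue)"
    by (intro nn_integral_liminf) measurable
  also have "\<dots> \<le> liminf (\<lambda>n. ennreal (pi * y n * c (y n)))"
  proof (rule Liminf_mono, rule always_eventually, rule allI)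
    fix n
    have "(\<integral>\<^sup>+s. ennreal (G s * (pi * y n * pois (y n) s)) \<partial>lebesgue) 
        = (\<integral>\<^sup>+s. ennreal (pi * y n) * ennreal (G s * pois (y n) s) \<partial>lebesgue)"
      using y[of n] G0 by (intro nn_integral_cong) (simp add: ennreal_mult[symmetric] mult_ac)
    also have "\<dots> = ennreal (pi * y n) * (\<integral>\<^sup>+s. ennreal (G s * pois (y n) s) \<partial>lebesgue)"
      by (intro nn_integral_cmult) measurable
    also have "\<dots> \<le> ennreal (pi * y n) * ennreal (c (y n))"
      using le[OF y(2,1)] by (intro mult_left_mono) auto
    also have "\<dots> = ennreal (pi * y n * c (y n))"
      using y[of n] by (simp add: ennreal_mult')
    finally show "(\<integral>\<^sup>+s. ennreal (G s * (pi * y n * pois (y n) s)) \<partial>lebesgue) \<le> ennreal (pi * y n * c (y n))" .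
  qed
  also have "\<dots> = ennreal L"
    using filterlim_compose[OF lim yt] by (intro lim_imp_Liminf tendsto_ennrealI) auto
  finally show ?thesis .
qed

section \<open>M. Riesz' inequality\<close>

lemma cos_ge_of_abs_le_half_pi:
  assumes "\<bar>t\<bar> \<le> pi/2" shows "1 - 2 * \<bar>t\<bar> / pi \<le> cos t"
proof -
  \<comment> \<open>Concavity keeps the cosine above its chord from \<open>(0, 1)\<close> to
    \<open>(pi/2, 0)\<close>.\<close>
  have "concave_on {0..pi/2} cos"
  proof -
    have "convex_on {0..pi/2} (\<lambda>x. - cos x)"
    proof (rule f''_ge0_imp_convex[of _ _ sin cos])
      show "convex {0..pi/2}" by simp
      show "((\<lambda>x. - cos x) has_real_derivative sin x) (at x)" for x
        by (auto intro!: derivative_eq_intros)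
      show "(sin has_real_derivative cos x) (at x)" for x by (rule DERIV_sin)
      show "0 \<le> cos x" if "x \<in> {0..pi/2}" for x using that by (intro cos_ge_zero) auto
    qed
    then show ?thesis by (simp add: concave_on_def)
  qed
  moreover define u where "u = 2 * \<bar>t\<bar> / pi"
  have u: "0 \<le> u" "u \<le> 1" using assms by (auto simp: u_def field_simps)
  ultimately have "(1 - u) * cos 0 + u * cos (pi/2) \<le> cos ((1 - u) *\<^sub>R 0 + u *\<^sub>R (pi/2))"
    by (intro concave_onD[of "{0..pi/2}" cos u 0 "pi/2"]) auto
  also have "(1 - u) *\<^sub>R 0 + u *\<^sub>R (pi/2) = \<bar>t\<bar>" by (simp add: u_def)
  also have "cos \<bar>t\<bar> = cos t" by (simp add: abs_if)
  finally show ?thesis by (simp add: u_def)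
qed

lemma abs_cos_diff_le: "\<bar>cos x - cos y\<bar> \<le> \<bar>x - y\<bar>" for x y :: real
proof -
  have "\<bar>cos x - cos y\<bar> = 2 * \<bar>sin ((x + y) / 2)\<bar> * \<bar>sin ((y - x) / 2)\<bar>"
    by (simp add: cos_diff_cos abs_mult)
  also have "\<dots> \<le> 2 * 1 * \<bar>(y - x) / 2\<bar>"
    by (intro mult_mono abs_sin_x_le_abs_x) auto
  finally show ?thesis by (simp add: abs_minus_commute)
qed

text \<open>On the imaginary axis \<open>Re z = 0\<close> and the real part of \<open>z^p\<close> is
  \<open>|z|^p cos (p pi / 2)\<close>, a negative multiple; \<open>riesz_B p\<close> is the factor
  that turns its negative into \<open>|z|^p\<close>. Off the axis, with \<open>t\<close> the
  argument of \<open>z\<close>, the loss relative to \<open>|z|^p\<close> is at most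
  \<open>riesz_B p * p * pi / 2 * cos t\<close>, and \<open>|z|^p cos t\<close> is at most
  \<open>3^(p-1) Re z\<close> when \<open>cmod z \<le> 3\<close>. This is
  \<open>riesz_A p\<close>.\<close>

definition riesz_B :: "real \<Rightarrow> real" where "riesz_B p = 1 / - cos (p * pi / 2)"
definition riesz_A :: "real \<Rightarrow> real" where "riesz_A p = riesz_B p * p * pi / 2 * 3 powr (p - 1)"

lemma riesz_B_pos: assumes "1 < p" "p \<le> 2" shows "0 < riesz_B p"
proof -
  have "cos (p * pi / 2) < 0"
  proof -
    have "0 < cos (p * pi / 2 - pi)" using assms by (intro cos_gt_zero_pi) (auto simp: field_simps)
    then show ?thesis by (simp add: cos_diff)
  qed
  then show ?thesis by (simp add: riesz_B_def)
qed

lemma riesz_A_nonneg: assumes "1 < p" "p \<le> 2" shows "0 \<le> riesz_A p"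
  using riesz_B_pos[OF assms] assms by (simp add: riesz_A_def)

text \<open>
  The pointwise inequality behind M. Riesz' theorem for functions with values in the right
  half-plane: near the imaginary axis \<open>z\<^sup>p\<close> has negative real part because \<open>1 < p \<le> 2\<close>.
\<close>

lemma riesz_pointwise:
  assumes p: "1 < p" "p \<le> 2" and z: "0 < Re z" "cmod z \<le> 3"
  shows "cmod z powr p \<le> riesz_A p * Re z - riesz_B p * Re (exp (of_real p * Ln z))"
proof -
  define t where "t = Arg z"
  define B where "B = riesz_B p"
  have B: "0 < B" unfolding B_def by (rule riesz_B_pos[OF p])
  have z0: "z \<noteq> 0" using z by auto
  have t: "\<bar>t\<bar> < pi/2" unfolding t_def using z by (subst Arg_Re_pos) simp
  have zc: "Re z = cmod z * cos t" using rcis_cmod_Arg[of z] by (metis Re_rcis t_def)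
  have ze: "Re (exp (of_real p * Ln z)) = cmod z powr p * cos (p * t)"
  proof -
    have "Ln z = Complex (ln (cmod z)) t" using z0 by (simp add: complex_eq_iff t_def Arg_eq_Im_Ln)
    then show ?thesis using z0 by (simp add: Re_exp powr_def mult.commute)
  qed
  \<comment> \<open>The Lipschitz bound measures the angular distance to the imaginary axis; the
    chord bound turns that distance into \<open>cos t\<close>, that is, into
    \<open>Re z\<close>.\<close>
  have "\<bar>cos (p * \<bar>t\<bar>) - cos (p * (pi / 2))\<bar> \<le> \<bar>p * \<bar>t\<bar> - p * (pi / 2)\<bar>"
    by (rule abs_cos_diff_le)
  also have "\<bar>p * \<bar>t\<bar> - p * (pi / 2)\<bar> = p * (pi/2 - \<bar>t\<bar>)"
    using t p by (simp add: abs_if algebra_simps) 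
  finally have "cos (p * \<bar>t\<bar>) - cos (p * pi / 2) \<le> p * (pi/2 - \<bar>t\<bar>)" by simp
  moreover have "cos (p * \<bar>t\<bar>) = cos (p * t)" by (simp add: abs_if)
  moreover have "p * (pi/2 - \<bar>t\<bar>) \<le> p * pi / 2 * cos t"
  proof -
    have "pi / 2 * (1 - 2 * \<bar>t\<bar> / pi) \<le> pi / 2 * cos t"
      using cos_ge_of_abs_le_half_pi[of t] t by (intro mult_left_mono) auto
    then have "pi / 2 - \<bar>t\<bar> \<le> pi / 2 * cos t" by (simp add: algebra_simps)
    then have "p * (pi / 2 - \<bar>t\<bar>) \<le> p * (pi / 2 * cos t)" using p by (intro mult_left_mono) auto
    then show ?thesis by simp
  qed
  ultimately have "B * cos (p * t) \<le> B * (p * pi / 2 * cos t + cos (p * pi / 2))"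
    using B by (intro mult_left_mono) auto
  moreover have "B * cos (p * pi / 2) = -1" using B by (simp add: B_def riesz_B_def)
  ultimately have 1: "1 \<le> B * p * pi / 2 * cos t - B * cos (p * t)" by (simp add: algebra_simps)
  have c0: "0 \<le> cos t" using t by (intro cos_ge_zero) auto
  have "cmod z powr p * 1 \<le> cmod z powr p * (B * p * pi / 2 * cos t - B * cos (p * t))"
    using 1 by (intro mult_left_mono) auto
  also have "\<dots> = cmod z powr (p - 1) * (B * p * pi / 2 * Re z) - B * Re (exp (of_real p * Ln z))"
    using z0 by (simp add: ze zc powr_diff algebra_simps)
  also have "\<dots> \<le> 3 powr (p - 1) * (B * p * pi / 2 * Re z) - B * Re (exp (of_real p * Ln z))"
    using z p B z0 by (intro diff_right_mono mult_right_mono powr_mono2) auto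
  finally show ?thesis by (simp add: riesz_A_def B_def mult_ac)
qed

text \<open>For \<open>p > 2\<close> the exponent is lowered to 2 through
  \<open>|1 - f|^p \<le> 2^(p-2) |1 - f|^2\<close>, valid because \<open>|1 - f| \<le> 2\<close>.
  The factor \<open>pi\<close> comes from the normalisation of the Poisson kernel.\<close>

definition riesz_C :: "real \<Rightarrow> real" where
  "riesz_C p = pi * (if p \<le> 2 then riesz_A p else 2 powr (p - 2) * riesz_A 2)"

section \<open>Integrals over the line from decay along the imaginary axis\<close>

locale half_plane_bound =
  fixes f :: "complex \<Rightarrow> complex" and J :: real
  assumes hol: "f holomorphic_on upper_half" and cont: "continuous_on uhp f"
    and le1: "\<forall>z\<in>uhp. cmod (f z) \<le> 1"
    and J0: "0 \<le> J"
    and near1: "\<And>y. 0 < y \<Longrightarrow> cmod (1 - f (Complex 0 y)) \<le> J / y"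
begin

lemma meas [measurable]: "(\<lambda>s. f (of_real s)) \<in> borel_measurable lebesgue"
proof -
  have "continuous_on UNIV (\<lambda>s. f (of_real s))"
    by (rule continuous_on_compose2[OF cont]) (auto intro!: continuous_intros)
  then have "(\<lambda>s. f (of_real s)) \<in> borel_measurable lborel"
    by (simp add: borel_measurable_continuous_onI)
  then show ?thesis by (rule measurable_completion)
qed

lemma Re_le1: "Re (f (of_real s)) \<le> 1"
  using bspec[OF le1 of_real_in_uhp[of s]] complex_Re_le_cmod[of "f (of_real s)"] by simp

lemma nn_integral_one_minus_Re:
  "(\<integral>\<^sup>+s. ennreal (Re (1 - f (of_real s))) \<partial>lebesgue) \<le> ennreal (pi * J)"
proof (rule nn_integral_le_of_poisson[where Y = 0 and c = "\<lambda>y. J / y"])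
  show "(\<lambda>s. Re (1 - f (of_real s))) \<in> borel_measurable lebesgue" by measurable
  show "0 \<le> Re (1 - f (of_real s))" for s using Re_le1[of s] by simp
  fix y :: real assume y: "0 < y"
  have b: "\<forall>z\<in>uhp. cmod (1 - f z) \<le> 2"
  proof
    fix z assume "z \<in> uhp"
    then show "cmod (1 - f z) \<le> 2" using le1 norm_triangle_ineq4[of 1 "f z"] by fastforce
  qed
  have h: "(\<lambda>z. 1 - f z) holomorphic_on upper_half" and c: "continuous_on uhp (\<lambda>z. 1 - f z)"
    by (intro holomorphic_intros continuous_intros hol cont)+
  note P = poisson_Re[OF y h c b, of 0]
  have "(\<integral>\<^sup>+s. ennreal (Re (1 - f (of_real s)) * pois y s) \<partial>lebesgue) = 
      ennreal (LINT s|lebesgue. Re (1 - f (of_real s)) * pois y (s - 0))"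
    using P(1) Re_le1 y by (subst nn_integral_eq_integral[symmetric]) auto
  also have "\<dots> = ennreal (Re (1 - f (Complex 0 y)))" unfolding P(2) ..
  also have "\<dots> \<le> ennreal (J / y)"
    using near1[OF y] complex_Re_le_cmod[of "1 - f (Complex 0 y)"] by (intro ennreal_leI) linarith
  finally show "(\<integral>\<^sup>+s. ennreal (Re (1 - f (of_real s)) * pois y s) \<partial>lebesgue) \<le> ennreal (J / y)" .
next
  have "((\<lambda>y::real. pi * J) \<longlongrightarrow> pi * J) at_top" by simp
  then show "((\<lambda>y. pi * y * (J / y)) \<longlongrightarrow> pi * J) at_top"
    by (rule Lim_transform_eventually) (use eventually_gt_at_top[of 0] in eventually_elim, simp)
qed

text \<open>Jensen's inequality at \<open>\<i> y\<close> is useful once \<open>|f|\<close> has a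
  positive lower bound there. The decay supplies \<open>1 - J / y\<close>, positive for
  \<open>y > J\<close> only, hence \<open>Y = J\<close>; and \<open>- ln (1 - J / y)\<close> behaves
  like \<open>J / y\<close>, so the resulting bound does not depend on the truncation level.\<close>

lemma nn_integral_log:
  assumes e: "0 < e" "e < 1"
  shows "(\<integral>\<^sup>+s. ennreal (- ln (max (cmod (f (of_real s))) e)) \<partial>lebesgue) \<le> ennreal (pi * J)"
proof (rule nn_integral_le_of_poisson[where Y = J and c = "\<lambda>y. - ln (1 - J / y)"])
  show "(\<lambda>s. - ln (max (cmod (f (of_real s))) e)) \<in> borel_measurable lebesgue" by measurable
  show nonneg: "0 \<le> - ln (max (cmod (f (of_real s))) e)" for s
  proof -
    have "0 < max (cmod (f (of_real s))) e" "max (cmod (f (of_real s))) e \<le> 1" 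
      using bspec[OF le1 of_real_in_uhp[of s]] e by auto
    then show ?thesis by (simp add: ln_le_zero_iff)
  qed
  fix y :: real assume y: "J < y" "0 < y"
  have Jy: "0 < 1 - J / y" using y by simp
  note P = jensen_half_plane[OF y(2) hol cont le1 e, of 0]
  have "1 - J / y \<le> 1 - cmod (1 - f (Complex 0 y))" using near1[OF y(2)] by simp
  also have "\<dots> \<le> cmod (f (Complex 0 y))"
    using norm_triangle_ineq2[of 1 "1 - f (Complex 0 y)"] by simp
  finally have "1 - J / y \<le> exp (LINT s|lebesgue. ln (max (cmod (f (of_real s))) e) * pois y (s - 0))"
    using P(2) by simp
  then have "ln (1 - J / y) \<le> (LINT s|lebesgue. ln (max (cmod (f (of_real s))) e) * pois y (s - 0))"
    using Jy by (metis exp_le_cancel_iff exp_ln)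
  then have le: "(LINT s|lebesgue. - ln (max (cmod (f (of_real s))) e) * pois y s) \<le> - ln (1 - J / y)"
    by simp
  have int: "integrable lebesgue (\<lambda>s. - ln (max (cmod (f (of_real s))) e) * pois y s)"
    using P(1) by simp
  have "(\<integral>\<^sup>+s. ennreal (- ln (max (cmod (f (of_real s))) e) * pois y s) \<partial>lebesgue) = 
      ennreal (LINT s|lebesgue. - ln (max (cmod (f (of_real s))) e) * pois y s)"
    using nonneg y(2) by (intro nn_integral_eq_integral[OF int] AE_I2 mult_nonneg_nonneg pois_nonneg) auto
  also have "\<dots> \<le> ennreal (- ln (1 - J / y))" using le by (rule ennreal_leI)
  finally show "(\<integral>\<^sup>+s. ennreal (- ln (max (cmod (f (of_real s))) e) * pois y s) \<partial>lebesgue) 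
    \<le> ennreal (- ln (1 - J / y))" .
next
  show "((\<lambda>y. pi * y * - ln (1 - J / y)) \<longlongrightarrow> pi * J) at_top" 
    by real_asymp
qed

text \<open>The pointwise inequality is integrated against the Poisson kernel, which turns both real
  parts into values at \<open>\<i> y\<close>. The term with \<open>Re z^p\<close> contributes order
  \<open>y^(-p)\<close>; after multiplication by \<open>pi y\<close> it vanishes in the limit
  because \<open>p > 1\<close>, so only the term linear in \<open>J\<close> remains.\<close>

lemma nn_integral_powr_le_2:
  assumes p: "1 < p" "p \<le> 2"
  shows "(\<integral>\<^sup>+s. ennreal (cmod (1 - f (of_real s)) powr p) \<partial>lebesgue) \<le> ennreal (pi * riesz_A p * J)"
proof (rule nn_integral_le_of_poisson[where Y = 0 and c = "\<lambda>y. riesz_A p * (J / y) + riesz_B p * (J / y) powr p"])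
  show "(\<lambda>s. cmod (1 - f (of_real s)) powr p) \<in> borel_measurable lebesgue" by measurable
  show "0 \<le> cmod (1 - f (of_real s)) powr p" for s by simp
  fix y :: real assume y: "0 < y"
  note A = riesz_A_nonneg[OF p] and B = riesz_B_pos[OF p]
  define u where "u = f (Complex 0 y)"
  \<comment> \<open>The shift by \<open>d\<close> moves \<open>1 - f\<close>, which may vanish, into
    the open right half-plane, where \<open>Ln\<close> is holomorphic. Together with
    \<open>|1 - f| \<le> 2\<close> the condition \<open>d < 1\<close> accounts for the radius
    3.\<close>
  have main: "(\<integral>\<^sup>+s. ennreal (cmod (1 - f (of_real s)) powr p * pois y s) \<partial>lebesgue) 
      \<le> ennreal (riesz_A p * (J / y + d) + riesz_B p * (J / y + d) powr p)" if d: "0 < d" "d < 1" for d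
  proof -
    define h where "h z = 1 - f z + of_real d" for z
    have Reh: "0 < Re (h z)" if "z \<in> uhp" for z
      using bspec[OF le1 that] complex_Re_le_cmod[of "f z"] d by (simp add: h_def)
    have bh: "\<forall>z\<in>uhp. cmod (h z) \<le> 3"
    proof
      fix z assume that: "z \<in> uhp"
      have "cmod (h z) \<le> cmod (1 - f z) + cmod (of_real d)" unfolding h_def by (rule norm_triangle_ineq)
      also have "cmod (1 - f z) \<le> cmod 1 + cmod (f z)" by (rule norm_triangle_ineq4)
      finally show "cmod (h z) \<le> 3" using bspec[OF le1 that] d by simp
    qed
    have npr: "h z \<notin> \<real>\<^sub>\<le>\<^sub>0" if "z \<in> uhp" for z 
      using Reh[OF that] by (auto simp: complex_nonpos_Reals_iff)
    have hh: "h holomorphic_on upper_half" unfolding h_def by (intro holomorphic_intros hol)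
    have ch: "continuous_on uhp h" unfolding h_def by (intro continuous_intros cont)
    define q where "q z = exp (of_real p * Ln (h z))" for z
    have hq: "q holomorphic_on upper_half" unfolding q_def
      using npr upper_half_subset_uhp by (intro holomorphic_intros hh) auto
    have cq: "continuous_on uhp q" unfolding q_def
      using npr by (intro continuous_intros ch) auto
    have nq: "cmod (q z) = cmod (h z) powr p" if "z \<in> uhp" for z
    proof -
      have "h z \<noteq> 0" using Reh[OF that] by auto
      then show ?thesis by (simp add: q_def norm_exp_eq_Re powr_def mult.commute)
    qed
    have bq: "\<forall>z\<in>uhp. cmod (q z) \<le> 3 powr p"
    proof
      fix z assume z: "z \<in> uhp"
      show "cmod (q z) \<le> 3 powr p" 
        unfolding nq[OF z] using bh z p by (intro powr_mono2) auto
    qed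
    note P1 = poisson_Re[OF y hh ch bh, of 0] and P2 = poisson_Re[OF y hq cq bq, of 0]
    define R where "R s = riesz_A p * (Re (h (of_real s)) * pois y (s - 0)) - riesz_B p * (Re (q (of_real s)) * pois y (s - 0))" for s
    have pw: "cmod (1 - f (of_real s)) powr p * pois y s \<le> R s" for s
    proof -
      \<comment> \<open>Both \<open>Re (1 - f)\<close> and \<open>d\<close> are nonnegative, so the
        shift does not decrease the modulus.\<close>
      have "cmod (1 - f (of_real s)) \<le> cmod (h (of_real s))"
        using Re_le1[of s] d by (auto simp: h_def cmod_def power2_eq_square intro!: real_sqrt_le_mono mult_mono)
      then have "cmod (1 - f (of_real s)) powr p \<le> cmod (h (of_real s)) powr p"
        using p by (intro powr_mono2) auto
      also have "\<dots> \<le> riesz_A p * Re (h (of_real s)) - riesz_B p * Re (q (of_real s))"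
        unfolding q_def by (intro riesz_pointwise[OF p] Reh bspec[OF bh]) simp_all
      finally have "cmod (1 - f (of_real s)) powr p * pois y s
         \<le> (riesz_A p * Re (h (of_real s)) - riesz_B p * Re (q (of_real s))) * pois y s"
        using y by (intro mult_right_mono) auto
      then show ?thesis by (simp add: R_def algebra_simps)
    qed
    have intR: "integrable lebesgue R" unfolding R_def 
      by (intro Bochner_Integration.integrable_diff integrable_mult_right P1(1) P2(1))
    have R0: "0 \<le> R s" for s using pw[of s] y by (meson mult_nonneg_nonneg order_trans powr_ge_zero pois_nonneg)
    have "(\<integral>\<^sup>+s. ennreal (cmod (1 - f (of_real s)) powr p * pois y s) \<partial>lebesgue) \<le> (\<integral>\<^sup>+s. ennreal (R s) \<partial>lebesgue)"
      using pw by (intro nn_integral_mono ennreal_leI)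
    also have "\<dots> = ennreal (LINT s|lebesgue. R s)" using R0 by (intro nn_integral_eq_integral[OF intR]) auto
    also have "(LINT s|lebesgue. R s) = riesz_A p * Re (h (Complex 0 y)) - riesz_B p * Re (q (Complex 0 y))"
      unfolding R_def P1(2)[symmetric] P2(2)[symmetric]
      by (subst Bochner_Integration.integral_diff) (intro integrable_mult_right P1(1) P2(1) | simp)+
    also have "\<dots> \<le> riesz_A p * (J / y + d) + riesz_B p * (J / y + d) powr p"
    proof -
      have Y: "Complex 0 y \<in> uhp" using y by (simp add: uhp_def)
      have 1: "cmod (h (Complex 0 y)) \<le> J / y + d"
        using norm_triangle_ineq[of "1 - f (Complex 0 y)" "of_real d"] near1[OF y] d by (simp add: h_def)
      have "- Re (q (Complex 0 y)) \<le> cmod (q (Complex 0 y))" by (metis abs_Re_le_cmod abs_le_iff)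
      also have "\<dots> \<le> (J / y + d) powr p" unfolding nq[OF Y] using 1 p by (intro powr_mono2) auto
      finally have 2: "- Re (q (Complex 0 y)) \<le> (J / y + d) powr p" .
      have 3: "Re (h (Complex 0 y)) \<le> J / y + d" using 1 complex_Re_le_cmod order_trans by blast
      show ?thesis using mult_left_mono[OF 3 A] mult_left_mono[OF 2, of "riesz_B p"] B by simp
    qed
    finally show ?thesis by (simp add: ennreal_leI)
  qed
  have "((\<lambda>d. ennreal (riesz_A p * (J / y + d) + riesz_B p * (J / y + d) powr p)) \<longlongrightarrow>
      ennreal (riesz_A p * (J / y + 0) + riesz_B p * (J / y + 0) powr p)) (at_right 0)"
    using J0 y p by (intro tendsto_ennrealI tendsto_intros tendsto_powr') 
      (auto intro!: eventually_at_right_less simp: eventually_at_filter)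
  moreover have "\<forall>\<^sub>F d in at_right 0. (\<integral>\<^sup>+s. ennreal (cmod (1 - f (of_real s)) powr p * pois y s) \<partial>lebesgue) 
      \<le> ennreal (riesz_A p * (J / y + d) + riesz_B p * (J / y + d) powr p)"
    unfolding eventually_at_right_field using main by (intro exI[of _ 1]) auto
  ultimately show "(\<integral>\<^sup>+s. ennreal (cmod (1 - f (of_real s)) powr p * pois y s) \<partial>lebesgue) 
      \<le> ennreal (riesz_A p * (J / y) + riesz_B p * (J / y) powr p)"
    using tendsto_lowerbound[of _ _ "at_right (0::real)"] by (fastforce simp: trivial_limit_at_right_real)
next
  have "((\<lambda>y. pi * riesz_A p * J + pi * riesz_B p * J powr p * y powr (1 - p)) \<longlongrightarrow> pi * riesz_A p * J + pi * riesz_B p * J powr p * 0) at_top"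
    using p by (intro tendsto_intros tendsto_neg_powr filterlim_ident) auto
  then show "((\<lambda>y. pi * y * (riesz_A p * (J / y) + riesz_B p * (J / y) powr p)) \<longlongrightarrow> pi * riesz_A p * J) at_top"
    unfolding mult_zero_right add_0_right
  proof (rule Lim_transform_eventually)
    show "\<forall>\<^sub>F y in at_top. pi * riesz_A p * J + pi * riesz_B p * J powr p * y powr (1 - p) = 
        pi * y * (riesz_A p * (J / y) + riesz_B p * (J / y) powr p)"
      using eventually_gt_at_top[of 0]
    proof eventually_elim
      case (elim y)
      then show ?case using J0 by (simp add: powr_divide powr_diff field_simps)
    qed
  qed
qed

end

lemma (in half_plane_bound) nn_integral_powr:
  assumes p: "1 < p"
  shows "(\<integral>\<^sup>+s. ennreal (cmod (1 - f (of_real s)) powr p) \<partial>lebesgue) \<le> ennreal (riesz_C p * J)"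
proof (cases "p \<le> 2")
  case True
  then show ?thesis using nn_integral_powr_le_2[OF p] by (simp add: riesz_C_def)
next
  case False
  have "(\<integral>\<^sup>+s. ennreal (cmod (1 - f (of_real s)) powr p) \<partial>lebesgue) 
     \<le> (\<integral>\<^sup>+s. ennreal (2 powr (p - 2)) * ennreal (cmod (1 - f (of_real s)) powr 2) \<partial>lebesgue)"
  proof (intro nn_integral_mono)
    fix s
    have le2: "cmod (1 - f (of_real s)) \<le> 2" 
      using bspec[OF le1 of_real_in_uhp[of s]] norm_triangle_ineq4[of 1 "f (of_real s)"] by simp
    have "cmod (1 - f (of_real s)) powr p = cmod (1 - f (of_real s)) powr (p - 2) * cmod (1 - f (of_real s)) powr 2"
      by (simp only: powr_add[symmetric]) simp
    also have "\<dots> \<le> 2 powr (p - 2) * cmod (1 - f (of_real s)) powr 2"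
      using le2 False by (intro mult_right_mono powr_mono2) auto
    finally show "ennreal (cmod (1 - f (of_real s)) powr p) \<le> ennreal (2 powr (p - 2)) * ennreal (cmod (1 - f (of_real s)) powr 2)"
      by (simp add: ennreal_mult[symmetric] ennreal_leI)
  qed
  also have "\<dots> = ennreal (2 powr (p - 2)) * (\<integral>\<^sup>+s. ennreal (cmod (1 - f (of_real s)) powr 2) \<partial>lebesgue)"
    by (intro nn_integral_cmult) measurable
  also have "\<dots> \<le> ennreal (2 powr (p - 2)) * ennreal (pi * riesz_A 2 * J)"
    by (intro mult_left_mono nn_integral_powr_le_2) auto
  also have "\<dots> = ennreal (riesz_C p * J)" 
    using False J0 riesz_A_nonneg[of 2] by (simp add: riesz_C_def ennreal_mult[symmetric] mult_ac)
  finally show ?thesis .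
qed

section \<open>The nontangential maximal function\<close>

lemma borel_measurable_on_real_axis:
  assumes "continuous_on uhp f"
  shows "(\<lambda>s. f (of_real s)) \<in> borel_measurable borel"
    and "(\<lambda>s. f (of_real s)) \<in> borel_measurable lebesgue"
proof -
  have "continuous_on UNIV (\<lambda>s. f (of_real s))"
    by (rule continuous_on_compose2[OF assms]) (auto intro!: continuous_intros)
  then show "(\<lambda>s. f (of_real s)) \<in> borel_measurable borel"
    by (simp add: borel_measurable_continuous_onI)
  then show "(\<lambda>s. f (of_real s)) \<in> borel_measurable lebesgue" 
    by (intro measurable_completion) simp
qed

lemma cball_lebesgue_measurable [measurable]: "cball x h \<in> sets lebesgue" for x :: real
  using sets_completionI_sets[of "cball x h" lborel] by simp

text \<open>The exceptional set is the countable union of fivefold Vitali balls covering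
  \<open>E\<close>, so \<open>E\<close> itself never has to be measured. A selected ball of radius
  \<open>r\<close> carries mass above \<open>2 * r * \<mu>\<close>, its enlargement has length
  \<open>10 * r\<close>, and disjointness bounds the total mass by \<open>A\<close>; this gives
  \<open>5 * A / \<mu>\<close>.\<close>

lemma hardy_littlewood_weak_type:
  fixes u :: "real \<Rightarrow> ennreal"
  assumes [measurable]: "u \<in> borel_measurable lebesgue" and A: "(\<integral>\<^sup>+s. u s \<partial>lebesgue) \<le> ennreal A" 
    and A0: "0 \<le> A" and lam: "0 < \<mu>"
  obtains B where "B \<in> sets lebesgue" "emeasure lebesgue B \<le> ennreal (5 * A / \<mu>)"
    "\<And>x h. x \<notin> B \<Longrightarrow> 0 < h \<Longrightarrow> (\<integral>\<^sup>+s. u s * indicator (cball x h) s \<partial>lebesgue) \<le> ennreal (2 * h * \<mu>)"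
proof -
  define E where "E = {x. \<exists>h>0. ennreal (2 * h * \<mu>) < (\<integral>\<^sup>+s. u s * indicator (cball x h) s \<partial>lebesgue)}"
  define r where "r x = (SOME h. 0 < h \<and> ennreal (2 * h * \<mu>) < (\<integral>\<^sup>+s. u s * indicator (cball x h) s \<partial>lebesgue))" for x
  have r: "0 < r x" "ennreal (2 * r x * \<mu>) < (\<integral>\<^sup>+s. u s * indicator (cball x (r x)) s \<partial>lebesgue)" if "x \<in> E" for x
    using someI_ex[of "\<lambda>h. 0 < h \<and> ennreal (2 * h * \<mu>) < (\<integral>\<^sup>+s. u s * indicator (cball x h) s \<partial>lebesgue)"] that
    unfolding r_def E_def by auto
  have rb: "r x \<le> A / (2 * \<mu>)" if "x \<in> E" for x
  proof -
    have "(\<integral>\<^sup>+s. u s * indicator (cball x (r x)) s \<partial>lebesgue) \<le> (\<integral>\<^sup>+s. u s \<partial>lebesgue)"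
      by (intro nn_integral_mono) (auto simp: indicator_def)
    then have "ennreal (2 * r x * \<mu>) \<le> ennreal A" using r(2)[OF that] A by (meson le_less_trans less_imp_le order_trans)
    then have "2 * r x * \<mu> \<le> A" using A0 by (simp add: ennreal_le_iff)
    then show ?thesis using lam by (simp add: field_simps)
  qed
  obtain C where C: "countable C" "C \<subseteq> E" "pairwise (\<lambda>i j. disjnt (cball i (r i)) (cball j (r j))) C"
     "E \<subseteq> (\<Union>i\<in>C. cball i (5 * r i))"
    by (rule Vitali_covering_lemma_cballs[where S = E and K = E and a = "\<lambda>i. i" and r = r and B = "A / (2 * \<mu>)"]) (use r(1) rb in force)+
  define B where "B = (\<Union>i\<in>C. cball i (5 * r i))"
  have mB [measurable]: "B \<in> sets lebesgue" unfolding B_def using C(1) by (intro sets.countable_UN'') auto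
  have "ennreal (2 * \<mu>) * (\<integral>\<^sup>+i. ennreal (r i) \<partial>count_space C) = (\<integral>\<^sup>+i. ennreal (2 * \<mu>) * ennreal (r i) \<partial>count_space C)"
    by (rule nn_integral_cmult[symmetric]) simp
  also have "\<dots> \<le> (\<integral>\<^sup>+i. (\<integral>\<^sup>+s. u s * indicator (cball i (r i)) s \<partial>lebesgue) \<partial>count_space C)"
  proof (rule nn_integral_mono)
    fix i assume "i \<in> space (count_space C)"
    then have "i \<in> E" using C(2) by auto
    from r[OF this] show "ennreal (2 * \<mu>) * ennreal (r i) \<le> (\<integral>\<^sup>+s. u s * indicator (cball i (r i)) s \<partial>lebesgue)"
      using lam by (simp add: ennreal_mult[symmetric] mult_ac less_imp_le)
  qed
  \<comment> \<open>Sums over the countable family are integrals over \<open>count_space C\<close>,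
    so that Tonelli exchanges them with the Lebesgue integral; at each \<open>s\<close> at most one
    ball contributes.\<close>
  also have "\<dots> = (\<integral>\<^sup>+s. (\<integral>\<^sup>+i. u s * indicator (cball i (r i)) s \<partial>count_space C) \<partial>lebesgue)"
    by (rule nn_integral_count_space_nn_integral[symmetric]) (use C(1) in measurable)
  also have "\<dots> \<le> (\<integral>\<^sup>+s. u s \<partial>lebesgue)"
  proof (rule nn_integral_mono)
    fix s :: real
    show "(\<integral>\<^sup>+i. u s * indicator (cball i (r i)) s \<partial>count_space C) \<le> u s"
    proof (cases "\<exists>i\<in>C. s \<in> cball i (r i)")
      case True
      then obtain i where i: "i \<in> C" "s \<in> cball i (r i)" by blast
      have "(\<integral>\<^sup>+k. u s * indicator (cball k (r k)) s \<partial>count_space C) = (\<integral>\<^sup>+k. u s * indicator {i} k \<partial>count_space C)"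
      proof (rule nn_integral_cong)
        fix k assume "k \<in> space (count_space C)"
        then have k: "k \<in> C" by simp
        have "s \<in> cball k (r k) \<longleftrightarrow> k = i"
        proof
          assume "s \<in> cball k (r k)"
          then have "\<not> disjnt (cball k (r k)) (cball i (r i))" using i by (auto simp: disjnt_iff)
          then show "k = i" using pairwiseD[OF C(3) k i(1)] by blast
        qed (use i in simp)
        then show "u s * indicator (cball k (r k)) s = u s * indicator {i} k" by (simp add: indicator_def)
      qed
      also have "\<dots> = u s * emeasure (count_space C) {i}" using i by (intro nn_integral_cmult_indicator) auto
      also have "\<dots> = u s" using i by simp
      finally show ?thesis by simp
    next
      case False
      then have "(\<integral>\<^sup>+i. u s * indicator (cball i (r i)) s \<partial>count_space C) = (\<integral>\<^sup>+i. 0 \<partial>count_space C)"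
        by (intro nn_integral_cong) (auto simp: indicator_def)
      then show ?thesis by simp
    qed
  qed
  also have "\<dots> \<le> ennreal A" by fact
  finally have S: "ennreal (2 * \<mu>) * (\<integral>\<^sup>+i. ennreal (r i) \<partial>count_space C) \<le> ennreal A" .
  have "emeasure lebesgue B = (\<integral>\<^sup>+s. indicator B s \<partial>lebesgue)" by simp
  also have "\<dots> \<le> (\<integral>\<^sup>+s. (\<integral>\<^sup>+i. indicator (cball i (5 * r i)) s \<partial>count_space C) \<partial>lebesgue)"
  proof (rule nn_integral_mono)
    fix s :: real
    show "indicator B s \<le> (\<integral>\<^sup>+i. indicator (cball i (5 * r i)) s \<partial>count_space C)"
    proof (cases "s \<in> B")
      case True
      then obtain i where i: "i \<in> C" "s \<in> cball i (5 * r i)" by (auto simp: B_def)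
      have "(1::ennreal) = (\<integral>\<^sup>+k. indicator {i} k \<partial>count_space C)" using i by simp
      also have "\<dots> \<le> (\<integral>\<^sup>+k. indicator (cball k (5 * r k)) s \<partial>count_space C)"
        using i by (intro nn_integral_mono) (auto simp: indicator_def)
      finally show ?thesis using True by simp
    qed simp
  qed
  also have "\<dots> = (\<integral>\<^sup>+i. (\<integral>\<^sup>+s. indicator (cball i (5 * r i)) s \<partial>lebesgue) \<partial>count_space C)"
    by (rule nn_integral_count_space_nn_integral) (use C(1) in measurable)
  also have "\<dots> = (\<integral>\<^sup>+i. ennreal 10 * ennreal (r i) \<partial>count_space C)"
  proof (rule nn_integral_cong)
    fix i assume "i \<in> space (count_space C)"
    then have "0 < r i" using r(1) C(2) by auto
    then show "(\<integral>\<^sup>+s. indicator (cball i (5 * r i)) s \<partial>lebesgue) = ennreal 10 * ennreal (r i)"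
      by (simp add: cball_eq_atLeastAtMost ennreal_mult)
  qed
  also have "\<dots> = ennreal 10 * (\<integral>\<^sup>+i. ennreal (r i) \<partial>count_space C)" by (rule nn_integral_cmult) simp
  also have "\<dots> = ennreal (5 / \<mu>) * (ennreal (2 * \<mu>) * (\<integral>\<^sup>+i. ennreal (r i) \<partial>count_space C))"
    using lam by (simp add: mult.assoc[symmetric] ennreal_mult[symmetric])
  also have "\<dots> \<le> ennreal (5 / \<mu>) * ennreal A" using S by (rule mult_left_mono) simp
  also have "\<dots> = ennreal (5 * A / \<mu>)" using A0 lam by (simp add: ennreal_mult[symmetric])
  finally have mBle: "emeasure lebesgue B \<le> ennreal (5 * A / \<mu>)" .
  show ?thesis
  proof (rule that[OF mB mBle])
    fix x h :: real assume "x \<notin> B" "0 < h"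
    then have "x \<notin> E" using C(4) by (auto simp: B_def)
    then show "(\<integral>\<^sup>+s. u s * indicator (cball x h) s \<partial>lebesgue) \<le> ennreal (2 * h * \<mu>)"
      using \<open>0 < h\<close> unfolding E_def by (auto simp: not_less dest!: spec[of _ h])
  qed
qed

text \<open>With \<open>n\<close> the least index whose ball contains \<open>s\<close>, the distance
  to \<open>x\<close> exceeds \<open>2^(n-1) * y\<close> unless \<open>n = 0\<close>, and the kernel
  is at most the \<open>n\<close>-th coefficient. The factor \<open>4^(-n)\<close> is what beats the
  growth \<open>2^n\<close> of the balls.\<close>

lemma pois_le_dyadic:
  assumes y: "0 < y"
  shows "ennreal (pois y (s - x)) \<le> (\<Sum>n. ennreal (4 / (pi * y) * (1/4)^n) * indicator (cball x (2^n * y)) s)"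
proof -
  have "\<exists>n. \<bar>s - x\<bar> \<le> 2^n * y"
  proof -
    obtain n where "\<bar>s - x\<bar> / y < 2^n" using real_arch_pow[of 2 "\<bar>s - x\<bar> / y"] by auto
    then show ?thesis using y by (intro exI[of _ n]) (simp add: field_simps)
  qed
  define n where "n = (LEAST n. \<bar>s - x\<bar> \<le> 2^n * y)"
  have n: "\<bar>s - x\<bar> \<le> 2^n * y" unfolding n_def by (rule LeastI_ex) fact
  have "pois y (s - x) \<le> 4 / (pi * y) * (1/4)^n"
  proof (cases n)
    case 0
    have "pois y (s - x) \<le> y / (pi * y\<^sup>2)" unfolding pois_def using y by (intro divide_left_mono mult_left_mono) (auto intro!: mult_pos_pos add_nonneg_pos)
    also have "\<dots> \<le> 4 / (pi * y)" using y by (simp add: power2_eq_square field_simps)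
    finally show ?thesis by (simp add: 0)
  next
    case (Suc m)
    have "\<not> \<bar>s - x\<bar> \<le> 2^m * y" using not_less_Least[of m "\<lambda>n. \<bar>s - x\<bar> \<le> 2^n * y"] Suc by (simp add: n_def)
    then have "(2^m * y)\<^sup>2 \<le> (s - x)\<^sup>2" using y by (simp add: abs_le_square_iff[symmetric])
    then have "4^m * y\<^sup>2 \<le> (s - x)\<^sup>2 + y\<^sup>2" 
    proof -
      assume *: "(2^m * y)\<^sup>2 \<le> (s - x)\<^sup>2"
      have "(2^m)\<^sup>2 = (4::real)^m" by (simp add: power2_eq_square power_mult_distrib[symmetric])
      then have "(2^m * y)\<^sup>2 = 4^m * y\<^sup>2" by (simp add: power_mult_distrib)
      with * show ?thesis by (simp add: add_increasing2)
    qed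
    then have "pois y (s - x) \<le> y / (pi * (4^m * y\<^sup>2))" unfolding pois_def using y 
      by (intro divide_left_mono mult_left_mono) (auto intro!: mult_pos_pos add_nonneg_pos)
    also have "\<dots> = 4 / (pi * y) * (1/4)^n" using y by (simp add: Suc power2_eq_square field_simps power_divide)
    finally show ?thesis .
  qed
  then have "ennreal (pois y (s - x)) \<le> ennreal (4 / (pi * y) * (1/4)^n) * indicator (cball x (2^n * y)) s"
    using n by (simp add: ennreal_leI dist_real_def abs_minus_commute)
  also have "\<dots> = (\<Sum>k\<in>{n}. ennreal (4 / (pi * y) * (1/4)^k) * indicator (cball x (2^k * y)) s)"
    by (simp only: sum.insert[OF finite.emptyI] sum.empty empty_iff not_False_eq_True add_0_right)
  also have "\<dots> \<le> (\<Sum>n. ennreal (4 / (pi * y) * (1/4)^n) * indicator (cball x (2^n * y)) s)"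
    by (rule sum_le_suminf) auto
  finally show ?thesis .
qed

text \<open>The \<open>n\<close>-th dyadic ball contributes \<open>4 / (pi y) * 4^(-n)\<close> times
  at most \<open>2 * 2^n * y * \<mu>\<close>; the geometric series sums to
  \<open>16 * \<mu> / pi\<close>, which is below \<open>6 * \<mu>\<close> as
  \<open>pi > 3\<close>.\<close>

lemma poisson_le_maximal:
  fixes u :: "real \<Rightarrow> ennreal"
  assumes [measurable]: "u \<in> borel_measurable lebesgue" and y: "0 < y" and lam: "0 < \<mu>"
    and le: "\<And>h. 0 < h \<Longrightarrow> (\<integral>\<^sup>+s. u s * indicator (cball x h) s \<partial>lebesgue) \<le> ennreal (2 * h * \<mu>)"
  shows "(\<integral>\<^sup>+s. u s * ennreal (pois y (s - x)) \<partial>lebesgue) \<le> ennreal (6 * \<mu>)"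
proof -
  define c where "c n = 4 / (pi * y) * (1/4)^n" for n :: nat
  have c0: "0 \<le> c n" for n using y by (simp add: c_def)
  have "(\<integral>\<^sup>+s. u s * ennreal (pois y (s - x)) \<partial>lebesgue) \<le> 
      (\<integral>\<^sup>+s. (\<Sum>n. ennreal (c n) * (u s * indicator (cball x (2^n * y)) s)) \<partial>lebesgue)"
  proof (rule nn_integral_mono)
    fix s
    have "u s * ennreal (pois y (s - x)) \<le> u s * (\<Sum>n. ennreal (c n) * indicator (cball x (2^n * y)) s)"
      unfolding c_def by (intro mult_left_mono pois_le_dyadic y) auto
    also have "\<dots> = (\<Sum>n. ennreal (c n) * (u s * indicator (cball x (2^n * y)) s))"
      unfolding ennreal_suminf_cmult[symmetric] by (simp only: mult.left_commute)
    finally show "u s * ennreal (pois y (s - x)) \<le> (\<Sum>n. ennreal (c n) * (u s * indicator (cball x (2^n * y)) s))" .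
  qed
  also have "\<dots> = (\<Sum>n. \<integral>\<^sup>+s. ennreal (c n) * (u s * indicator (cball x (2^n * y)) s) \<partial>lebesgue)"
    by (rule nn_integral_suminf) measurable
  also have "\<dots> = (\<Sum>n. ennreal (c n) * (\<integral>\<^sup>+s. u s * indicator (cball x (2^n * y)) s \<partial>lebesgue))"
    by (intro suminf_cong nn_integral_cmult) measurable
  also have "\<dots> \<le> (\<Sum>n. ennreal (8 * \<mu> / pi * (1/2)^n))"
  proof (rule suminf_le)
    fix n
    have "ennreal (c n) * (\<integral>\<^sup>+s. u s * indicator (cball x (2^n * y)) s \<partial>lebesgue) \<le> ennreal (c n) * ennreal (2 * (2^n * y) * \<mu>)"
      using y by (intro mult_left_mono le) auto
    also have "\<dots> = ennreal (c n * (2 * (2^n * y) * \<mu>))" using c0 y lam by (simp add: ennreal_mult)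
    also have "c n * (2 * (2^n * y) * \<mu>) = 8 * \<mu> / pi * (1/2)^n"
    proof -
      have "(4::real)^n = 2^n * 2^n" by (simp add: power_mult_distrib[symmetric])
      then show ?thesis using y by (simp add: c_def power_divide field_simps)
    qed
    finally show "ennreal (c n) * (\<integral>\<^sup>+s. u s * indicator (cball x (2^n * y)) s \<partial>lebesgue) \<le> ennreal (8 * \<mu> / pi * (1/2)^n)" .
  qed auto
  also have "\<dots> = ennreal (\<Sum>n. 8 * \<mu> / pi * (1/2)^n)"
    using lam by (intro suminf_ennreal2 summable_mult summable_geometric) auto
  also have "(\<Sum>n. 8 * \<mu> / pi * (1/2::real)^n) = 16 * \<mu> / pi"
    by (subst suminf_mult) (auto simp: suminf_geometric)
  also have "ennreal (16 * \<mu> / pi) \<le> ennreal (6 * \<mu>)"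
  proof (rule ennreal_leI)
    have "16 / pi \<le> 6" using pi_gt3 by (simp add: field_simps)
    then have "16 / pi * \<mu> \<le> 6 * \<mu>" using lam by (intro mult_right_mono) auto
    then show "16 * \<mu> / pi \<le> 6 * \<mu>" by simp
  qed
  finally show ?thesis .
qed

text \<open>A Harnack-type comparison: within a cone over \<open>x\<close> the kernel centred below
  the point may be replaced by the one centred at the vertex, so that a bound at \<open>x\<close>
  controls the entire cone.\<close>

lemma pois_cone:
  assumes "0 < v" "\<bar>a - x\<bar> < \<alpha> * v" "0 < \<alpha>"
  shows "pois v (s - a) \<le> (2 * \<alpha>\<^sup>2 + 2) * pois v (s - x)"
proof -
  have "(a - x)\<^sup>2 \<le> (\<alpha> * v)\<^sup>2" using assms by (simp add: abs_le_square_iff[symmetric])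
  moreover have "(s - x)\<^sup>2 \<le> 2 * (s - a)\<^sup>2 + 2 * (a - x)\<^sup>2"
    using sum_squares_ge_zero[of "s - a - (a - x)" 0] by (simp add: power2_eq_square algebra_simps)
  ultimately have "(s - x)\<^sup>2 + v\<^sup>2 \<le> 2 * (s - a)\<^sup>2 + 2 * \<alpha>\<^sup>2 * v\<^sup>2 + v\<^sup>2" by (simp add: power_mult_distrib)
  also have "\<dots> \<le> (2 * \<alpha>\<^sup>2 + 2) * ((s - a)\<^sup>2 + v\<^sup>2)" by (simp add: algebra_simps)
  finally have *: "(s - x)\<^sup>2 + v\<^sup>2 \<le> (2 * \<alpha>\<^sup>2 + 2) * ((s - a)\<^sup>2 + v\<^sup>2)" .
  have p: "0 < (s - x)\<^sup>2 + v\<^sup>2" "0 < (s - a)\<^sup>2 + v\<^sup>2" using assms by (auto intro!: add_nonneg_pos)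
  have "1 / ((s - a)\<^sup>2 + v\<^sup>2) \<le> (2 * \<alpha>\<^sup>2 + 2) / ((s - x)\<^sup>2 + v\<^sup>2)" using p * by (simp add: field_simps)
  from mult_left_mono[OF this, of "v / pi"] show ?thesis using assms by (simp add: pois_def field_simps)
qed

text \<open>Meant for differences of \<open>g\<close> between two times. The sup bound
  \<open>M\<close> makes the Poisson inequality applicable; the estimates themselves are in terms of
  \<open>A\<close>, which will be small at late times.\<close>

locale hardy2 =
  fixes f :: "complex \<Rightarrow> complex" and M A :: real
  assumes hol: "f holomorphic_on upper_half" and cont: "continuous_on uhp f"
    and bd: "\<forall>z\<in>uhp. cmod (f z) \<le> M"
    and A0: "0 \<le> A"
    and L2: "(\<integral>\<^sup>+s. ennreal ((cmod (f (of_real s)))\<^sup>2) \<partial>lebesgue) \<le> ennreal A"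
begin

lemmas meas_b [measurable] = borel_measurable_on_real_axis(1)[OF cont]
lemmas meas_l [measurable] = borel_measurable_on_real_axis(2)[OF cont]

lemma poisson_le:
  assumes y: "0 < y"
  shows "ennreal ((cmod (f (Complex a y)))\<^sup>2) \<le> (\<integral>\<^sup>+s. ennreal ((cmod (f (of_real s)))\<^sup>2) * ennreal (pois y (s - a)) \<partial>lebesgue)"
proof -
  note P = poisson_cmod_power2[OF y hol cont bd, of a]
  have "ennreal ((cmod (f (Complex a y)))\<^sup>2) \<le> ennreal (LINT s|lebesgue. (cmod (f (of_real s)))\<^sup>2 * pois y (s - a))"
    using P(2) by (rule ennreal_leI)
  also have "\<dots> = (\<integral>\<^sup>+s. ennreal ((cmod (f (of_real s)))\<^sup>2 * pois y (s - a)) \<partial>lebesgue)"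
    using y by (intro nn_integral_eq_integral[OF P(1), symmetric]) auto
  also have "\<dots> = (\<integral>\<^sup>+s. ennreal ((cmod (f (of_real s)))\<^sup>2) * ennreal (pois y (s - a)) \<partial>lebesgue)"
    using y by (intro nn_integral_cong ennreal_mult) auto
  finally show ?thesis .
qed

lemma pointwise_le:
  assumes y: "0 < y"
  shows "(cmod (f (Complex a y)))\<^sup>2 \<le> A / (pi * y)"
proof -
  have "ennreal ((cmod (f (Complex a y)))\<^sup>2) \<le> (\<integral>\<^sup>+s. ennreal ((cmod (f (of_real s)))\<^sup>2) * ennreal (1 / (pi * y)) \<partial>lebesgue)"
  proof (rule order_trans[OF poisson_le[OF y]], intro nn_integral_mono mult_left_mono ennreal_leI)
    fix s
    have "pois y (s - a) \<le> y / (pi * y\<^sup>2)" unfolding pois_def using y by (intro divide_left_mono mult_left_mono) (auto intro!: mult_pos_pos add_nonneg_pos)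
    then show "pois y (s - a) \<le> 1 / (pi * y)" using y by (simp add: power2_eq_square)
  qed simp
  also have "\<dots> = (\<integral>\<^sup>+s. ennreal ((cmod (f (of_real s)))\<^sup>2) \<partial>lebesgue) * ennreal (1 / (pi * y))"
    by (rule nn_integral_multc) measurable
  also have "\<dots> \<le> ennreal A * ennreal (1 / (pi * y))" by (intro mult_right_mono L2) simp
  also have "\<dots> = ennreal (A / (pi * y))" using A0 y by (simp add: ennreal_mult[symmetric])
  finally show ?thesis using A0 y by (simp add: ennreal_le_iff)
qed

text \<open>After Tonelli the kernel is integrated in its centre, where by symmetry it has total
  mass 1. The move to \<open>lborel\<close> makes joint measurability of the integrand a Borel
  question.\<close>

lemma horizontal_le:
  assumes y: "0 < y"
  shows "(\<integral>\<^sup>+a. ennreal ((cmod (f (Complex a y)))\<^sup>2) \<partial>lebesgue) \<le> ennreal A"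
proof -
  have "(\<integral>\<^sup>+a. ennreal ((cmod (f (Complex a y)))\<^sup>2) \<partial>lebesgue) 
    \<le> (\<integral>\<^sup>+a. (\<integral>\<^sup>+s. ennreal ((cmod (f (of_real s)))\<^sup>2) * ennreal (pois y (s - a)) \<partial>lebesgue) \<partial>lebesgue)"
    by (intro nn_integral_mono poisson_le y)
  also have "\<dots> = (\<integral>\<^sup>+a. (\<integral>\<^sup>+s. ennreal ((cmod (f (of_real s)))\<^sup>2) * ennreal (pois y (s - a)) \<partial>lborel) \<partial>lborel)"
    by (simp add: nn_integral_completion)
  also have "\<dots> = (\<integral>\<^sup>+s. (\<integral>\<^sup>+a. ennreal ((cmod (f (of_real s)))\<^sup>2) * ennreal (pois y (s - a)) \<partial>lborel) \<partial>lborel)"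
    by (rule lborel_pair.Fubini') measurable
  also have "\<dots> = (\<integral>\<^sup>+s. ennreal ((cmod (f (of_real s)))\<^sup>2) * (\<integral>\<^sup>+a. ennreal (pois y (s - a)) \<partial>lborel) \<partial>lborel)"
    by (intro nn_integral_cong nn_integral_cmult) measurable
  also have "\<dots> = (\<integral>\<^sup>+s. ennreal ((cmod (f (of_real s)))\<^sup>2) \<partial>lborel)"
  proof (intro nn_integral_cong)
    fix s
    have "(\<integral>\<^sup>+a. ennreal (pois y (s - a)) \<partial>lborel) = (\<integral>\<^sup>+a. ennreal (pois y (a - s)) \<partial>lborel)"
      by (simp add: pois_def power2_commute)
    also have "\<dots> = (\<integral>\<^sup>+a. ennreal (pois y (a - s)) \<partial>lebesgue)" by (simp add: nn_integral_completion)
    also have "\<dots> = ennreal (LINT a|lebesgue. pois y (a - s))"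
      using y by (intro nn_integral_eq_integral pois_integral) auto
    also have "\<dots> = 1" using pois_integral(2)[OF y] by simp
    finally show "ennreal ((cmod (f (of_real s)))\<^sup>2) * (\<integral>\<^sup>+a. ennreal (pois y (s - a)) \<partial>lborel) = ennreal ((cmod (f (of_real s)))\<^sup>2)"
      by simp
  qed
  also have "\<dots> = (\<integral>\<^sup>+s. ennreal ((cmod (f (of_real s)))\<^sup>2) \<partial>lebesgue)" by (simp add: nn_integral_completion)
  finally show ?thesis using L2 by (rule order_trans)
qed

text \<open>The exceptional set is fixed before the aperture \<alpha>, which only enters the bound.
  Hence one null set can later serve all cones at once, as \<open>boundary_values\<close>
  demands.\<close>

lemma nontangential_maximal:
  assumes lam: "0 < \<mu>"
  obtains B where "B \<in> sets lebesgue" "emeasure lebesgue B \<le> ennreal (5 * A / \<mu>)"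
    "\<And>x \<alpha> z. x \<notin> B \<Longrightarrow> 0 < \<alpha> \<Longrightarrow> z \<in> upper_half \<Longrightarrow> \<bar>Re z - x\<bar> < \<alpha> * Im z \<Longrightarrow> (cmod (f z))\<^sup>2 \<le> (2 * \<alpha>\<^sup>2 + 2) * (6 * \<mu>)"
proof -
  have m: "(\<lambda>s. ennreal ((cmod (f (of_real s)))\<^sup>2)) \<in> borel_measurable lebesgue" by measurable
  have "\<exists>B. B \<in> sets lebesgue \<and> emeasure lebesgue B \<le> ennreal (5 * A / \<mu>) \<and>
    (\<forall>x h. x \<notin> B \<longrightarrow> 0 < h \<longrightarrow> 
      (\<integral>\<^sup>+s. ennreal ((cmod (f (of_real s)))\<^sup>2) * indicator (cball x h) s \<partial>lebesgue) \<le> ennreal (2 * h * \<mu>))"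
    by (rule hardy_littlewood_weak_type[OF m L2 A0 lam]) blast
  then obtain B where B: "B \<in> sets lebesgue" "emeasure lebesgue B \<le> ennreal (5 * A / \<mu>)"
    "\<And>x h. x \<notin> B \<Longrightarrow> 0 < h \<Longrightarrow> (\<integral>\<^sup>+s. ennreal ((cmod (f (of_real s)))\<^sup>2) * indicator (cball x h) s \<partial>lebesgue) \<le> ennreal (2 * h * \<mu>)"
    by blast
  show ?thesis
  proof (rule that[OF B(1,2)])
    fix x \<alpha> z assume x: "x \<notin> B" and \<alpha>: "0 < \<alpha>" and z: "z \<in> upper_half" "\<bar>Re z - x\<bar> < \<alpha> * Im z"
    have v: "0 < Im z" using z by (simp add: upper_half_def)
    have "ennreal ((cmod (f z))\<^sup>2) \<le> (\<integral>\<^sup>+s. ennreal ((cmod (f (of_real s)))\<^sup>2) * ennreal (pois (Im z) (s - Re z)) \<partial>lebesgue)"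
      using poisson_le[OF v, of "Re z"] by simp
    also have "\<dots> \<le> (\<integral>\<^sup>+s. ennreal (2 * \<alpha>\<^sup>2 + 2) * (ennreal ((cmod (f (of_real s)))\<^sup>2) * ennreal (pois (Im z) (s - x))) \<partial>lebesgue)"
    proof (rule nn_integral_mono)
      fix s
      have "ennreal ((cmod (f (of_real s)))\<^sup>2) * ennreal (pois (Im z) (s - Re z)) 
        \<le> ennreal ((cmod (f (of_real s)))\<^sup>2) * ennreal ((2 * \<alpha>\<^sup>2 + 2) * pois (Im z) (s - x))"
        using pois_cone[OF v z(2) \<alpha>] by (intro mult_left_mono ennreal_leI) auto
      also have "\<dots> = ennreal (2 * \<alpha>\<^sup>2 + 2) * (ennreal ((cmod (f (of_real s)))\<^sup>2) * ennreal (pois (Im z) (s - x)))"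
        using v by (simp add: ennreal_mult mult_ac)
      finally show "ennreal ((cmod (f (of_real s)))\<^sup>2) * ennreal (pois (Im z) (s - Re z)) 
        \<le> ennreal (2 * \<alpha>\<^sup>2 + 2) * (ennreal ((cmod (f (of_real s)))\<^sup>2) * ennreal (pois (Im z) (s - x)))" .
    qed
    also have "\<dots> = ennreal (2 * \<alpha>\<^sup>2 + 2) * (\<integral>\<^sup>+s. ennreal ((cmod (f (of_real s)))\<^sup>2) * ennreal (pois (Im z) (s - x)) \<partial>lebesgue)"
    proof (rule nn_integral_cmult)
      have [measurable]: "(\<lambda>s. pois (Im z) (s - x)) \<in> borel_measurable lebesgue"
        using measurable_completion[of "\<lambda>s. pois (Im z) (s - x)" lborel borel] by simp
      show "(\<lambda>s. ennreal ((cmod (f (of_real s)))\<^sup>2) * ennreal (pois (Im z) (s - x))) \<in> borel_measurable lebesgue"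
        by measurable
    qed
    also have "\<dots> \<le> ennreal (2 * \<alpha>\<^sup>2 + 2) * ennreal (6 * \<mu>)"
      by (intro mult_left_mono poisson_le_maximal v lam B(3)[OF x]) auto
    also have "\<dots> = ennreal ((2 * \<alpha>\<^sup>2 + 2) * (6 * \<mu>))" using lam by (intro ennreal_mult[symmetric]) auto
    finally show "(cmod (f z))\<^sup>2 \<le> (2 * \<alpha>\<^sup>2 + 2) * (6 * \<mu>)"
      using lam by (subst (asm) ennreal_le_iff) auto
  qed
qed

end

text \<open>
  The nontangential maximal inequality makes a rapidly convergent sequence converge uniformly
  on almost every cone, including its vertex; the limit inherits the boundary values.
\<close>

lemma boundary_values_limit:
  fixes F :: "nat \<Rightarrow> complex \<Rightarrow> complex"
  assumes hol: "\<And>n. F n holomorphic_on upper_half" and cont: "\<And>n. continuous_on uhp (F n)"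
    and bd: "\<And>n. \<forall>z\<in>uhp. cmod (F n z) \<le> 1"
    and L2: "\<And>n. (\<integral>\<^sup>+s. ennreal ((cmod (F (Suc n) (of_real s) - F n (of_real s)))\<^sup>2) \<partial>lebesgue) \<le> ennreal ((1/16)^n)"
  shows "boundary_values (\<lambda>z. lim (\<lambda>n. F n z))"
    and "AE x in lebesgue. (\<lambda>n. F n (of_real x)) \<longlonglongrightarrow> lim (\<lambda>n. F n (of_real x))"
proof -
  define D where "D n z = F (Suc n) z - F n z" for n z
  define G where "G z = lim (\<lambda>n. F n z)" for z
  have D: "hardy2 (D n) 2 ((1/16)^n)" for n
  proof
    show "D n holomorphic_on upper_half" unfolding D_def by (intro holomorphic_intros hol)
    show "continuous_on uhp (D n)" unfolding D_def by (intro continuous_intros cont)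
    show "\<forall>z\<in>uhp. cmod (D n z) \<le> 2"
    proof
      fix z assume "z \<in> uhp"
      then show "cmod (D n z) \<le> 2" unfolding D_def
        using norm_triangle_ineq4[of "F (Suc n) z" "F n z"] bspec[OF bd[of n], of z] bspec[OF bd[of "Suc n"], of z] by linarith
    qed
    show "(\<integral>\<^sup>+s. ennreal ((cmod (D n (of_real s)))\<^sup>2) \<partial>lebesgue) \<le> ennreal ((1/16)^n)" unfolding D_def by (rule L2)
  qed simp
  \<comment> \<open>The level \<open>(1/4)^n\<close> balances two summability requirements: the
    exceptional sets have measure at most \<open>5 * (1/4)^n\<close>, enough for Borel-Cantelli, and
    off them \<open>D n\<close> is at most a constant times \<open>(1/2)^n\<close> on the cone,
    enough for the Weierstrass test.\<close>
  have "\<exists>B. B \<in> sets lebesgue \<and> emeasure lebesgue B \<le> ennreal (5 * (1/16)^n / (1/4)^n) \<and> (\<forall>x \<alpha> z. x \<notin> B \<longrightarrow> 0 < \<alpha> \<longrightarrow>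
      z \<in> upper_half \<longrightarrow> \<bar>Re z - x\<bar> < \<alpha> * Im z \<longrightarrow> (cmod (D n z))\<^sup>2 \<le> (2 * \<alpha>\<^sup>2 + 2) * (6 * (1/4)^n))" for n
    by (rule hardy2.nontangential_maximal[OF D[of n], of "(1/4)^n"]) (simp, blast)
  then obtain B where B: "\<And>n. B n \<in> sets lebesgue" "\<And>n. emeasure lebesgue (B n) \<le> ennreal (5 * (1/16)^n / (1/4)^n)"
    "\<And>n x \<alpha> z. x \<notin> B n \<Longrightarrow> 0 < \<alpha> \<Longrightarrow>
      z \<in> upper_half \<Longrightarrow> \<bar>Re z - x\<bar> < \<alpha> * Im z \<Longrightarrow> (cmod (D n z))\<^sup>2 \<le> (2 * \<alpha>\<^sup>2 + 2) * (6 * (1/4)^n)"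
    by metis
  have e: "5 * (1/16)^n / (1/4)^n = 5 * (1/4::real)^n" for n
  proof -
    have "(1/16::real) = 1/4 * (1/4)" by simp
    then have "(1/16::real)^n = (1/4)^n * (1/4)^n" by (simp only: power_mult_distrib)
    then show ?thesis by simp
  qed
  have "AE x in lebesgue. \<forall>\<^sub>F n in sequentially. x \<in> space lebesgue - B n"
  proof (rule borel_cantelli_AE1[OF B(1)])
    show fin: "emeasure lebesgue (B n) < \<infinity>" for n using B(2)[of n] by (simp add: le_less_trans)
    have le: "measure lebesgue (B n) \<le> 5 * (1/4)^n" for n
      using B(2)[of n] unfolding e by (simp add: measure_def enn2real_leI)
    have "summable (\<lambda>n. 5 * (1/4::real)^n)" by (intro summable_mult summable_geometric) simp
    then show "summable (\<lambda>n. measure lebesgue (B n))"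
      by (rule summable_comparison_test'[where N = 0]) (use le in simp)
  qed
  then have good: "AE x in lebesgue. \<exists>m. \<forall>n\<ge>m. x \<notin> B n"
    by eventually_elim (auto simp: eventually_sequentially)
  have cone: "((G \<longlongrightarrow> G (of_real x)) (at (of_real x) within {z \<in> upper_half. \<bar>Re z - x\<bar> < \<alpha> * Im z})) \<and>
      (\<lambda>n. F n (of_real x)) \<longlonglongrightarrow> G (of_real x)"
    if m: "\<forall>n\<ge>m. x \<notin> B n" and \<alpha>: "0 < \<alpha>" for x m \<alpha>
  proof -
    define T where "T = {z \<in> upper_half. \<bar>Re z - x\<bar> < \<alpha> * Im z}"
    define K where "K = sqrt ((2 * \<alpha>\<^sup>2 + 2) * 6)"
    have Kn: "sqrt ((2 * \<alpha>\<^sup>2 + 2) * (6 * (1/4)^n)) = K * (1/2)^n" for n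
    proof -
      have "(1/4::real)^n = ((1/2)^n)\<^sup>2" by (simp add: power2_eq_square power_mult_distrib[symmetric])
      then have "(2 * \<alpha>\<^sup>2 + 2) * (6 * (1/4)^n) = ((2 * \<alpha>\<^sup>2 + 2) * 6) * ((1/2)^n)\<^sup>2" by simp
      then show ?thesis unfolding K_def by (simp only: real_sqrt_mult real_sqrt_abs) simp
    qed
    have DT: "cmod (D n z) \<le> K * (1/2)^n" if "n \<ge> m" "z \<in> T" for n z
      unfolding Kn[symmetric] using B(3)[of x n \<alpha> z] m that \<alpha> by (intro real_le_rsqrt) (auto simp: T_def)
    \<comment> \<open>Each \<open>D n\<close> is continuous up to the line, so its bound on the cone
      extends to the vertex by vertical approach. With the vertex included, the uniform limit on
      \<open>T'\<close> is continuous there, and this continuity is the nontangential limit.\<close>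
    have Dx: "cmod (D n (of_real x)) \<le> K * (1/2)^n" if n: "n \<ge> m" for n
    proof -
      define z where "z k = Complex x (1 / real (Suc k))" for k
      have zl: "z \<longlonglongrightarrow> of_real x" unfolding z_def
        by (intro tendsto_Complex[of _ x _ _ 0, folded complex_of_real_def] tendsto_const LIMSEQ_inverse_real_of_nat[unfolded inverse_eq_divide])
      have zT: "z k \<in> T" for k using \<alpha> by (auto simp: T_def z_def upper_half_def)
      then have zu: "z k \<in> uhp" for k using upper_half_subset_uhp by (auto simp: T_def)
      have "(\<lambda>k. D n (z k)) \<longlonglongrightarrow> D n (of_real x)"
        using hardy2.cont[OF D[of n]] zl zu by (intro continuous_on_tendsto_compose[of uhp "D n"]) auto
      then have "(\<lambda>k. cmod (D n (z k))) \<longlonglongrightarrow> cmod (D n (of_real x))" by (rule tendsto_norm)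
      then show ?thesis by (rule LIMSEQ_le_const2) (use DT[OF n zT] in auto)
    qed
    define T' where "T' = insert (of_real x) T"
    have T'u: "T' \<subseteq> uhp" using upper_half_subset_uhp by (auto simp: T'_def T_def)
    have "uniform_limit T' (\<lambda>n z. \<Sum>i<n. D i z) (\<lambda>z. suminf (\<lambda>i. D i z)) sequentially"
    proof (rule Weierstrass_m_test_ev)
      show "\<forall>\<^sub>F n in sequentially. \<forall>z\<in>T'. norm (D n z) \<le> K * (1/2)^n"
        using DT Dx by (auto simp: eventually_sequentially T'_def)
      show "summable (\<lambda>n. K * (1/2)^n)" by (intro summable_mult summable_geometric) simp
    qed
    moreover have "(\<Sum>i<n. D i z) = F n z - F 0 z" for n z unfolding D_def by (rule sum_lessThan_telescope)
    ultimately have "uniform_limit T' (\<lambda>n z. F n z - F 0 z) (\<lambda>z. suminf (\<lambda>i. D i z)) sequentially" by simp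
    then have "uniform_limit T' (\<lambda>n z. F n z - F 0 z + F 0 z) (\<lambda>z. suminf (\<lambda>i. D i z) + F 0 z) sequentially"
      by (intro uniform_limit_intros)
    then have ul: "uniform_limit T' F (\<lambda>z. suminf (\<lambda>i. D i z) + F 0 z) sequentially" by simp
    have lim: "(\<lambda>n. F n z) \<longlonglongrightarrow> suminf (\<lambda>i. D i z) + F 0 z" if "z \<in> T'" for z
      using tendsto_uniform_limitI[OF ul that] .
    then have Gz: "G z = suminf (\<lambda>i. D i z) + F 0 z" if "z \<in> T'" for z
      unfolding G_def using that by (intro limI) auto
    have "continuous_on T' (\<lambda>z. suminf (\<lambda>i. D i z) + F 0 z)"
      by (rule uniform_limit_theorem[OF _ ul]) (auto intro!: always_eventually continuous_on_subset[OF cont T'u])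
    then have "continuous_on T' G" using Gz by (subst continuous_on_cong[OF refl Gz]) auto
    then have "(G \<longlongrightarrow> G (of_real x)) (at (of_real x) within T')"
      by (auto simp: continuous_on_def T'_def)
    then have "(G \<longlongrightarrow> G (of_real x)) (at (of_real x) within T)"
      by (rule tendsto_within_subset) (auto simp: T'_def)
    moreover have "(\<lambda>n. F n (of_real x)) \<longlonglongrightarrow> G (of_real x)"
      using lim[of "of_real x"] Gz[of "of_real x"] by (simp add: T'_def)
    ultimately show ?thesis by (simp add: T_def)
  qed
  have "boundary_values G" unfolding boundary_values_def
    using good by eventually_elim (use cone in blast)
  then show "boundary_values (\<lambda>z. lim (\<lambda>n. F n z))" unfolding G_def .
  have "AE x in lebesgue. (\<lambda>n. F n (of_real x)) \<longlonglongrightarrow> G (of_real x)"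
    using good by eventually_elim (use cone[of _ _ 1] in auto)
  then show "AE x in lebesgue. (\<lambda>n. F n (of_real x)) \<longlonglongrightarrow> lim (\<lambda>n. F n (of_real x))" unfolding G_def .
qed

section \<open>Locally absolutely continuous functions\<close>

text \<open>Needed for Fubini in the product rule below: densities are Lebesgue but not necessarily
  Borel measurable, so the product is one of two completed measures.\<close>

lemma sigma_finite_lebesgue: "sigma_finite_measure (lebesgue :: real measure)"
proof
  obtain A :: "real set set" where A: "countable A" "A \<subseteq> sets lborel" "\<Union>A = space lborel" "\<forall>a\<in>A. emeasure lborel a \<noteq> \<infinity>"
    using lborel.sigma_finite_countable by blast
  show "\<exists>A::real set set. countable A \<and> A \<subseteq> sets lebesgue \<and> \<Union>A = space lebesgue \<and> (\<forall>a\<in>A. emeasure lebesgue a \<noteq> \<infinity>)"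
    by (intro exI[of _ A]) (use A in \<open>auto simp: subset_iff emeasure_completion\<close>)
qed

interpretation lebesgue: sigma_finite_measure "lebesgue :: real measure"
  by (rule sigma_finite_lebesgue)

interpretation lebesgue_pair: pair_sigma_finite "lebesgue :: real measure" "lebesgue :: real measure" ..

text \<open>\<open>a\<close> is locally absolutely continuous on \<open>[0, \<infinity>)\<close> with \<open>a' = \<alpha>\<close> almost everywhere.\<close>

definition ac_prim :: "(real \<Rightarrow> complex) \<Rightarrow> (real \<Rightarrow> complex) \<Rightarrow> bool" where
  "ac_prim a \<alpha> \<longleftrightarrow> continuous_on {0..} a \<and>
     (\<forall>t\<ge>0. set_integrable lebesgue {0..t} \<alpha> \<and> a t = a 0 + (LINT s:{0..t}|lebesgue. \<alpha> s))"

lemma ac_primD: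
  assumes "ac_prim a \<alpha>"
  shows "continuous_on {0..} a" "0 \<le> t \<Longrightarrow> set_integrable lebesgue {0..t} \<alpha>"
    "0 \<le> t \<Longrightarrow> a t = a 0 + (LINT s:{0..t}|lebesgue. \<alpha> s)"
  using assms unfolding ac_prim_def by blast+

lemma ac_prim_cong:
  assumes "ac_prim a \<alpha>" "\<And>t. 0 \<le> t \<Longrightarrow> a t = b t" "\<And>t. 0 \<le> t \<Longrightarrow> \<alpha> t = \<beta> t"
  shows "ac_prim b \<beta>"
proof -
  have "continuous_on {0..} b" using ac_primD(1)[OF assms(1)] assms(2) by (subst continuous_on_cong[OF refl, of _ b a]) auto
  moreover have "set_integrable lebesgue {0..t} \<beta>" if "0 \<le> t" for t
    using ac_primD(2)[OF assms(1) that] assms(3) by (subst set_integrable_cong[OF refl refl, of _ \<beta> \<alpha>]) auto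
  moreover have "b t = b 0 + (LINT s:{0..t}|lebesgue. \<beta> s)" if "0 \<le> t" for t
  proof -
    have "(LINT s:{0..t}|lebesgue. \<beta> s) = (LINT s:{0..t}|lebesgue. \<alpha> s)"
      by (rule set_lebesgue_integral_cong) (use assms(3) in auto)
    then show ?thesis using ac_primD(3)[OF assms(1) that] assms(2)[OF that] assms(2)[of 0] by simp
  qed
  ultimately show ?thesis unfolding ac_prim_def by blast
qed

lemma ac_prim_const: "ac_prim (\<lambda>_. c) (\<lambda>_. 0)"
  by (simp add: ac_prim_def set_integrable_def set_lebesgue_integral_def)

lemma ac_prim_add:
  assumes "ac_prim a \<alpha>" "ac_prim b \<beta>" shows "ac_prim (\<lambda>t. a t + b t) (\<lambda>t. \<alpha> t + \<beta> t)"
  unfolding ac_prim_def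
proof (intro conjI allI impI)
  show "continuous_on {0..} (\<lambda>t. a t + b t)" by (intro continuous_intros ac_primD(1)[OF assms(1)] ac_primD(1)[OF assms(2)])
  fix t :: real assume t: "0 \<le> t"
  note i = ac_primD(2)[OF assms(1) t] ac_primD(2)[OF assms(2) t]
  show "set_integrable lebesgue {0..t} (\<lambda>t. \<alpha> t + \<beta> t)" using i by (rule set_integral_add(1))
  show "a t + b t = a 0 + b 0 + (LINT s:{0..t}|lebesgue. \<alpha> s + \<beta> s)"
    unfolding set_integral_add(2)[OF i]
    by (subst ac_primD(3)[OF assms(1) t], subst ac_primD(3)[OF assms(2) t]) (simp only: add_ac)
qed

lemma ac_prim_sum:
  assumes "\<And>i. i \<in> S \<Longrightarrow> ac_prim (a i) (\<alpha> i)"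
  shows "ac_prim (\<lambda>t. \<Sum>i\<in>S. a i t) (\<lambda>t. \<Sum>i\<in>S. \<alpha> i t)"
proof (cases "finite S")
  case True
  then show ?thesis using assms
    by (induction S rule: finite_induct) (auto intro: ac_prim_const ac_prim_add)
qed (simp add: ac_prim_const)

lemma lebesgue_set_integral_diff:
  fixes \<alpha> :: "real \<Rightarrow> 'a::{banach, second_countable_topology}"
  assumes "set_integrable lebesgue {0..t} \<alpha>" "0 \<le> r" "r \<le> t"
  shows "(LINT s:{r<..t}|lebesgue. \<alpha> s) = (LINT s:{0..t}|lebesgue. \<alpha> s) - (LINT s:{0..r}|lebesgue. \<alpha> s)"
proof -
  have e: "{0..t} = {0..r} \<union> {r<..t}" using assms by auto
  have "(LINT s:{0..r} \<union> {r<..t}|lebesgue. \<alpha> s) = (LINT s:{0..r}|lebesgue. \<alpha> s) + (LINT s:{r<..t}|lebesgue. \<alpha> s)"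
    by (rule set_integral_Un) (use assms in \<open>auto intro!: set_integrable_subset[OF assms(1)]\<close>)
  then show ?thesis unfolding e[symmetric] by simp
qed

lemma lebesgue_set_integral_open_right:
  fixes \<beta> :: "real \<Rightarrow> complex"
  assumes "set_integrable lebesgue {0..s} \<beta>"
  shows "(LINT r:{0..<s}|lebesgue. \<beta> r) = (LINT r:{0..s}|lebesgue. \<beta> r)"
proof -
  have ne: "AE r in lebesgue. r \<noteq> s" by (intro AE_completion) (rule AE_lborel_singleton)
  show ?thesis unfolding set_lebesgue_integral_def
  proof (rule integral_cong_AE)
    have "set_integrable lebesgue {0..<s} \<beta>" by (rule set_integrable_subset[OF assms]) auto
    then show "(\<lambda>r. indicat_real {0..<s} r *\<^sub>R \<beta> r) \<in> borel_measurable lebesgue" 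
      unfolding set_integrable_def by (rule borel_measurable_integrable)
    show "(\<lambda>r. indicat_real {0..s} r *\<^sub>R \<beta> r) \<in> borel_measurable lebesgue" 
      using assms unfolding set_integrable_def by (rule borel_measurable_integrable)
    show "AE r in lebesgue. indicat_real {0..<s} r *\<^sub>R \<beta> r = indicat_real {0..s} r *\<^sub>R \<beta> r"
      using ne by eventually_elim (auto simp: indicator_def)
  qed
qed

lemma set_integrable_mult_continuous:
  fixes \<alpha> b :: "real \<Rightarrow> complex"
  assumes \<alpha>: "set_integrable lebesgue {0..t} \<alpha>" and b: "continuous_on {0..t} b"
  shows "set_integrable lebesgue {0..t} (\<lambda>s. \<alpha> s * b s)"
proof -
  obtain K where K: "\<And>s. s \<in> {0..t} \<Longrightarrow> norm (b s) \<le> K"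
    using compact_imp_bounded[OF compact_continuous_image[OF b compact_Icc]] unfolding bounded_iff by (metis imageI)
  have mb: "(\<lambda>s. indicat_real {0..t} s *\<^sub>R b s) \<in> borel_measurable lebesgue"
    using absolutely_integrable_continuous_real[OF b] unfolding set_integrable_def by (rule borel_measurable_integrable)
  have m: "(\<lambda>s. indicat_real {0..t} s *\<^sub>R \<alpha> s) \<in> borel_measurable lebesgue"
    using \<alpha> unfolding set_integrable_def by (rule borel_measurable_integrable)
  have i: "integrable lebesgue (\<lambda>s. K * norm (indicat_real {0..t} s *\<^sub>R \<alpha> s))"
    using \<alpha> unfolding set_integrable_def by (intro integrable_mult_right integrable_norm)
  show ?thesis unfolding set_integrable_def
  proof (rule Bochner_Integration.integrable_bound[OF i])
    have "(\<lambda>s. indicat_real {0..t} s *\<^sub>R (\<alpha> s * b s)) = (\<lambda>s. (indicat_real {0..t} s *\<^sub>R \<alpha> s) * (indicat_real {0..t} s *\<^sub>R b s))"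
      by (auto simp: indicator_def)
    then show "(\<lambda>s. indicat_real {0..t} s *\<^sub>R (\<alpha> s * b s)) \<in> borel_measurable lebesgue"
      using borel_measurable_times[OF m mb] by (simp only:)
    have "norm (indicat_real {0..t} s *\<^sub>R (\<alpha> s * b s)) \<le> norm (K * norm (indicat_real {0..t} s *\<^sub>R \<alpha> s))" for s
    proof (cases "s \<in> {0..t}")
      case True
      have "norm (\<alpha> s * b s) \<le> norm (\<alpha> s) * K" unfolding norm_mult by (intro mult_left_mono K True) simp
      then have "norm (\<alpha> s * b s) \<le> \<bar>K\<bar> * norm (\<alpha> s)"
        using abs_ge_self[of K] by (metis abs_norm_cancel abs_mult abs_ge_self mult.commute order_trans)
      then show ?thesis using True by (simp add: norm_mult abs_mult)
    qed simp
    then show "AE s in lebesgue. norm (indicat_real {0..t} s *\<^sub>R (\<alpha> s * b s)) \<le> norm (K * norm (indicat_real {0..t} s *\<^sub>R \<alpha> s))"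
      by simp
  qed
qed

text \<open>Fubini for \<open>\<alpha>' s * \<beta>' r\<close> over the triangle
  \<open>r < s\<close>: one order of integration yields the integral of
  \<open>\<alpha> * (b - b 0)\<close>, the other that of \<open>(a t - a) * \<beta>\<close>.
  Expanding the two gives the product rule without any differentiation almost everywhere.\<close>

lemma ac_prim_mult:
  assumes A: "ac_prim a \<alpha>" and B: "ac_prim b \<beta>"
  shows "ac_prim (\<lambda>t. a t * b t) (\<lambda>t. \<alpha> t * b t + a t * \<beta> t)"
  unfolding ac_prim_def
proof (intro conjI allI impI)
  show "continuous_on {0..} (\<lambda>t. a t * b t)" by (intro continuous_intros ac_primD(1)[OF A] ac_primD(1)[OF B])
  fix t :: real assume t: "0 \<le> t"
  have ca: "continuous_on {0..t} a" and cb: "continuous_on {0..t} b"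
    using ac_primD(1)[OF A] ac_primD(1)[OF B] by (auto elim: continuous_on_subset)
  note ia = ac_primD(2)[OF A t] and ib = ac_primD(2)[OF B t]
  have i1: "set_integrable lebesgue {0..t} (\<lambda>s. \<alpha> s * b s)" by (rule set_integrable_mult_continuous[OF ia cb])
  have i2: "set_integrable lebesgue {0..t} (\<lambda>s. a s * \<beta> s)" 
    using set_integrable_mult_continuous[OF ib ca] by (simp add: mult.commute)
  show "set_integrable lebesgue {0..t} (\<lambda>s. \<alpha> s * b s + a s * \<beta> s)" using i1 i2 by (rule set_integral_add(1))
  define \<alpha>' where "\<alpha>' s = indicat_real {0..t} s *\<^sub>R \<alpha> s" for s
  define \<beta>' where "\<beta>' s = indicat_real {0..t} s *\<^sub>R \<beta> s" for s
  have I\<alpha>: "integrable lebesgue \<alpha>'" and I\<beta>: "integrable lebesgue \<beta>'"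
    using ia ib by (auto simp: \<alpha>'_def[abs_def] \<beta>'_def[abs_def] set_integrable_def)
  have m\<alpha> [measurable]: "\<alpha>' \<in> borel_measurable lebesgue" and m\<beta> [measurable]: "\<beta>' \<in> borel_measurable lebesgue"
    using I\<alpha> I\<beta> by auto
  define H where "H s r = \<alpha>' s * \<beta>' r * indicat_real {p. snd p < fst p} (s, r)" for s r
  have id_borel: "(\<lambda>x. x) \<in> borel_measurable (lebesgue :: real measure)"
    by (rule measurable_completion) simp
  have mP: "{p. snd p < fst p} \<in> sets (lebesgue \<Otimes>\<^sub>M lebesgue :: (real \<times> real) measure)"
  proof -
    have 1: "fst \<in> borel_measurable (lebesgue \<Otimes>\<^sub>M lebesgue :: (real \<times> real) measure)"
      using measurable_compose[OF measurable_fst id_borel, of lebesgue] by (simp add: o_def)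
    have 2: "snd \<in> borel_measurable (lebesgue \<Otimes>\<^sub>M lebesgue :: (real \<times> real) measure)"
      using measurable_compose[OF measurable_snd id_borel, of lebesgue] by (simp add: o_def)
    have "{p \<in> space (lebesgue \<Otimes>\<^sub>M lebesgue :: (real \<times> real) measure). snd p < fst p} \<in> sets (lebesgue \<Otimes>\<^sub>M lebesgue)"
      by (rule borel_measurable_less[OF 2 1])
    then show ?thesis by (simp add: space_pair_measure)
  qed
  have mH: "case_prod H \<in> borel_measurable (lebesgue \<Otimes>\<^sub>M lebesgue)"
  proof -
    have [measurable]: "(\<lambda>p. indicat_real {p. snd p < fst p} p) \<in> borel_measurable (lebesgue \<Otimes>\<^sub>M lebesgue :: (real \<times> real) measure)"
      using mP by (rule borel_measurable_indicator)
    have "(\<lambda>p. \<alpha>' (fst p) * \<beta>' (snd p) * indicat_real {p. snd p < fst p} p) \<in> borel_measurable (lebesgue \<Otimes>\<^sub>M lebesgue)"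
      by measurable
    then show ?thesis by (simp add: H_def case_prod_unfold)
  qed
  have H_int: "integrable lebesgue (\<lambda>r. H s r)" for s
  proof (rule Bochner_Integration.integrable_bound[of _ "\<lambda>r. \<alpha>' s * \<beta>' r"])
    show "integrable lebesgue (\<lambda>r. \<alpha>' s * \<beta>' r)" using I\<beta> by simp
    show "(\<lambda>r. H s r) \<in> borel_measurable lebesgue"
      using measurable_compose[OF measurable_Pair1' mH, of s] by simp
    show "AE r in lebesgue. norm (H s r) \<le> norm (\<alpha>' s * \<beta>' r)" by (simp add: H_def indicator_def norm_mult)
  qed
  have IH: "integrable (lebesgue \<Otimes>\<^sub>M lebesgue) (case_prod H)"
  proof (rule lebesgue_pair.Fubini_integrable[OF mH])
    show "AE s in lebesgue. integrable lebesgue (\<lambda>r. case_prod H (s, r))" using H_int by simp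
    have m: "(\<lambda>s. LINT r|lebesgue. norm (case_prod H (s, r))) \<in> borel_measurable lebesgue"
      by (rule lebesgue.borel_measurable_lebesgue_integral) (use mH in \<open>simp add: case_prod_unfold\<close>)
    show "integrable lebesgue (\<lambda>s. LINT r|lebesgue. norm (case_prod H (s, r)))"
    proof (rule Bochner_Integration.integrable_bound[OF _ m])
      show "integrable lebesgue (\<lambda>s. norm (\<alpha>' s) * (LINT r|lebesgue. norm (\<beta>' r)))" using I\<alpha> by simp
      have "(LINT r|lebesgue. norm (H s r)) \<le> norm (\<alpha>' s) * (LINT r|lebesgue. norm (\<beta>' r))" for s
      proof -
        have "(LINT r|lebesgue. norm (H s r)) \<le> (LINT r|lebesgue. norm (\<alpha>' s) * norm (\<beta>' r))"
          by (intro integral_mono integrable_norm H_int integrable_mult_right I\<beta>) (simp add: H_def indicator_def norm_mult)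
        then show ?thesis by simp
      qed
      then show "AE s in lebesgue. norm (LINT r|lebesgue. norm (case_prod H (s, r))) \<le> norm (norm (\<alpha>' s) * (LINT r|lebesgue. norm (\<beta>' r)))"
        by (simp add: abs_of_nonneg integral_nonneg_AE)
    qed
  qed
  have e1: "(LINT r|lebesgue. H s r) = indicat_real {0..t} s *\<^sub>R (\<alpha> s * (b s - b 0))" for s
  proof (cases "s \<in> {0..t}")
    case True
    then have s: "0 \<le> s" "s \<le> t" by auto
    have "(LINT r|lebesgue. H s r) = (LINT r|lebesgue. \<alpha> s * (indicat_real {0..<s} r *\<^sub>R \<beta> r))"
      by (intro Bochner_Integration.integral_cong) (use s in \<open>auto simp: H_def \<alpha>'_def \<beta>'_def indicator_def\<close>)
    also have "\<dots> = \<alpha> s * (LINT r:{0..<s}|lebesgue. \<beta> r)" unfolding set_lebesgue_integral_def by (rule integral_mult_right_zero)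
    also have "(LINT r:{0..<s}|lebesgue. \<beta> r) = b s - b 0"
      using lebesgue_set_integral_open_right[OF ac_primD(2)[OF B s(1)]] ac_primD(3)[OF B s(1)] by simp
    finally show ?thesis using True by simp
  qed (simp add: H_def \<alpha>'_def)
  have e2: "(LINT s|lebesgue. H s r) = indicat_real {0..t} r *\<^sub>R ((a t - a r) * \<beta> r)" for r
  proof (cases "r \<in> {0..t}")
    case True
    then have r: "0 \<le> r" "r \<le> t" by auto
    have "(LINT s|lebesgue. H s r) = (LINT s|lebesgue. \<beta> r * (indicat_real {r<..t} s *\<^sub>R \<alpha> s))"
      by (intro Bochner_Integration.integral_cong) (use r in \<open>auto simp: H_def \<alpha>'_def \<beta>'_def indicator_def\<close>)
    also have "\<dots> = \<beta> r * (LINT s:{r<..t}|lebesgue. \<alpha> s)" unfolding set_lebesgue_integral_def by (rule integral_mult_right_zero)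
    also have "(LINT s:{r<..t}|lebesgue. \<alpha> s) = a t - a r"
      using lebesgue_set_integral_diff[OF ia r] ac_primD(3)[OF A r(1)] ac_primD(3)[OF A t] by simp
    finally show ?thesis using True by simp
  qed (simp add: H_def \<beta>'_def)
  have "(LINT r|lebesgue. (LINT s|lebesgue. H s r)) = (LINT s|lebesgue. (LINT r|lebesgue. H s r))"
    by (rule lebesgue_pair.Fubini_integral[OF IH])
  then have "(LINT r:{0..t}|lebesgue. (a t - a r) * \<beta> r) = (LINT s:{0..t}|lebesgue. \<alpha> s * (b s - b 0))"
    unfolding e1 e2 set_lebesgue_integral_def .
  moreover have "(LINT r:{0..t}|lebesgue. (a t - a r) * \<beta> r) = a t * (b t - b 0) - (LINT r:{0..t}|lebesgue. a r * \<beta> r)"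
  proof -
    have "(LINT r:{0..t}|lebesgue. a t * \<beta> r - a r * \<beta> r) = (LINT r:{0..t}|lebesgue. a t * \<beta> r) - (LINT r:{0..t}|lebesgue. a r * \<beta> r)"
      by (rule set_integral_diff(2)[OF set_integrable_mult_right[OF ib] i2])
    then show ?thesis using ac_primD(3)[OF B t] by (simp add: left_diff_distrib)
  qed
  moreover have "(LINT s:{0..t}|lebesgue. \<alpha> s * (b s - b 0)) = (LINT r:{0..t}|lebesgue. \<alpha> r * b r) - (a t - a 0) * b 0"
  proof -
    have "(LINT r:{0..t}|lebesgue. \<alpha> r * b r - \<alpha> r * b 0) = (LINT r:{0..t}|lebesgue. \<alpha> r * b r) - (LINT r:{0..t}|lebesgue. \<alpha> r * b 0)"
      by (rule set_integral_diff(2)[OF i1 set_integrable_mult_left[OF ia]])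
    then show ?thesis using ac_primD(3)[OF A t] by (simp add: right_diff_distrib)
  qed
  moreover have "(LINT s:{0..t}|lebesgue. \<alpha> s * b s + a s * \<beta> s) = (LINT r:{0..t}|lebesgue. \<alpha> r * b r) + (LINT r:{0..t}|lebesgue. a r * \<beta> r)"
    by (rule set_integral_add(2)[OF i1 i2])
  ultimately have "a t * (b t - b 0) - (LINT r:{0..t}|lebesgue. a r * \<beta> r) = (LINT r:{0..t}|lebesgue. \<alpha> r * b r) - (a t - a 0) * b 0"
    "(LINT s:{0..t}|lebesgue. \<alpha> s * b s + a s * \<beta> s) = (LINT r:{0..t}|lebesgue. \<alpha> r * b r) + (LINT r:{0..t}|lebesgue. a r * \<beta> r)"
    by simp_all
  then show "a t * b t = a 0 * b 0 + (LINT s:{0..t}|lebesgue. \<alpha> s * b s + a s * \<beta> s)"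
    by (simp only:) (simp add: right_diff_distrib left_diff_distrib diff_eq_eq add_ac)
qed

lemma ac_prim_cmult: "ac_prim a \<alpha> \<Longrightarrow> ac_prim (\<lambda>t. c * a t) (\<lambda>t. c * \<alpha> t)"
  using ac_prim_mult[OF ac_prim_const, of a \<alpha> c] by simp

lemma ac_prim_cnj:
  assumes "ac_prim a \<alpha>" shows "ac_prim (\<lambda>t. cnj (a t)) (\<lambda>t. cnj (\<alpha> t))"
  unfolding ac_prim_def
proof (intro conjI allI impI)
  show "continuous_on {0..} (\<lambda>t. cnj (a t))" by (intro continuous_intros ac_primD(1)[OF assms])
  fix t :: real assume t: "0 \<le> t"
  note i = ac_primD(2)[OF assms t]
  have c: "indicat_real S s *\<^sub>R cnj z = cnj (indicat_real S s *\<^sub>R z)" for S s z by simp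
  show "set_integrable lebesgue {0..t} (\<lambda>t. cnj (\<alpha> t))"
    using i unfolding set_integrable_def c by (rule integrable_bounded_linear[OF bounded_linear_cnj])
  show "cnj (a t) = cnj (a 0) + (LINT s:{0..t}|lebesgue. cnj (\<alpha> s))"
    unfolding set_lebesgue_integral_def c
    by (subst ac_primD(3)[OF assms t]) (simp add: set_lebesgue_integral_def del: complex_cnj_scaleR)
qed

lemma ac_prim_exp: "ac_prim (\<lambda>t. exp (c * of_real t)) (\<lambda>t. c * exp (c * of_real t))"
  unfolding ac_prim_def
proof (intro conjI allI impI)
  show "continuous_on {0..} (\<lambda>t. exp (c * of_real t))" by (intro continuous_intros)
  fix t :: real assume t: "0 \<le> t"
  show i: "set_integrable lebesgue {0..t} (\<lambda>t. c * exp (c * of_real t))"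
    by (intro absolutely_integrable_continuous_real continuous_intros)
  have "((\<lambda>t. c * exp (c * of_real t)) has_integral (exp (c * of_real t) - exp (c * of_real 0))) {0..t}"
    by (rule fundamental_theorem_of_calculus[OF t]) 
      (auto intro!: derivative_eq_intros has_vector_derivative_real_field)
  then show "exp (c * of_real t) = exp (c * of_real 0) + (LINT s:{0..t}|lebesgue. c * exp (c * of_real s))"
    unfolding set_lebesgue_integral_eq_integral(2)[OF i] by (simp only: integral_unique) simp
qed

lemma ac_prim_prod:
  assumes "finite S" "\<And>i. i \<in> S \<Longrightarrow> ac_prim (a i) (\<alpha> i)"
  shows "ac_prim (\<lambda>t. \<Prod>i\<in>S. a i t) (\<lambda>t. \<Sum>k\<in>S. \<Prod>i\<in>S. if i = k then \<alpha> i t else a i t)"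
  using assms
proof (induction S rule: finite_induct)
  case (insert x F)
  have "ac_prim (\<lambda>t. a x t * (\<Prod>i\<in>F. a i t)) (\<lambda>t. \<alpha> x t * (\<Prod>i\<in>F. a i t) + a x t * (\<Sum>k\<in>F. \<Prod>i\<in>F. if i = k then \<alpha> i t else a i t))"
    using insert by (intro ac_prim_mult) auto
  moreover have "(\<Sum>k\<in>insert x F. \<Prod>i\<in>insert x F. if i = k then \<alpha> i t else a i t) =
      \<alpha> x t * (\<Prod>i\<in>F. a i t) + a x t * (\<Sum>k\<in>F. \<Prod>i\<in>F. if i = k then \<alpha> i t else a i t)" for t
  proof -
    have 1: "(\<Prod>i\<in>F. if i = x then \<alpha> i t else a i t) = (\<Prod>i\<in>F. a i t)"
      using insert by (intro prod.cong) auto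
    have 2: "(\<Prod>i\<in>insert x F. if i = k then \<alpha> i t else a i t) = a x t * (\<Prod>i\<in>F. if i = k then \<alpha> i t else a i t)" if "k \<in> F" for k
      using insert that by (subst prod.insert) auto
    have 3: "(\<Sum>k\<in>F. \<Prod>i\<in>insert x F. if i = k then \<alpha> i t else a i t) = (\<Sum>k\<in>F. a x t * (\<Prod>i\<in>F. if i = k then \<alpha> i t else a i t))"
      by (rule sum.cong) (use 2 in auto)
    show ?thesis using insert.hyps 1 3 by (simp add: sum_distrib_left)
  qed
  ultimately show ?case using insert.hyps by simp
qed (simp add: ac_prim_const)

lemma ac_prim_zero:
  assumes "ac_prim a (\<lambda>_. 0)" "0 \<le> t" shows "a t = a 0"
  using ac_primD(3)[OF assms] by (simp add: set_lebesgue_integral_def)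

text \<open>Serves the decrease of the energy, the absorption argument for \<open>|1 - g|\<close>
  and a Gronwall estimate. Complex densities are kept, since their imaginary parts do not affect the
  comparison.\<close>

lemma ac_prim_Re_decreasing:
  assumes "ac_prim a \<alpha>" "0 \<le> t" "\<And>s. 0 \<le> s \<Longrightarrow> Re (\<alpha> s) \<le> 0"
  shows "Re (a t) \<le> Re (a 0)"
proof -
  have "Re (LINT s:{0..t}|lebesgue. \<alpha> s) = (LINT s|lebesgue. Re (indicat_real {0..t} s *\<^sub>R \<alpha> s))"
    using ac_primD(2)[OF assms(1,2)] unfolding set_lebesgue_integral_def set_integrable_def 
    by (rule integral_bounded_linear[OF bounded_linear_Re, symmetric])
  also have "\<dots> \<le> (LINT s::real|lebesgue. 0)"
    by (rule integral_mono_AE')  (use assms(3) in \<open>auto simp: indicator_def\<close>)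
  finally show ?thesis using ac_primD(3)[OF assms(1,2)] by simp
qed

section \<open>Minors\<close>

text \<open>Entries are given by a function, so rows can be selected by an arbitrary index map,
  repetitions included.\<close>

definition detf :: "nat \<Rightarrow> (nat \<Rightarrow> nat \<Rightarrow> complex) \<Rightarrow> complex" where
  "detf j M = Determinant.det (Matrix.mat j j (\<lambda>(i, c). M i c))"

lemma detf_expand: "detf j M = (\<Sum>p | p permutes {0..<j}. signof p * (\<Prod>i\<in>{0..<j}. M i (p i)))"
proof -
  have "detf j M = (\<Sum>p | p permutes {0..<j}. signof p * (\<Prod>i\<in>{0..<j}. Matrix.mat j j (\<lambda>(i, c). M i c) $$ (i, p i)))"
    unfolding detf_def by (rule det_def') simp
  also have "\<dots> = (\<Sum>p | p permutes {0..<j}. signof p * (\<Prod>i\<in>{0..<j}. M i (p i)))"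
    by (intro sum.cong refl arg_cong2[where f = "(*)"] prod.cong) auto
  finally show ?thesis .
qed

lemma detf_cong: "(\<And>i c. i < j \<Longrightarrow> c < j \<Longrightarrow> M i c = M' i c) \<Longrightarrow> detf j M = detf j M'"
  unfolding detf_def by (rule arg_cong[where f = Determinant.det], rule eq_matI) auto

lemma detf_transpose: "detf j (\<lambda>i c. M c i) = detf j M"
proof -
  have "Matrix.mat j j (\<lambda>(i, c). M c i) = transpose_mat (Matrix.mat j j (\<lambda>(i, c). M i c))"
    by (rule eq_matI) auto
  then show ?thesis unfolding detf_def by (simp add: det_transpose[of _ j])
qed

lemma detf_permute_rows:
  assumes p: "p permutes {0..<j}"
  shows "detf j (\<lambda>i c. M (p i) c) = signof p * detf j M"
proof -
  have "Matrix.mat j j (\<lambda>(i, c). Matrix.mat j j (\<lambda>(i, c). M i c) $$ (p i, c)) = Matrix.mat j j (\<lambda>(i, c). M (p i) c)"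
    by (rule eq_matI) (use p in auto)
  with det_permute_rows[of "Matrix.mat j j (\<lambda>(i, c). M i c)" j p] p show ?thesis
    unfolding detf_def by simp
qed

lemma detf_identical_rows:
  assumes "i < j" "i' < j" "i \<noteq> i'" "\<And>c. c < j \<Longrightarrow> M i c = M i' c"
  shows "detf j M = 0"
  unfolding detf_def
  by (rule det_identical_rows[of _ j i i']) (use assms in \<open>auto intro!: eq_vecI\<close>)

lemma detf_identity: "detf j (\<lambda>i c. if i = c then 1 else 0) = 1"
proof -
  have "Matrix.mat j j (\<lambda>(i, c). if i = c then 1 else 0) = (1\<^sub>m j :: complex mat)" by (rule eq_matI) auto
  then show ?thesis unfolding detf_def by simp
qed

lemma cnj_detf: "cnj (detf j M) = detf j (\<lambda>i c. cnj (M i c))"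
  unfolding detf_expand by simp

section \<open>Sums over index tuples and the Cauchy-Binet formula\<close>

abbreviation tuples :: "nat \<Rightarrow> nat \<Rightarrow> (nat \<Rightarrow> nat) set" where
  "tuples j N \<equiv> {0..<j} \<rightarrow>\<^sub>E {0..<N}"

lemma finite_tuples: "finite (tuples j N)"
  by (intro finite_PiE) auto

lemma permute_tuples:
  assumes p: "p permutes {0..<j}" and s: "\<sigma> \<in> tuples j N"
  shows "\<sigma> \<circ> p \<in> tuples j N"
proof -
  have "p i \<in> {0..<j} \<longleftrightarrow> i \<in> {0..<j}" for i using p by (rule permutes_in_image)
  moreover have "p i = i" if "i \<notin> {0..<j}" for i using p that by (rule permutes_not_in)
  ultimately show ?thesis using s by (auto simp: PiE_def extensional_def Pi_def)
qed

lemma sum_tuples_permute: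
  assumes p: "p permutes {0..<j}"
  shows "(\<Sum>\<sigma>\<in>tuples j N. f (\<sigma> \<circ> p)) = (\<Sum>\<sigma>\<in>tuples j N. f \<sigma>)"
  by (rule sum.reindex_bij_witness[of _ "\<lambda>\<sigma>. \<sigma> \<circ> Hilbert_Choice.inv p" "\<lambda>\<sigma>. \<sigma> \<circ> p"])
    (auto simp: comp_assoc permutes_inv_o[OF p] simp del: comp_apply
      intro!: permute_tuples p permutes_inv)

text \<open>
  The sum runs over all index tuples instead of the increasing ones, which avoids signs at the
  price of counting every minor \<open>j!\<close> times.
\<close>

theorem cauchy_binet:
  "(\<Sum>\<sigma>\<in>tuples j N. detf j (\<lambda>i c. A i (\<sigma> c)) * detf j (\<lambda>i c. B (\<sigma> i) c)) =
     fact j * detf j (\<lambda>i c. \<Sum>n<N. A i n * B n c)"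
proof -
  define P where "P = {p. p permutes {0..<j}}"
  have cP: "card P = fact j" unfolding P_def by (simp add: card_permutations)
  have fP: "finite P" unfolding P_def by (rule finite_permutations) simp
  define a where "a \<sigma> = (\<Prod>i\<in>{0..<j}. A i (\<sigma> i))" for \<sigma>
  have 1: "detf j (\<lambda>i c. \<Sum>n<N. A i n * B n c) = (\<Sum>\<sigma>\<in>tuples j N. a \<sigma> * detf j (\<lambda>i c. B (\<sigma> i) c))"
  proof -
    have "detf j (\<lambda>i c. \<Sum>n<N. A i n * B n c) = 
        (\<Sum>p\<in>P. signof p * (\<Prod>i\<in>{0..<j}. \<Sum>n\<in>{0..<N}. A i n * B n (p i)))"
      unfolding detf_expand P_def by (simp add: lessThan_atLeast0)
    also have "\<dots> = (\<Sum>p\<in>P. signof p * (\<Sum>\<sigma>\<in>tuples j N. \<Prod>i\<in>{0..<j}. A i (\<sigma> i) * B (\<sigma> i) (p i)))"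
      by (subst prod_sum_PiE) auto
    also have "\<dots> = (\<Sum>p\<in>P. \<Sum>\<sigma>\<in>tuples j N. a \<sigma> * (signof p * (\<Prod>i\<in>{0..<j}. B (\<sigma> i) (p i))))"
      by (simp add: sum_distrib_left prod.distrib a_def mult_ac)
    also have "\<dots> = (\<Sum>\<sigma>\<in>tuples j N. a \<sigma> * detf j (\<lambda>i c. B (\<sigma> i) c))"
      unfolding detf_expand sum_distrib_left P_def by (rule sum.swap)
    finally show ?thesis .
  qed
  \<comment> \<open>Reindexing fact \<open>1\<close> by each permutation gives \<open>fact j\<close>
    expressions for the same determinant. Adding them up antisymmetrises the products
    \<open>a\<close> into the minors of \<open>A\<close>.\<close>
  have 2: "detf j (\<lambda>i c. \<Sum>n<N. A i n * B n c) = (\<Sum>\<sigma>\<in>tuples j N. (signof p * a (\<sigma> \<circ> p)) * detf j (\<lambda>i c. B (\<sigma> i) c))" 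
    if "p \<in> P" for p
  proof -
    have p: "p permutes {0..<j}" using that by (simp add: P_def)
    show ?thesis unfolding 1
    proof (subst sum_tuples_permute[OF p, symmetric], rule sum.cong[OF refl])
      fix \<sigma>
      show "a (\<sigma> \<circ> p) * detf j (\<lambda>i c. B ((\<sigma> \<circ> p) i) c) = signof p * a (\<sigma> \<circ> p) * detf j (\<lambda>i c. B (\<sigma> i) c)"
        using detf_permute_rows[OF p, of "\<lambda>i c. B (\<sigma> i) c"] by (simp add: mult_ac)
    qed
  qed
  have "fact j * detf j (\<lambda>i c. \<Sum>n<N. A i n * B n c) = (\<Sum>p\<in>P. detf j (\<lambda>i c. \<Sum>n<N. A i n * B n c))"
    by (simp add: cP)
  also have "\<dots> = (\<Sum>p\<in>P. \<Sum>\<sigma>\<in>tuples j N. (signof p * a (\<sigma> \<circ> p)) * detf j (\<lambda>i c. B (\<sigma> i) c))"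
    by (rule sum.cong[OF refl 2])
  also have "\<dots> = (\<Sum>\<sigma>\<in>tuples j N. (\<Sum>p\<in>P. signof p * a (\<sigma> \<circ> p)) * detf j (\<lambda>i c. B (\<sigma> i) c))"
    by (subst sum.swap) (simp add: sum_distrib_right)
  also have "\<dots> = (\<Sum>\<sigma>\<in>tuples j N. detf j (\<lambda>i c. A i (\<sigma> c)) * detf j (\<lambda>i c. B (\<sigma> i) c))"
    by (simp add: detf_expand a_def P_def)
  finally show ?thesis by simp
qed

text \<open>An injective tuple has \<open>fact j\<close> distinct rearrangements with the same
  value, and tuples with different images have no rearrangement in common. This picks single
  coordinates, with the right multiplicity, out of sums over all tuples.\<close>

lemma sum_tuples_ge:
  fixes F :: "(nat \<Rightarrow> nat) \<Rightarrow> real"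
  assumes nonneg: "\<And>\<sigma>. \<sigma> \<in> tuples j N \<Longrightarrow> 0 \<le> F \<sigma>"
    and sym: "\<And>p \<sigma>. p permutes {0..<j} \<Longrightarrow> \<sigma> \<in> tuples j N \<Longrightarrow> F (\<sigma> \<circ> p) = F \<sigma>"
    and fin: "finite I" and tau: "\<And>i. i \<in> I \<Longrightarrow> \<tau> i \<in> tuples j N" and inj: "\<And>i. i \<in> I \<Longrightarrow> inj_on (\<tau> i) {0..<j}"
    and img: "\<And>i i'. i \<in> I \<Longrightarrow> i' \<in> I \<Longrightarrow> \<tau> i ` {0..<j} = \<tau> i' ` {0..<j} \<Longrightarrow> i = i'"
  shows "fact j * (\<Sum>i\<in>I. F (\<tau> i)) \<le> (\<Sum>\<sigma>\<in>tuples j N. F \<sigma>)"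
proof -
  define P where "P = {p. p permutes {0..<j}}"
  have cP: "card P = fact j" unfolding P_def by (simp add: card_permutations)
  have fP: "finite P" unfolding P_def by (rule finite_permutations) simp
  define h where "h = (\<lambda>(p :: nat \<Rightarrow> nat, i). \<tau> i \<circ> p)"
  have injh: "inj_on h (P \<times> I)"
  proof (rule inj_onI, clarify)
    fix p i p' i' assume p: "p \<in> P" "p' \<in> P" and i: "i \<in> I" "i' \<in> I" and e: "h (p, i) = h (p', i')"
    have P: "p permutes {0..<j}" "p' permutes {0..<j}" using p by (auto simp: P_def)
    have "\<tau> i ` {0..<j} = (\<tau> i \<circ> p) ` {0..<j}" "\<tau> i' ` {0..<j} = (\<tau> i' \<circ> p') ` {0..<j}"
      unfolding image_comp[symmetric] using P by (simp_all add: permutes_image)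
    moreover have "\<tau> i \<circ> p = \<tau> i' \<circ> p'" using e by (simp add: h_def)
    ultimately have "\<tau> i ` {0..<j} = \<tau> i' ` {0..<j}" by (simp only:)
    with img i have ii: "i = i'" by blast
    have "p x = p' x" for x
    proof (cases "x \<in> {0..<j}")
      case True
      then have "p x \<in> {0..<j}" "p' x \<in> {0..<j}" using P by (simp_all add: permutes_in_image)
      moreover have "\<tau> i (p x) = \<tau> i (p' x)" using e ii by (simp add: h_def fun_eq_iff)
      ultimately show ?thesis using inj[OF i(1)] by (auto dest: inj_onD)
    next
      case False
      then show ?thesis using P by (simp add: permutes_not_in)
    qed
    with ii show "p = p' \<and> i = i'" by auto
  qed
  have "fact j * (\<Sum>i\<in>I. F (\<tau> i)) = (\<Sum>p\<in>P. \<Sum>i\<in>I. F (\<tau> i))" by (simp add: cP)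
  also have "\<dots> = (\<Sum>p\<in>P. \<Sum>i\<in>I. F (\<tau> i \<circ> p))"
    by (intro sum.cong refl sym[symmetric] tau) (auto simp: P_def)
  also have "\<dots> = (\<Sum>q\<in>P \<times> I. F (h q))" by (simp add: sum.cartesian_product h_def case_prod_unfold)
  also have "\<dots> = sum F (h ` (P \<times> I))" by (simp add: sum.reindex[OF injh])
  also have "\<dots> \<le> sum F (tuples j N)"
    by (rule sum_mono2[OF finite_tuples]) (use nonneg tau in \<open>auto simp: h_def P_def intro!: permute_tuples simp del: comp_apply\<close>)
  finally show ?thesis .
qed

text \<open>The leading rows, whose minor becomes \<open>g\<close>. Changing one row, as in
  \<open>(idt j)(m := l)\<close>, gives the coordinates coupled directly to it. The restriction
  makes \<open>idt j\<close> extensional, as membership in \<open>tuples j N\<close>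
  requires.\<close>

definition idt :: "nat \<Rightarrow> nat \<Rightarrow> nat" where "idt j = restrict id {0..<j}"

lemma idt_tuples: "j \<le> N \<Longrightarrow> idt j \<in> tuples j N" 
  by (auto simp: idt_def PiE_def)

lemma idt_apply [simp]: "i < j \<Longrightarrow> idt j i = i"
  by (simp add: idt_def)

lemma update_tuples: "\<sigma> \<in> tuples j N \<Longrightarrow> i < j \<Longrightarrow> n < N \<Longrightarrow> \<sigma>(i := n) \<in> tuples j N"
  by (auto simp: PiE_def extensional_def)

lemma idt_update_image: 
  assumes "m < j" "j \<le> l"
  shows "(idt j)(m := l) ` {0..<j} = insert l ({0..<j} - {m})" "inj_on ((idt j)(m := l)) {0..<j}"
proof -
  show "(idt j)(m := l) ` {0..<j} = insert l ({0..<j} - {m})"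
  proof (intro equalityI subsetI)
    fix z assume "z \<in> insert l ({0..<j} - {m})"
    then have "z = ((idt j)(m := l)) (if z = l then m else z)" "(if z = l then m else z) \<in> {0..<j}" using assms by auto
    then show "z \<in> (idt j)(m := l) ` {0..<j}" by blast
  qed (use assms in \<open>auto simp: split: if_splits\<close>)
  show "inj_on ((idt j)(m := l)) {0..<j}" using assms by (auto simp: inj_on_def)
qed

text \<open>The indices below \<open>j\<close> missing from \<open>R\<close> are as many as the
  members of \<open>R\<close> from \<open>j\<close> on; a bijection replaces each of the former by a
  larger index, and \<open>lam\<close> increases.\<close>

lemma sum_smallest_le:
  fixes lam :: "nat \<Rightarrow> real"
  assumes mono: "strict_mono_on {..<N} lam" and R: "R \<subseteq> {..<N}" and c: "card R = j"
  shows "(\<Sum>m<j. lam m) \<le> (\<Sum>r\<in>R. lam r)"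
proof -
  have fR: "finite R" using R finite_subset by blast
  have "j \<le> N" using card_mono[OF _ R] c by simp
  have "card ({..<j} - R) = card (R - {..<j})"
  proof -
    have "card ({..<j} - R) + card ({..<j} \<inter> R) = j" using card_Int_Diff[of "{..<j}" R] by simp
    moreover have "card (R - {..<j}) + card ({..<j} \<inter> R) = j" using card_Int_Diff[OF fR, of "{..<j}"] c by (simp add: Int_commute)
    ultimately show ?thesis by simp
  qed
  then obtain f where f: "bij_betw f ({..<j} - R) (R - {..<j})"
    using fR finite_same_card_bij[of "{..<j} - R" "R - {..<j}"] by auto
  have "(\<Sum>m\<in>{..<j} - R. lam m) \<le> (\<Sum>m\<in>{..<j} - R. lam (f m))"
  proof (rule sum_mono)
    fix m assume m: "m \<in> {..<j} - R"
    then have "f m \<in> R - {..<j}" using f by (auto simp: bij_betw_def)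
    then show "lam m \<le> lam (f m)" using m R \<open>j \<le> N\<close>
      by (intro less_imp_le strict_mono_onD[OF mono]) auto
  qed
  also have "\<dots> = (\<Sum>r\<in>R - {..<j}. lam r)" by (rule sum.reindex_bij_betw[OF f])
  finally have "(\<Sum>m\<in>{..<j} - R. lam m) \<le> (\<Sum>r\<in>R - {..<j}. lam r)" .
  moreover have "(\<Sum>m<j. lam m) = (\<Sum>m\<in>{..<j} \<inter> R. lam m) + (\<Sum>m\<in>{..<j} - R. lam m)"
    by (simp add: sum.Int_Diff[of "{..<j}" lam R])
  moreover have "(\<Sum>r\<in>R. lam r) = (\<Sum>m\<in>{..<j} \<inter> R. lam m) + (\<Sum>r\<in>R - {..<j}. lam r)"
    using sum.Int_Diff[OF fR, of lam "{..<j}"] by (simp add: Int_commute)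
  ultimately show ?thesis by simp
qed

text \<open>The map taking \<open>(\<sigma>, n)\<close> to
  \<open>(\<sigma>(i := n), \<sigma> i)\<close> is an involution.\<close>

lemma sum_update_swap:
  assumes i: "i < j"
  shows "(\<Sum>\<sigma>\<in>tuples j N. \<Sum>n<N. f \<sigma> n) = (\<Sum>\<sigma>\<in>tuples j N. \<Sum>n<N. f (\<sigma>(i := n)) (\<sigma> i))"
proof -
  have "(\<Sum>q\<in>tuples j N \<times> {..<N}. f (fst q) (snd q)) = (\<Sum>q\<in>tuples j N \<times> {..<N}. f ((fst q)(i := snd q)) (fst q i))"
    by (rule sum.reindex_bij_witness[of _ "\<lambda>q. ((fst q)(i := snd q), fst q i)" "\<lambda>q. ((fst q)(i := snd q), fst q i)"])
      (use i in \<open>auto intro!: update_tuples simp: PiE_def Pi_def extensional_def\<close>)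
  then show ?thesis by (simp add: sum.cartesian_product case_prod_unfold)
qed

text \<open>A Hermitian matrix acting in one slot of the tuple is Hermitian again: conjugation
  transposes \<open>W\<close>, and the involution of \<open>sum_update_swap\<close> undoes
  this.\<close>

lemma hermitian_form_real:
  fixes W :: "nat \<Rightarrow> nat \<Rightarrow> complex"
  assumes i: "i < j" and herm: "\<And>m l. m < N \<Longrightarrow> l < N \<Longrightarrow> cnj (W m l) = W l m"
  shows "Im (\<Sum>\<sigma>\<in>tuples j N. \<Sum>n<N. W (\<sigma> i) n * \<phi> (\<sigma>(i := n)) * cnj (\<phi> \<sigma>)) = 0"
proof -
  define Q where "Q = (\<Sum>\<sigma>\<in>tuples j N. \<Sum>n<N. W (\<sigma> i) n * \<phi> (\<sigma>(i := n)) * cnj (\<phi> \<sigma>))"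
  have "cnj Q = (\<Sum>\<sigma>\<in>tuples j N. \<Sum>n<N. W n (\<sigma> i) * cnj (\<phi> (\<sigma>(i := n))) * \<phi> \<sigma>)"
    unfolding Q_def cnj_sum complex_cnj_mult complex_cnj_cnj
    by (intro sum.cong refl) (use i herm in \<open>auto simp: PiE_def Pi_def\<close>)
  also have "\<dots> = Q"
    unfolding Q_def by (subst sum_update_swap[OF i]) (simp add: mult_ac)
  finally have "cnj Q = Q" .
  then show ?thesis unfolding Q_def[symmetric] by (simp add: complex_eq_iff)
qed

lemma continuous_on_indefinite_integral:
  fixes \<alpha> :: "real \<Rightarrow> complex"
  assumes "\<And>t. 0 \<le> t \<Longrightarrow> set_integrable lebesgue {0..t} \<alpha>"
  shows "continuous_on {0..} (\<lambda>t. LINT s:{0..t}|lebesgue. \<alpha> s)"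
  unfolding continuous_on_eq_continuous_within
proof
  fix r :: real assume r: "r \<in> {0..}"
  have T: "0 \<le> r + 1" using r by simp
  have "continuous_on {0..r + 1} (\<lambda>t. integral {0..t} \<alpha>)"
    by (intro indefinite_integral_continuous_1 set_lebesgue_integral_eq_integral(1) assms T)
  then have "continuous_on {0..r + 1} (\<lambda>t. LINT s:{0..t}|lebesgue. \<alpha> s)"
    by (rule continuous_on_eq) (simp add: set_lebesgue_integral_eq_integral(2) assms)
  then have "continuous (at r within {0..r + 1}) (\<lambda>t. LINT s:{0..t}|lebesgue. \<alpha> s)"
    using r by (simp add: continuous_on_eq_continuous_within)
  moreover have "at r within {0..r + 1} = at r within {0..}"
    by (rule at_within_nhd[of _ "{..<r + 1}"]) auto
  ultimately show "continuous (at r within {0..}) (\<lambda>t. LINT s:{0..t}|lebesgue. \<alpha> s)" by simp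
qed

lemma ac_prim_indefinite:
  assumes "\<And>t. 0 \<le> t \<Longrightarrow> set_integrable lebesgue {0..t} \<alpha>"
  shows "ac_prim (\<lambda>t. LINT s:{0..t}|lebesgue. \<alpha> s) \<alpha>"
proof -
  have "AE s in lebesgue. s \<noteq> (0::real)" by (intro AE_completion) (rule AE_lborel_singleton)
  then have ae: "AE s in lebesgue. indicat_real {0..0} s *\<^sub>R \<alpha> s = 0"
    by eventually_elim simp
  have "(LINT s:{0..0}|lebesgue. \<alpha> s) = (LINT s::real|lebesgue. 0)"
    unfolding set_lebesgue_integral_def
    by (rule integral_cong_AE[OF _ _ ae]) (use assms[of 0] in \<open>auto simp: set_integrable_def\<close>)
  then show ?thesis using continuous_on_indefinite_integral[OF assms] assms by (simp add: ac_prim_def)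
qed

lemma ac_prim_detf:
  assumes x: "\<And>m c. m < N \<Longrightarrow> c < j \<Longrightarrow> ac_prim (\<lambda>t. x m c t) (\<lambda>t. \<Sum>n<N. H m n t * x n c t)"
    and s: "\<sigma> \<in> tuples j N"
  shows "ac_prim (\<lambda>t. detf j (\<lambda>i c. x (\<sigma> i) c t))
     (\<lambda>t. \<Sum>k<j. \<Sum>n<N. H (\<sigma> k) n t * detf j (\<lambda>i c. x ((\<sigma>(k := n)) i) c t))"
proof -
  define P where "P = {p. p permutes {0..<j}}"
  have "ac_prim (\<lambda>t. \<Sum>p\<in>P. signof p * (\<Prod>i\<in>{0..<j}. x (\<sigma> i) (p i) t))
    (\<lambda>t. \<Sum>p\<in>P. signof p * (\<Sum>k\<in>{0..<j}. \<Prod>i\<in>{0..<j}. if i = k then \<Sum>n<N. H (\<sigma> i) n t * x n (p i) t else x (\<sigma> i) (p i) t))"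
  proof (intro ac_prim_sum ac_prim_cmult ac_prim_prod)
    fix p i assume "p \<in> P" "i \<in> {0..<j}"
    then have "p i < j" using permutes_in_image[of p "{0..<j}" i] by (simp add: P_def)
    moreover have "\<sigma> i < N" using s \<open>i \<in> _\<close> by (auto simp: PiE_def Pi_def)
    ultimately show "ac_prim (\<lambda>t. x (\<sigma> i) (p i) t) (\<lambda>t. \<Sum>n<N. H (\<sigma> i) n t * x n (p i) t)" by (rule x[rotated])
  qed simp
  moreover have "(\<Sum>p\<in>P. signof p * (\<Sum>k\<in>{0..<j}. \<Prod>i\<in>{0..<j}. if i = k then \<Sum>n<N. H (\<sigma> i) n t * x n (p i) t else x (\<sigma> i) (p i) t))
    = (\<Sum>k<j. \<Sum>n<N. H (\<sigma> k) n t * detf j (\<lambda>i c. x ((\<sigma>(k := n)) i) c t))" for t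
  proof -
    have 1: "(\<Prod>i\<in>{0..<j}. if i = k then \<Sum>n<N. H (\<sigma> i) n t * x n (p i) t else x (\<sigma> i) (p i) t)
      = (\<Sum>n<N. H (\<sigma> k) n t * (\<Prod>i\<in>{0..<j}. x ((\<sigma>(k := n)) i) (p i) t))" if k: "k \<in> {0..<j}" for k p
    proof -
      have r: "(\<Prod>i\<in>{0..<j} - {k}. if i = k then a i else b i) = (\<Prod>i\<in>{0..<j} - {k}. b i)" for a b :: "nat \<Rightarrow> complex"
        by (rule prod.cong) auto
      have r': "(\<Prod>i\<in>{0..<j} - {k}. x ((\<sigma>(k := n)) i) (p i) t) = (\<Prod>i\<in>{0..<j} - {k}. x (\<sigma> i) (p i) t)" for n
        by (rule prod.cong) auto
      show ?thesis
        unfolding prod.remove[OF finite_atLeastLessThan k] r r' by (simp add: sum_distrib_right mult_ac)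
    qed
    have "(\<Sum>p\<in>P. signof p * (\<Sum>k\<in>{0..<j}. \<Prod>i\<in>{0..<j}. if i = k then \<Sum>n<N. H (\<sigma> i) n t * x n (p i) t else x (\<sigma> i) (p i) t))
       = (\<Sum>p\<in>P. \<Sum>k\<in>{0..<j}. \<Sum>n<N. H (\<sigma> k) n t * (signof p * (\<Prod>i\<in>{0..<j}. x ((\<sigma>(k := n)) i) (p i) t)))"
      unfolding sum_distrib_left by (intro sum.cong refl) (simp only: 1 sum_distrib_left mult.left_commute)
    also have "\<dots> = (\<Sum>k\<in>{0..<j}. \<Sum>n<N. \<Sum>p\<in>P. H (\<sigma> k) n t * (signof p * (\<Prod>i\<in>{0..<j}. x ((\<sigma>(k := n)) i) (p i) t)))"
      by (subst sum.swap) (intro sum.cong refl sum.swap)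
    finally show ?thesis unfolding detf_expand P_def sum_distrib_left lessThan_atLeast0 .
  qed
  ultimately show ?thesis unfolding detf_expand P_def by simp
qed

section \<open>The system on the exterior power\<close>

locale canonical_system =
  fixes N j :: nat and lam :: "nat \<Rightarrow> real" and V :: "nat \<Rightarrow> nat \<Rightarrow> real \<Rightarrow> complex"
    and x :: "nat \<Rightarrow> nat \<Rightarrow> real \<Rightarrow> complex \<Rightarrow> complex"
  assumes mono: "strict_mono_on {..<N} lam" and jN: "j \<le> N"
    and herm: "\<And>m l t. m < N \<Longrightarrow> l < N \<Longrightarrow> 0 \<le> t \<Longrightarrow> cnj (V m l t) = V l m t"
    and diag: "\<And>m t. m < N \<Longrightarrow> 0 \<le> t \<Longrightarrow> V m m t = 0"
    and L2: "\<And>m l T. m < N \<Longrightarrow> l < N \<Longrightarrow> 0 \<le> T \<Longrightarrow> set_integrable lebesgue {0..T} (\<lambda>t. (cmod (V m l t))\<^sup>2)"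
    and ode: "\<And>m c k. m < N \<Longrightarrow> c < N \<Longrightarrow> ac_prim (\<lambda>t. x m c t k) 
        (\<lambda>t. \<Sum>n<N. (\<i> * ((if n = m then k * of_real (lam m) else 0) + V m n t)) * x n c t k)"
    and init: "\<And>m c k. m < N \<Longrightarrow> c < N \<Longrightarrow> x m c 0 k = (if m = c then 1 else 0)"
begin

definition lam0 :: real where "lam0 = (\<Sum>m<j. lam m)"

text \<open>Diagonal entry at \<open>\<sigma>\<close> of the exterior system, after the normalising
  exponential has removed \<open>lam0\<close>.\<close>

definition d :: "(nat \<Rightarrow> nat) \<Rightarrow> real" where "d \<sigma> = (\<Sum>i<j. lam (\<sigma> i)) - lam0"

definition \<psi> :: "(nat \<Rightarrow> nat) \<Rightarrow> real \<Rightarrow> complex \<Rightarrow> complex" where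
  "\<psi> \<sigma> t k = detf j (\<lambda>i c. x (\<sigma> i) c t k)"

definition \<phi> :: "(nat \<Rightarrow> nat) \<Rightarrow> real \<Rightarrow> complex \<Rightarrow> complex" where
  "\<phi> \<sigma> t k = exp (- (\<i> * k * of_real lam0) * of_real t) * \<psi> \<sigma> t k"

definition g :: "real \<Rightarrow> complex \<Rightarrow> complex" where "g t k = \<phi> (idt j) t k"

text \<open>\<open>I(V)\<close> up to time \<open>t\<close>. For \<open>m < j\<close> and
  \<open>j \<le> l\<close> the gap \<open>lam l - lam m\<close> is positive, so no absolute value is
  taken.\<close>

definition potint :: "real \<Rightarrow> real" where
  "potint t = (LINT s:{0..t}|lebesgue. \<Sum>m<j. \<Sum>l=j..<N. (cmod (V m l s))\<^sup>2 / (lam l - lam m))"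

lemma lam_less: "m < l \<Longrightarrow> l < N \<Longrightarrow> lam m < lam l"
  using strict_mono_onD[OF mono, of m l] by simp

lemma tuple_less: "\<sigma> \<in> tuples j N \<Longrightarrow> i < j \<Longrightarrow> \<sigma> i < N"
  by (auto simp: PiE_def Pi_def)

lemma \<psi>_deriv:
  assumes s: "\<sigma> \<in> tuples j N"
  shows "ac_prim (\<lambda>t. \<psi> \<sigma> t k) (\<lambda>t. \<i> * (k * of_real (\<Sum>i<j. lam (\<sigma> i)) * \<psi> \<sigma> t k
      + (\<Sum>i<j. \<Sum>n<N. V (\<sigma> i) n t * \<psi> (\<sigma>(i := n)) t k)))"
proof -
  have *: "ac_prim (\<lambda>t. \<psi> \<sigma> t k) (\<lambda>t. \<Sum>i<j. \<Sum>n<N. (\<i> * ((if n = \<sigma> i then k * of_real (lam (\<sigma> i)) else 0) + V (\<sigma> i) n t)) * \<psi> (\<sigma>(i := n)) t k)"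
    unfolding \<psi>_def by (rule ac_prim_detf[OF ode s]) (use jN in auto)
  have "(\<Sum>n<N. (\<i> * ((if n = \<sigma> i then k * of_real (lam (\<sigma> i)) else 0) + V (\<sigma> i) n t)) * \<psi> (\<sigma>(i := n)) t k)
     = \<i> * (k * of_real (lam (\<sigma> i)) * \<psi> \<sigma> t k + (\<Sum>n<N. V (\<sigma> i) n t * \<psi> (\<sigma>(i := n)) t k))" if i: "i < j" for i t
  proof -
    have "(\<Sum>n<N. (\<i> * ((if n = \<sigma> i then k * of_real (lam (\<sigma> i)) else 0) + V (\<sigma> i) n t)) * \<psi> (\<sigma>(i := n)) t k)
     = (\<Sum>n<N. (if n = \<sigma> i then \<i> * k * of_real (lam (\<sigma> i)) * \<psi> (\<sigma>(i := n)) t k else 0) + \<i> * (V (\<sigma> i) n t * \<psi> (\<sigma>(i := n)) t k))"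
      by (intro sum.cong refl) (simp add: algebra_simps)
    also have "\<dots> = \<i> * k * of_real (lam (\<sigma> i)) * \<psi> \<sigma> t k + \<i> * (\<Sum>n<N. V (\<sigma> i) n t * \<psi> (\<sigma>(i := n)) t k)"
      using tuple_less[OF s i] by (simp add: sum.distrib sum.delta sum_distrib_left)
    finally show ?thesis by (simp add: algebra_simps)
  qed
  then have "(\<Sum>i<j. \<Sum>n<N. (\<i> * ((if n = \<sigma> i then k * of_real (lam (\<sigma> i)) else 0) + V (\<sigma> i) n t)) * \<psi> (\<sigma>(i := n)) t k)
     = \<i> * (k * of_real (\<Sum>i<j. lam (\<sigma> i)) * \<psi> \<sigma> t k + (\<Sum>i<j. \<Sum>n<N. V (\<sigma> i) n t * \<psi> (\<sigma>(i := n)) t k))" for t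
    by (simp add: sum.distrib sum_distrib_left sum_distrib_right distrib_left mult_ac)
  with * show ?thesis by simp
qed

lemma \<phi>_deriv:
  assumes s: "\<sigma> \<in> tuples j N"
  shows "ac_prim (\<lambda>t. \<phi> \<sigma> t k) (\<lambda>t. \<i> * (k * of_real (d \<sigma>) * \<phi> \<sigma> t k
      + (\<Sum>i<j. \<Sum>n<N. V (\<sigma> i) n t * \<phi> (\<sigma>(i := n)) t k)))"
proof (rule ac_prim_cong)
  show "ac_prim (\<lambda>t. exp (- (\<i> * k * of_real lam0) * of_real t) * \<psi> \<sigma> t k) 
     (\<lambda>t. (- (\<i> * k * of_real lam0) * exp (- (\<i> * k * of_real lam0) * of_real t)) * \<psi> \<sigma> t k
       + exp (- (\<i> * k * of_real lam0) * of_real t) * (\<i> * (k * of_real (\<Sum>i<j. lam (\<sigma> i)) * \<psi> \<sigma> t k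
      + (\<Sum>i<j. \<Sum>n<N. V (\<sigma> i) n t * \<psi> (\<sigma>(i := n)) t k))))"
    by (rule ac_prim_mult[OF ac_prim_exp \<psi>_deriv[OF s]])
  fix t :: real
  define E where "E = exp (- (\<i> * k * of_real lam0) * of_real t)"
  define S where "S = (\<Sum>i<j. \<Sum>n<N. V (\<sigma> i) n t * \<psi> (\<sigma>(i := n)) t k)"
  define L where "L = complex_of_real (\<Sum>i<j. lam (\<sigma> i))"
  have "(\<Sum>i<j. \<Sum>n<N. V (\<sigma> i) n t * \<phi> (\<sigma>(i := n)) t k) = E * S"
    by (simp add: \<phi>_def E_def S_def sum_distrib_left mult.left_commute)
  moreover have "- (\<i> * k * of_real lam0) * E * \<psi> \<sigma> t k + E * (\<i> * (k * L * \<psi> \<sigma> t k + S)) = 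
      \<i> * (k * (L - of_real lam0) * (E * \<psi> \<sigma> t k) + E * S)"
    by (simp add: algebra_simps)
  ultimately show "(- (\<i> * k * of_real lam0) * exp (- (\<i> * k * of_real lam0) * of_real t)) * \<psi> \<sigma> t k
       + exp (- (\<i> * k * of_real lam0) * of_real t) * (\<i> * (k * of_real (\<Sum>i<j. lam (\<sigma> i)) * \<psi> \<sigma> t k
      + (\<Sum>i<j. \<Sum>n<N. V (\<sigma> i) n t * \<psi> (\<sigma>(i := n)) t k))) = \<i> * (k * of_real (d \<sigma>) * \<phi> \<sigma> t k
      + (\<Sum>i<j. \<Sum>n<N. V (\<sigma> i) n t * \<phi> (\<sigma>(i := n)) t k))"
    unfolding E_def[symmetric] S_def[symmetric] L_def[symmetric] d_def of_real_diff by (simp only: \<phi>_def E_def)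
qed (simp add: \<phi>_def)

definition energy :: "real \<Rightarrow> complex \<Rightarrow> real" where
  "energy t k = (\<Sum>\<sigma>\<in>tuples j N. (cmod (\<phi> \<sigma> t k))\<^sup>2)"

definition dissip :: "real \<Rightarrow> complex \<Rightarrow> real" where
  "dissip t k = (\<Sum>\<sigma>\<in>tuples j N. d \<sigma> * (cmod (\<phi> \<sigma> t k))\<^sup>2)"

text \<open>Paired with the solution, the potential contributes a real number \<open>R\<close> by
  Hermitian symmetry, so \<open>Z = \<i> (k dissip + R)\<close>, and in \<open>Z + cnj Z\<close>
  only the imaginary part of \<open>k\<close> survives. The density is left unnamed, since later
  arguments use its real part alone.\<close>

lemma energy_deriv:
  "\<exists>\<alpha>. ac_prim (\<lambda>t. of_real (energy t k)) \<alpha> \<and> (\<forall>t\<ge>0. Re (\<alpha> t) = - 2 * Im k * dissip t k)"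
proof -
  define D where "D \<sigma> t = \<i> * (k * of_real (d \<sigma>) * \<phi> \<sigma> t k + (\<Sum>i<j. \<Sum>n<N. V (\<sigma> i) n t * \<phi> (\<sigma>(i := n)) t k))" for \<sigma> t
  define \<alpha> where "\<alpha> t = (\<Sum>\<sigma>\<in>tuples j N. D \<sigma> t * cnj (\<phi> \<sigma> t k) + \<phi> \<sigma> t k * cnj (D \<sigma> t))" for t
  have "ac_prim (\<lambda>t. \<Sum>\<sigma>\<in>tuples j N. \<phi> \<sigma> t k * cnj (\<phi> \<sigma> t k)) \<alpha>"
    unfolding \<alpha>_def D_def by (intro ac_prim_sum ac_prim_mult ac_prim_cnj \<phi>_deriv)
  then have "ac_prim (\<lambda>t. of_real (energy t k)) \<alpha>"
    by (rule ac_prim_cong) (simp_all add: energy_def complex_norm_square del: of_real_power)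
  moreover have "Re (\<alpha> t) = - 2 * Im k * dissip t k" if t: "0 \<le> t" for t
  proof -
    define Q where "Q i = (\<Sum>\<sigma>\<in>tuples j N. \<Sum>n<N. V (\<sigma> i) n t * \<phi> (\<sigma>(i := n)) t k * cnj (\<phi> \<sigma> t k))" for i
    have Q: "Im (Q i) = 0" if "i < j" for i
      unfolding Q_def by (rule hermitian_form_real[OF that, of N "\<lambda>m n. V m n t" "\<lambda>\<sigma>. \<phi> \<sigma> t k"]) (use herm t in auto)
    define R where "R = (\<Sum>i<j. Q i)"
    define Z where "Z = (\<Sum>\<sigma>\<in>tuples j N. D \<sigma> t * cnj (\<phi> \<sigma> t k))"
    have R0: "Im R = 0" using Q by (simp add: R_def)
    have Z: "Z = \<i> * (k * of_real (dissip t k) + R)"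
    proof -
      have "(\<Sum>\<sigma>\<in>tuples j N. D \<sigma> t * cnj (\<phi> \<sigma> t k)) = 
        (\<Sum>\<sigma>\<in>tuples j N. \<i> * (k * of_real (d \<sigma> * (cmod (\<phi> \<sigma> t k))\<^sup>2)) + \<i> * (\<Sum>i<j. \<Sum>n<N. V (\<sigma> i) n t * \<phi> (\<sigma>(i := n)) t k * cnj (\<phi> \<sigma> t k)))"
      proof (rule sum.cong[OF refl])
        fix \<sigma>
        have "\<phi> \<sigma> t k * cnj (\<phi> \<sigma> t k) = of_real ((cmod (\<phi> \<sigma> t k))\<^sup>2)" by (simp add: complex_norm_square del: of_real_power)
        then have "k * of_real (d \<sigma>) * \<phi> \<sigma> t k * cnj (\<phi> \<sigma> t k) = k * of_real (d \<sigma> * (cmod (\<phi> \<sigma> t k))\<^sup>2)"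
          by (simp only: mult.assoc of_real_mult)
        then show "D \<sigma> t * cnj (\<phi> \<sigma> t k) = \<i> * (k * of_real (d \<sigma> * (cmod (\<phi> \<sigma> t k))\<^sup>2)) + \<i> * (\<Sum>i<j. \<Sum>n<N. V (\<sigma> i) n t * \<phi> (\<sigma>(i := n)) t k * cnj (\<phi> \<sigma> t k))"
          unfolding D_def by (simp only: distrib_left distrib_right mult.assoc sum_distrib_right)
      qed
      also have "\<dots> = \<i> * (k * of_real (dissip t k)) + \<i> * (\<Sum>\<sigma>\<in>tuples j N. \<Sum>i<j. \<Sum>n<N. V (\<sigma> i) n t * \<phi> (\<sigma>(i := n)) t k * cnj (\<phi> \<sigma> t k))"
        by (simp only: sum.distrib dissip_def of_real_sum sum_distrib_left)
      also have "(\<Sum>\<sigma>\<in>tuples j N. \<Sum>i<j. \<Sum>n<N. V (\<sigma> i) n t * \<phi> (\<sigma>(i := n)) t k * cnj (\<phi> \<sigma> t k)) = R"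
        unfolding Q_def R_def by (rule sum.swap)
      finally show ?thesis by (simp only: Z_def distrib_left)
    qed
    moreover have "\<alpha> t = Z + cnj Z"
      by (simp add: \<alpha>_def Z_def sum.distrib mult.commute)
    ultimately show ?thesis using R0 by simp
  qed
  ultimately show ?thesis by blast
qed

lemma d_nonneg: 
  assumes "\<sigma> \<in> tuples j N" "inj_on \<sigma> {0..<j}" shows "0 \<le> d \<sigma>"
proof -
  have "(\<Sum>m<j. lam m) \<le> (\<Sum>r\<in>\<sigma> ` {0..<j}. lam r)"
    by (rule sum_smallest_le[OF mono]) (use assms in \<open>auto simp: card_image PiE_def Pi_def\<close>)
  then show ?thesis using assms(2) by (simp add: d_def lam0_def sum.reindex lessThan_atLeast0)
qed

lemma \<phi>_not_inj: "\<not> inj_on \<sigma> {0..<j} \<Longrightarrow> \<phi> \<sigma> t k = 0"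
proof -
  assume "\<not> inj_on \<sigma> {0..<j}"
  then obtain i i' where "i < j" "i' < j" "i \<noteq> i'" "\<sigma> i = \<sigma> i'" by (auto simp: inj_on_def)
  then have "\<psi> \<sigma> t k = 0" unfolding \<psi>_def by (intro detf_identical_rows[of i j i']) auto
  then show ?thesis by (simp add: \<phi>_def)
qed

lemma dissip_term_nonneg: "\<sigma> \<in> tuples j N \<Longrightarrow> 0 \<le> d \<sigma> * (cmod (\<phi> \<sigma> t k))\<^sup>2"
  using d_nonneg[of \<sigma>] \<phi>_not_inj[of \<sigma>] by (cases "inj_on \<sigma> {0..<j}") auto

lemma dissip_nonneg: "0 \<le> dissip t k"
  unfolding dissip_def by (intro sum_nonneg dissip_term_nonneg)

lemma cmod_\<phi>_permute:
  assumes "p permutes {0..<j}"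
  shows "cmod (\<phi> (\<sigma> \<circ> p) t k) = cmod (\<phi> \<sigma> t k)"
proof -
  have "\<psi> (\<sigma> \<circ> p) t k = signof p * \<psi> \<sigma> t k"
    unfolding \<psi>_def using detf_permute_rows[OF assms, of "\<lambda>i c. x (\<sigma> i) c t k"] by simp
  then show ?thesis by (simp add: \<phi>_def norm_mult sign_def)
qed

lemma d_permute:
  assumes "p permutes {0..<j}" shows "d (\<sigma> \<circ> p) = d \<sigma>"
  using sum.permute[OF assms, of "\<lambda>i. lam (\<sigma> i)"] by (simp add: d_def lessThan_atLeast0 o_def)

text \<open>Cauchy-Binet for the product of two identity matrices; \<open>fact j\<close> is the
  multiplicity with which each minor is counted, and thus the normalisation of the energy.\<close>

lemma energy_0: "energy 0 k = fact j"
proof -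
  have \<phi>0: "\<phi> \<sigma> 0 k = detf j (\<lambda>i c. if \<sigma> i = c then 1 else 0)" if "\<sigma> \<in> tuples j N" for \<sigma>
    unfolding \<phi>_def \<psi>_def using jN tuple_less[OF that] by (simp add: init cong: detf_cong)
  have "of_real (energy 0 k) = (\<Sum>\<sigma>\<in>tuples j N. detf j (\<lambda>i c. if i = \<sigma> c then 1 else 0) * detf j (\<lambda>i c. if \<sigma> i = c then 1 else 0))"
    unfolding energy_def of_real_sum
  proof (rule sum.cong[OF refl])
    fix \<sigma> assume s: "\<sigma> \<in> tuples j N"
    have "of_real ((cmod (\<phi> \<sigma> 0 k))\<^sup>2) = cnj (\<phi> \<sigma> 0 k) * \<phi> \<sigma> 0 k" by (simp add: complex_norm_square mult.commute del: of_real_power)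
    also have "cnj (\<phi> \<sigma> 0 k) = detf j (\<lambda>i c. if \<sigma> i = c then 1 else 0)"
      unfolding \<phi>0[OF s] cnj_detf by (rule detf_cong) simp
    also have "\<dots> = detf j (\<lambda>i c. if i = \<sigma> c then 1 else 0)"
      by (subst detf_transpose[symmetric]) (simp add: eq_commute)
    finally show "of_real ((cmod (\<phi> \<sigma> 0 k))\<^sup>2) = detf j (\<lambda>i c. if i = \<sigma> c then 1 else 0) * detf j (\<lambda>i c. if \<sigma> i = c then 1 else 0)"
      unfolding \<phi>0[OF s] .
  qed
  also have "\<dots> = fact j * detf j (\<lambda>i c. \<Sum>n<N. (if i = n then 1 else 0) * (if n = c then 1 else 0))"
    by (rule cauchy_binet[where j = j and N = N and A = "\<lambda>i n. if i = n then 1 else 0" and B = "\<lambda>n c. if n = c then 1 else 0"])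
  also have "detf j (\<lambda>i c. \<Sum>n<N. (if i = n then 1 else 0) * (if n = c then 1 else 0)) = detf j (\<lambda>i c. if i = c then 1 else 0)"
  proof (rule detf_cong)
    fix i c assume "i < j" "c < j"
    then have "i < N" using jN by simp
    have "(\<Sum>n<N. (if i = n then 1 else 0) * (if n = c then 1 else (0::complex))) = (\<Sum>n<N. if i = n then (if i = c then 1 else 0) else 0)"
      by (rule sum.cong) auto
    then show "(\<Sum>n<N. (if i = n then 1 else 0) * (if n = c then 1 else 0)) = (if i = c then 1 else (0::complex))"
      using \<open>i < N\<close> by (simp add: sum.delta')
  qed
  finally have "complex_of_real (energy 0 k) = fact j" by (simp add: detf_identity)
  then show ?thesis by (metis of_real_fact of_real_eq_iff)
qed

lemma energy_ge: "fact j * (cmod (g t k))\<^sup>2 \<le> energy t k"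
proof -
  have "fact j * (\<Sum>i\<in>{()}. (cmod (\<phi> (idt j) t k))\<^sup>2) \<le> energy t k"
    unfolding energy_def
    by (rule sum_tuples_ge[where \<tau> = "\<lambda>_. idt j"]) (use jN in \<open>auto simp: cmod_\<phi>_permute idt_tuples inj_on_def simp del: o_apply\<close>)
  then show ?thesis by (simp add: g_def)
qed

lemma d_update: 
  assumes "m < j" shows "d ((idt j)(m := l)) = lam l - lam m"
proof -
  have "(\<Sum>i<j. lam (((idt j)(m := l)) i)) = lam l + (\<Sum>i\<in>{..<j} - {m}. lam i)"
    using assms by (subst sum.remove[of _ m]) (auto intro!: sum.cong)
  moreover have "(\<Sum>i<j. lam i) = lam m + (\<Sum>i\<in>{..<j} - {m}. lam i)"
    using assms by (subst sum.remove[of _ m]) auto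
  ultimately show ?thesis by (simp add: d_def lam0_def)
qed

text \<open>The tuples \<open>(idt j)(m := l)\<close> have pairwise different images, and their
  weight in \<open>dissip\<close> is \<open>lam l - lam m\<close>, the very gap that divides the
  square of \<open>V\<close> in \<open>potint\<close>. This match is what makes the later AM-GM
  estimate produce \<open>I(V)\<close>.\<close>

lemma dissip_ge: "fact j * (\<Sum>m<j. \<Sum>l=j..<N. (lam l - lam m) * (cmod (\<phi> ((idt j)(m := l)) t k))\<^sup>2) \<le> dissip t k"
proof -
  have "fact j * (\<Sum>q\<in>{..<j} \<times> {j..<N}. (d ((idt j)(fst q := snd q)) * (cmod (\<phi> ((idt j)(fst q := snd q)) t k))\<^sup>2)) \<le> dissip t k"
    unfolding dissip_def
  proof (rule sum_tuples_ge)
    fix q assume q: "q \<in> {..<j} \<times> {j..<N}"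
    show "(idt j)(fst q := snd q) \<in> tuples j N" 
      by (intro update_tuples idt_tuples jN) (use q in auto)
    show "inj_on ((idt j)(fst q := snd q)) {0..<j}"
      by (rule idt_update_image(2)) (use q in auto)
    fix q' assume q': "q' \<in> {..<j} \<times> {j..<N}"
      and e: "(idt j)(fst q := snd q) ` {0..<j} = (idt j)(fst q' := snd q') ` {0..<j}"
    have lt: "fst q < j" "fst q' < j" "j \<le> snd q" "j \<le> snd q'" using q q' by auto
    have e': "insert (snd q) ({0..<j} - {fst q}) = insert (snd q') ({0..<j} - {fst q'})"
      using e unfolding idt_update_image(1)[OF lt(1,3)] idt_update_image(1)[OF lt(2,4)] .
    have 1: "snd q \<in> insert (snd q') ({0..<j} - {fst q'})" and 2: "fst q \<notin> insert (snd q') ({0..<j} - {fst q'})" 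
      unfolding e'[symmetric] using lt by auto
    show "q = q'" by (rule prod_eqI) (use 1 2 lt in auto)
  next
    fix \<sigma> assume "\<sigma> \<in> tuples j N"
    then show "0 \<le> d \<sigma> * (cmod (\<phi> \<sigma> t k))\<^sup>2" by (rule dissip_term_nonneg)
    fix p assume "p permutes {0..<j}"
    then show "d (\<sigma> \<circ> p) * (cmod (\<phi> (\<sigma> \<circ> p) t k))\<^sup>2 = d \<sigma> * (cmod (\<phi> \<sigma> t k))\<^sup>2"
      by (simp only: cmod_\<phi>_permute d_permute)
  qed simp
  moreover have "(\<Sum>m<j. \<Sum>l=j..<N. (lam l - lam m) * (cmod (\<phi> ((idt j)(m := l)) t k))\<^sup>2) =
      (\<Sum>q\<in>{..<j} \<times> {j..<N}. (d ((idt j)(fst q := snd q)) * (cmod (\<phi> ((idt j)(fst q := snd q)) t k))\<^sup>2))"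
    unfolding sum.cartesian_product by (rule sum.cong) (auto simp: d_update)
  ultimately show ?thesis by simp
qed

text \<open>At \<open>idt j\<close> the diagonal term vanishes. Of the updates of slot
  \<open>m\<close>, those with another index below \<open>j\<close> repeat a row, and the update by
  \<open>m\<close> itself meets the zero diagonal of \<open>V\<close>; hence only the block of
  \<open>V\<close> occurring in \<open>I(V)\<close> drives \<open>g\<close>.\<close>

lemma g_deriv:
  "ac_prim (\<lambda>t. g t k) (\<lambda>t. \<i> * (\<Sum>m<j. \<Sum>l=j..<N. V m l t * \<phi> ((idt j)(m := l)) t k))"
proof -
  have d0: "d (idt j) = 0" by (simp add: d_def lam0_def)
  have "(\<Sum>n<N. V m n t * \<phi> ((idt j)(m := n)) t k) = (\<Sum>l=j..<N. V m l t * \<phi> ((idt j)(m := l)) t k)" if t: "0 \<le> t" and m: "m < j" for t m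
  proof (rule sum.mono_neutral_right)
    show "\<forall>n\<in>{..<N} - {j..<N}. V m n t * \<phi> ((idt j)(m := n)) t k = 0"
    proof
      fix n assume n: "n \<in> {..<N} - {j..<N}"
      show "V m n t * \<phi> ((idt j)(m := n)) t k = 0"
      proof (cases "n = m")
        case True then show ?thesis using diag t m jN by simp
      next
        case False
        then have "\<not> inj_on ((idt j)(m := n)) {0..<j}" using n m by (auto simp: inj_on_def)
        then show ?thesis using \<phi>_not_inj by simp
      qed
    qed
  qed auto
  then show ?thesis
    by (intro ac_prim_cong[OF \<phi>_deriv[OF idt_tuples[OF jN], of k]]) (auto simp: g_def d0)
qed

lemma energy_decreasing:
  assumes "0 \<le> t" "0 \<le> Im k" shows "energy t k \<le> fact j"
proof -
  obtain \<alpha> where a: "ac_prim (\<lambda>t. of_real (energy t k)) \<alpha>" "\<forall>t\<ge>0. Re (\<alpha> t) = - 2 * Im k * dissip t k"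
    using energy_deriv by blast
  have "Re (of_real (energy t k)) \<le> Re (of_real (energy 0 k))"
    by (rule ac_prim_Re_decreasing[OF a(1) assms(1)]) (use a(2) assms dissip_nonneg in \<open>simp add: mult_nonneg_nonneg\<close>)
  then show ?thesis by (simp add: energy_0)
qed

lemma cmod_g_le_1:
  assumes "0 \<le> t" "0 \<le> Im k" shows "cmod (g t k) \<le> 1"
proof -
  have "fact j * (cmod (g t k))\<^sup>2 \<le> fact j * 1" using order_trans[OF energy_ge energy_decreasing[OF assms]] by simp
  then have "(cmod (g t k))\<^sup>2 \<le> 1" by (subst (asm) mult_le_cancel_left_pos) auto
  then show ?thesis by (simp add: abs_square_le_1)
qed

lemma potint_integrable:
  assumes "0 \<le> t"
  shows "set_integrable lebesgue {0..t} (\<lambda>s. \<Sum>m<j. \<Sum>l=j..<N. (cmod (V m l s))\<^sup>2 / (lam l - lam m))"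
  unfolding set_integrable_def scaleR_sum_right
  by (intro Bochner_Integration.integrable_sum set_integrable_divide[unfolded set_integrable_def] 
      L2[unfolded set_integrable_def]) (use assms jN in auto)

lemma g_0: "g 0 k = 1"
proof -
  have "detf j (\<lambda>i c. x (idt j i) c 0 k) = detf j (\<lambda>i c. if i = c then 1 else 0)"
    by (rule detf_cong) (use jN in \<open>simp add: init\<close>)
  then show ?thesis by (simp add: g_def \<phi>_def \<psi>_def detf_identity)
qed

text \<open>
  With \<open>y = Im k\<close>, AM-GM bounds \<open>|g'|\<close> by \<open>potint' / (2 y) + y / 2 \<cdot> dissip / j!\<close>. The
  integrated dissipation is at most \<open>(1 - |g|\<^sup>2) j! / (2 y)\<close>, which is again controlled by
  \<open>|1 - g|\<close>, so that half of \<open>|1 - g|\<close> can be absorbed.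
\<close>

theorem cmod_one_minus_g:
  assumes t: "0 \<le> t" and y: "0 < Im k"
  shows "cmod (1 - g t k) \<le> potint t / Im k"
proof -
  define y where "y = Im k"
  have y0: "0 < y" using y by (simp add: y_def)
  obtain \<alpha> where a: "ac_prim (\<lambda>t. of_real (energy t k)) \<alpha>" "\<forall>t\<ge>0. Re (\<alpha> t) = - 2 * Im k * dissip t k"
    using energy_deriv by blast
  \<comment> \<open>The rotation is frozen at the final time \<open>t\<close>, so that
    \<open>u * (1 - g s k)\<close> stays locally absolutely continuous in \<open>s\<close>, while
    its real part at \<open>s = t\<close> is the modulus.\<close>
  define u where "u = cnj (sgn (1 - g t k))"
  have u1: "cmod u \<le> 1" by (simp add: u_def norm_sgn)
  have ug: "Re (u * (1 - g t k)) = cmod (1 - g t k)"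
  proof (cases "1 - g t k = 0")
    case False
    have "u * (1 - g t k) = (1 - g t k) * cnj (1 - g t k) / of_real (cmod (1 - g t k))"
      by (simp add: u_def sgn_div_norm scaleR_conv_of_real divide_inverse mult_ac)
    also have "\<dots> = of_real (cmod (1 - g t k))"
      using False by (subst complex_norm_square[symmetric]) (simp add: power2_eq_square)
    finally show ?thesis by simp
  qed simp
  define p where "p s = (\<Sum>m<j. \<Sum>l=j..<N. (cmod (V m l s))\<^sup>2 / (lam l - lam m))" for s
  have sc: "indicat_real S s *\<^sub>R complex_of_real (p s) = complex_of_real (indicat_real S s *\<^sub>R p s)" for S s
    by (simp add: scaleR_conv_of_real)
  have pint: "integrable lebesgue (\<lambda>s. indicat_real {0..t} s *\<^sub>R p s)" if "0 \<le> t" for t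
    using potint_integrable[OF that] unfolding p_def set_integrable_def .
  have pp: "ac_prim (\<lambda>t. LINT s:{0..t}|lebesgue. complex_of_real (p s)) (\<lambda>s. complex_of_real (p s))"
    unfolding set_lebesgue_integral_def[symmetric]
    by (rule ac_prim_indefinite, unfold set_integrable_def sc) (intro integrable_bounded_linear[OF bounded_linear_of_real] pint)
  have pr: "(LINT s:{0..t}|lebesgue. complex_of_real (p s)) = of_real (potint t)"
    unfolding potint_def p_def[symmetric] set_lebesgue_integral_def sc
    by (rule integral_bounded_linear[OF bounded_linear_of_real pint[OF t]])
  \<comment> \<open>Chosen so that \<open>c\<close> times the rate of energy loss
    \<open>2 y dissip\<close> is exactly the AM-GM term
    \<open>y / 2 * dissip / fact j\<close>.\<close>
  define c :: real where "c = 1 / (4 * fact j)"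
  define a' where "a' s = u * (1 - g s k) - of_real (1 / (2 * y)) * (LINT r:{0..s}|lebesgue. complex_of_real (p r)) + of_real c * of_real (energy s k)" for s
  define G where "G s = \<i> * (\<Sum>m<j. \<Sum>l=j..<N. V m l s * \<phi> ((idt j)(m := l)) s k)" for s
  define \<alpha>' where "\<alpha>' s = (- u) * G s + (- of_real (1 / (2 * y))) * complex_of_real (p s) + of_real c * \<alpha> s" for s
  have "ac_prim (\<lambda>s. u + (- u) * g s k + (- of_real (1 / (2 * y))) * (LINT r:{0..s}|lebesgue. complex_of_real (p r)) + of_real c * of_real (energy s k))
     (\<lambda>s. 0 + (- u) * G s + (- of_real (1 / (2 * y))) * complex_of_real (p s) + of_real c * \<alpha> s)"
    unfolding G_def by (intro ac_prim_add ac_prim_const ac_prim_cmult a(1) pp g_deriv)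
  then have prim: "ac_prim a' \<alpha>'"
    by (rule ac_prim_cong) (simp_all add: a'_def \<alpha>'_def right_diff_distrib)
  have neg: "Re (\<alpha>' s) \<le> 0" if s: "0 \<le> s" for s
  proof -
    have "Re ((- u) * G s) \<le> cmod (G s)"
      using complex_Re_le_cmod[of "(- u) * G s"] mult_right_mono[OF u1 norm_ge_zero[of "G s"]] by (simp add: norm_mult)
    also have "cmod (G s) \<le> (\<Sum>m<j. \<Sum>l=j..<N. cmod (V m l s) * cmod (\<phi> ((idt j)(m := l)) s k))"
      unfolding G_def norm_mult norm_ii mult_1
      by (intro order_trans[OF norm_sum] sum_mono) (simp add: norm_mult[symmetric] order_trans[OF norm_sum])
    also have "\<dots> \<le> (\<Sum>m<j. \<Sum>l=j..<N. (1 / (2 * y)) * ((cmod (V m l s))\<^sup>2 / (lam l - lam m)) + (y / 2) * ((lam l - lam m) * (cmod (\<phi> ((idt j)(m := l)) s k))\<^sup>2))"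
    proof (intro sum_mono)
      fix m l assume ml: "m \<in> {..<j}" "l \<in> {j..<N}"
      define D where "D = lam l - lam m"
      have D: "0 < D" using lam_less[of m l] ml by (simp add: D_def)
      define A B where "A = cmod (V m l s)" and "B = cmod (\<phi> ((idt j)(m := l)) s k)"
      have "0 \<le> (A - y * D * B)\<^sup>2 / (2 * y * D)" using D y0 by simp
      also have "\<dots> = (1 / (2 * y)) * (A\<^sup>2 / D) + (y / 2) * (D * B\<^sup>2) - A * B"
        using D y0 by (simp add: power2_diff add_divide_distrib diff_divide_distrib power_mult_distrib) (simp add: power2_eq_square)
      finally show "A * B \<le> (1 / (2 * y)) * (A\<^sup>2 / (lam l - lam m)) + (y / 2) * ((lam l - lam m) * B\<^sup>2)"
        by (simp add: D_def)
    qed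
    also have "\<dots> = (1 / (2 * y)) * p s + (y / 2) * (\<Sum>m<j. \<Sum>l=j..<N. (lam l - lam m) * (cmod (\<phi> ((idt j)(m := l)) s k))\<^sup>2)"
      by (simp only: sum.distrib p_def sum_distrib_left)
    also have "\<dots> \<le> (1 / (2 * y)) * p s + (y / 2) * (dissip s k / fact j)"
      using dissip_ge[of s k] y0 by (intro add_left_mono mult_left_mono) (simp_all add: field_simps)
    finally have "Re ((- u) * G s) \<le> (1 / (2 * y)) * p s + (y / 2) * (dissip s k / fact j)" .
    moreover have "Re (of_real c * \<alpha> s) = - ((y / 2) * (dissip s k / fact j))"
    proof -
      have "Re (of_real c * \<alpha> s) = c * (- 2 * Im k * dissip s k)" using a(2) s by simp
      then show ?thesis by (simp add: c_def y_def field_simps)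
    qed
    ultimately show ?thesis by (simp add: \<alpha>'_def)
  qed
  have "Re (a' t) \<le> Re (a' 0)" by (rule ac_prim_Re_decreasing[OF prim t neg])
  moreover have "Re (a' 0) = 1/4"
  proof -
    have "(LINT r:{0..0}|lebesgue. complex_of_real (p r)) = 0" using ac_primD(3)[OF pp, of 0] by simp
    then show ?thesis by (simp add: a'_def g_0 energy_0 c_def)
  qed
  moreover have "Re (a' t) = cmod (1 - g t k) - potint t / (2 * y) + energy t k / (4 * fact j)"
  proof -
    have "Re (a' t) = cmod (1 - g t k) - potint t / (2 * y) + c * energy t k"
      unfolding a'_def pr minus_complex.sel plus_complex.sel ug by simp
    then show ?thesis by (simp add: c_def)
  qed
  ultimately have "cmod (1 - g t k) \<le> potint t / (2 * y) + 1/4 - energy t k / (4 * fact j)" by simp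
  moreover have "(cmod (g t k))\<^sup>2 / 4 \<le> energy t k / (4 * fact j)" using energy_ge[of t k] by (simp add: field_simps)
  moreover have "1 - (cmod (g t k))\<^sup>2 \<le> 2 * cmod (1 - g t k)"
  proof -
    have 1: "1 - cmod (g t k) \<le> cmod (1 - g t k)" using norm_triangle_ineq2[of 1 "g t k"] by simp
    have "1 - (cmod (g t k))\<^sup>2 = (1 - cmod (g t k)) * (1 + cmod (g t k))" by (simp add: power2_eq_square algebra_simps)
    also have "\<dots> \<le> cmod (1 - g t k) * 2"
      using 1 cmod_g_le_1[OF t, of k] y by (intro mult_mono) auto
    finally show ?thesis by simp
  qed
  ultimately have "cmod (1 - g t k) \<le> potint t / (2 * y) + cmod (1 - g t k) / 2" by linarith
  then have "cmod (1 - g t k) / 2 \<le> potint t / (2 * y)" by linarith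
  then show ?thesis using y0 by (simp add: y_def field_simps)
qed

end

section \<open>Translation in time\<close>

lemma set_integrable_shift:
  fixes f :: "real \<Rightarrow> 'a::euclidean_space"
  assumes "set_integrable lebesgue {s..s + t} f"
  shows "set_integrable lebesgue {0..t} (\<lambda>r. f (s + r))"
    and "(LINT r:{0..t}|lebesgue. f (s + r)) = (LINT r:{s..s + t}|lebesgue. f r)"
proof -
  have i: "f integrable_on {s..s + t}" "(\<lambda>r. norm (f r)) integrable_on {s..s + t}"
    using assms unfolding absolutely_integrable_on_def by auto
  have 1: "((\<lambda>r. f (s + r)) has_integral integral {s..s+t} f) {0..t}"
    using has_integral_shift_Icc_real[of f s "integral {s..s+t} f" 0 t] integrable_integral[OF i(1)] by (simp add: o_def add.commute)
  have 2: "((\<lambda>r. norm (f (s + r))) has_integral integral {s..s+t} (\<lambda>r. norm (f r))) {0..t}"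
    using has_integral_shift_Icc_real[of "\<lambda>r. norm (f r)" s "integral {s..s+t} (\<lambda>r. norm (f r))" 0 t] integrable_integral[OF i(2)] by (simp add: o_def add.commute)
  show 3: "set_integrable lebesgue {0..t} (\<lambda>r. f (s + r))"
    unfolding absolutely_integrable_on_def using 1 2 by (auto simp: integrable_on_def)
  show "(LINT r:{0..t}|lebesgue. f (s + r)) = (LINT r:{s..s + t}|lebesgue. f r)"
    using set_lebesgue_integral_eq_integral(2)[OF 3] set_lebesgue_integral_eq_integral(2)[OF assms] 1
    by (simp add: integral_unique)
qed

lemma lebesgue_set_integral_Icc_diff:
  fixes f :: "real \<Rightarrow> 'a::{banach, second_countable_topology}"
  assumes i: "set_integrable lebesgue {0..s + t} f" and "0 \<le> s" "0 \<le> t"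
  shows "(LINT r:{s..s + t}|lebesgue. f r) = (LINT r:{0..s + t}|lebesgue. f r) - (LINT r:{0..s}|lebesgue. f r)"
proof -
  have "AE r in lebesgue. r \<noteq> s" by (intro AE_completion) (rule AE_lborel_singleton)
  then have ae: "AE r in lebesgue. indicat_real {s<..s + t} r *\<^sub>R f r = indicat_real {s..s + t} r *\<^sub>R f r"
    by eventually_elim (auto simp: indicator_def)
  have "(LINT r:{s<..s + t}|lebesgue. f r) = (LINT r:{s..s + t}|lebesgue. f r)"
    unfolding set_lebesgue_integral_def
  proof (rule integral_cong_AE[OF _ _ ae])
    have "set_integrable lebesgue {s<..s + t} f" "set_integrable lebesgue {s..s + t} f" 
      by (rule set_integrable_subset[OF i]; use assms in auto)+
    then show "(\<lambda>r. indicat_real {s<..s + t} r *\<^sub>R f r) \<in> borel_measurable lebesgue"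
      "(\<lambda>r. indicat_real {s..s + t} r *\<^sub>R f r) \<in> borel_measurable lebesgue"
      unfolding set_integrable_def by (auto dest: borel_measurable_integrable)
  qed
  then show ?thesis using lebesgue_set_integral_diff[OF i assms(2)] assms by simp
qed

lemma ac_prim_diff:
  assumes "ac_prim a \<alpha>" "0 \<le> s" "0 \<le> t"
  shows "a (s + t) = a s + (LINT r:{s..s + t}|lebesgue. \<alpha> r)"
proof -
  have st: "0 \<le> s + t" using assms by simp
  show ?thesis 
    unfolding lebesgue_set_integral_Icc_diff[OF ac_primD(2)[OF assms(1) st] assms(2,3)] 
      ac_primD(3)[OF assms(1) st] ac_primD(3)[OF assms(1,2)] by simp
qed

lemma ac_prim_shift:
  assumes A: "ac_prim a \<alpha>" and s: "0 \<le> s"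
  shows "ac_prim (\<lambda>t. a (s + t)) (\<lambda>t. \<alpha> (s + t))"
  unfolding ac_prim_def
proof (intro conjI allI impI)
  show "continuous_on {0..} (\<lambda>t. a (s + t))"
    by (rule continuous_on_compose2[OF ac_primD(1)[OF A]]) (use s in \<open>auto intro!: continuous_intros\<close>)
  fix t :: real assume t: "0 \<le> t"
  have i: "set_integrable lebesgue {s..s + t} \<alpha>" 
    by (rule set_integrable_subset[OF ac_primD(2)[OF A, of "s + t"]]) (use s t in auto)
  show "set_integrable lebesgue {0..t} (\<lambda>t. \<alpha> (s + t))" by (rule set_integrable_shift(1)[OF i])
  show "a (s + t) = a (s + 0) + (LINT r:{0..t}|lebesgue. \<alpha> (s + r))"
    unfolding set_integrable_shift(2)[OF i] using ac_prim_diff[OF A s t] by simp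
qed

section \<open>Unitarity and holomorphic dependence on the spectral parameter\<close>

context canonical_system begin

text \<open>Entries of the adjoint of \<open>X(t, cnj k)\<close> times \<open>X(t, k')\<close>. As
  \<open>V\<close> is Hermitian its contributions cancel, and the derivative in \<open>t\<close> is
  \<open>(k' - k) * q\<close>. Equal parameters give the generalised unitarity relation, different
  ones the increment of \<open>X\<close> in the parameter.\<close>

definition Q :: "nat \<Rightarrow> nat \<Rightarrow> real \<Rightarrow> complex \<Rightarrow> complex \<Rightarrow> complex" where
  "Q a b t k k' = (\<Sum>m<N. cnj (x m a t (cnj k)) * x m b t k')"

definition q :: "nat \<Rightarrow> nat \<Rightarrow> real \<Rightarrow> complex \<Rightarrow> complex \<Rightarrow> complex" where
  "q a b t k k' = \<i> * (\<Sum>m<N. of_real (lam m) * cnj (x m a t (cnj k)) * x m b t k')"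

lemma ode':
  assumes "m < N" "c < N"
  shows "ac_prim (\<lambda>t. x m c t k) (\<lambda>t. \<i> * (k * of_real (lam m) * x m c t k + (\<Sum>n<N. V m n t * x n c t k)))"
proof (rule ac_prim_cong[OF ode[OF assms]])
  fix t
  have "(\<Sum>n<N. (\<i> * ((if n = m then k * of_real (lam m) else 0) + V m n t)) * x n c t k) =
     (\<Sum>n<N. (if n = m then \<i> * k * of_real (lam m) * x n c t k else 0) + \<i> * (V m n t * x n c t k))"
    by (intro sum.cong refl) (simp add: algebra_simps)
  also have "\<dots> = \<i> * k * of_real (lam m) * x m c t k + \<i> * (\<Sum>n<N. V m n t * x n c t k)"
    using assms by (simp add: sum.distrib sum.delta sum_distrib_left)
  finally show "(\<Sum>n<N. (\<i> * ((if n = m then k * of_real (lam m) else 0) + V m n t)) * x n c t k) =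
    \<i> * (k * of_real (lam m) * x m c t k + (\<Sum>n<N. V m n t * x n c t k))"
    by (simp add: algebra_simps)
qed simp

lemma Q_deriv:
  assumes "a < N" "b < N"
  shows "ac_prim (\<lambda>t. Q a b t k k') (\<lambda>t. (k' - k) * q a b t k k')"
proof (rule ac_prim_cong)
  define D where "D m c t k = \<i> * (k * of_real (lam m) * x m c t k + (\<Sum>n<N. V m n t * x n c t k))" for m c t k
  show "ac_prim (\<lambda>t. Q a b t k k') (\<lambda>t. \<Sum>m<N. cnj (D m a t (cnj k)) * x m b t k' + cnj (x m a t (cnj k)) * D m b t k')"
    unfolding Q_def D_def by (intro ac_prim_sum ac_prim_mult ac_prim_cnj ode') (use assms in auto)
  fix t :: real assume t: "0 \<le> t"
  have "(\<Sum>m<N. cnj (D m a t (cnj k)) * x m b t k' + cnj (x m a t (cnj k)) * D m b t k')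
    = (\<Sum>m<N. (k' - k) * (\<i> * (of_real (lam m) * cnj (x m a t (cnj k)) * x m b t k')) 
        + \<i> * ((\<Sum>n<N. V m n t * cnj (x m a t (cnj k)) * x n b t k') - (\<Sum>n<N. cnj (V m n t) * cnj (x n a t (cnj k)) * x m b t k')))"
  proof (rule sum.cong[OF refl])
    fix m
    define S1 where "S1 = (\<Sum>n<N. V m n t * x n b t k')"
    define S2 where "S2 = (\<Sum>n<N. cnj (V m n t) * cnj (x n a t (cnj k)))"
    have "(\<Sum>n<N. V m n t * cnj (x m a t (cnj k)) * x n b t k') = cnj (x m a t (cnj k)) * S1"
      "(\<Sum>n<N. cnj (V m n t) * cnj (x n a t (cnj k)) * x m b t k') = S2 * x m b t k'"
      by (simp_all add: S1_def S2_def sum_distrib_left sum_distrib_right mult_ac)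
    moreover have "D m b t k' = \<i> * (k' * of_real (lam m) * x m b t k' + S1)" by (simp add: D_def S1_def)
    moreover have "cnj (D m a t (cnj k)) = - \<i> * (k * of_real (lam m) * cnj (x m a t (cnj k)) + S2)" by (simp add: D_def S2_def)
    ultimately show "cnj (D m a t (cnj k)) * x m b t k' + cnj (x m a t (cnj k)) * D m b t k' =
        (k' - k) * (\<i> * (of_real (lam m) * cnj (x m a t (cnj k)) * x m b t k')) 
        + \<i> * ((\<Sum>n<N. V m n t * cnj (x m a t (cnj k)) * x n b t k') - (\<Sum>n<N. cnj (V m n t) * cnj (x n a t (cnj k)) * x m b t k'))"
      by (simp only:) (simp add: algebra_simps)
  qed
  also have "\<dots> = (k' - k) * q a b t k k' + \<i> * ((\<Sum>m<N. \<Sum>n<N. V m n t * cnj (x m a t (cnj k)) * x n b t k') - (\<Sum>m<N. \<Sum>n<N. cnj (V m n t) * cnj (x n a t (cnj k)) * x m b t k'))"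
    by (simp only: sum.distrib sum_subtractf sum_distrib_left[symmetric] q_def)
  also have "(\<Sum>m<N. \<Sum>n<N. cnj (V m n t) * cnj (x n a t (cnj k)) * x m b t k') = (\<Sum>m<N. \<Sum>n<N. V m n t * cnj (x m a t (cnj k)) * x n b t k')"
    by (subst sum.swap) (intro sum.cong refl, use herm t in simp)
  finally show "(\<Sum>m<N. cnj (D m a t (cnj k)) * x m b t k' + cnj (x m a t (cnj k)) * D m b t k') = (k' - k) * q a b t k k'"
    by simp
qed simp

lemma Q_0: "a < N \<Longrightarrow> b < N \<Longrightarrow> Q a b 0 k k' = (if a = b then 1 else 0)"
proof -
  assume a: "a < N" "b < N"
  have "Q a b 0 k k' = (\<Sum>m<N. if m = a then (if a = b then 1 else 0) else 0)"
    unfolding Q_def by (intro sum.cong refl) (use a in \<open>auto simp: init\<close>)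
  then show ?thesis using a by (simp add: sum.delta)
qed

lemma unitary_left: 
  assumes "a < N" "b < N" "0 \<le> t"
  shows "(\<Sum>m<N. cnj (x m a t (cnj k)) * x m b t k) = (if a = b then 1 else 0)"
proof -
  have "Q a b t k k = Q a b 0 k k" by (rule ac_prim_zero) (use Q_deriv[OF assms(1,2), of k k] assms in auto)
  then show ?thesis using Q_0[OF assms(1,2)] by (simp add: Q_def)
qed

lemma unitary_right:
  assumes "m < N" "n < N" "0 \<le> t"
  shows "(\<Sum>a<N. x m a t k * cnj (x n a t (cnj k))) = (if m = n then 1 else 0)"
proof -
  define A where "A = Matrix.mat N N (\<lambda>(a, m). cnj (x m a t (cnj k)))"
  define B where "B = Matrix.mat N N (\<lambda>(m, b). x m b t k)"
  have AB: "A * B = 1\<^sub>m N"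
  proof (rule eq_matI)
    fix a b assume "a < dim_row (1\<^sub>m N :: complex mat)" "b < dim_col (1\<^sub>m N :: complex mat)"
    then show "(A * B) $$ (a, b) = 1\<^sub>m N $$ (a, b)"
      using unitary_left[OF _ _ assms(3), of a b k] by (simp add: A_def B_def scalar_prod_def lessThan_atLeast0)
  qed (auto simp: A_def B_def)
  have "B * A = 1\<^sub>m N" by (rule mat_mult_left_right_inverse[OF _ _ AB]) (auto simp: A_def B_def)
  then have "(B * A) $$ (m, n) = (if m = n then 1 else 0)" using assms by simp
  then show ?thesis using assms by (simp add: A_def B_def scalar_prod_def lessThan_atLeast0)
qed

definition L :: real where "L = (\<Sum>m<N. \<bar>lam m\<bar>)"

lemma lam_le_L: "m < N \<Longrightarrow> \<bar>lam m\<bar> \<le> L"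
  unfolding L_def by (rule member_le_sum) auto

lemma L_nonneg: "0 \<le> L" unfolding L_def by (rule sum_nonneg) simp

text \<open>A Gronwall estimate for the squared norm \<open>\<nu>\<close> of a column: by
  \<open>Q_deriv\<close> with conjugate parameters its derivative involves only \<open>Im k\<close>
  and \<open>lam\<close>, not \<open>V\<close>. The bound is therefore uniform on strips, as
  dominated convergence in \<open>k\<close> requires.\<close>

lemma cmod_x_le:
  assumes "m < N" "b < N" "0 \<le> t" "t \<le> T" "\<bar>Im k\<bar> \<le> K"
  shows "cmod (x m b t k) \<le> exp (K * L * T)"
proof -
  define c where "c = 2 * \<bar>Im k\<bar> * L"
  define \<nu> where "\<nu> t = (\<Sum>m<N. (cmod (x m b t k))\<^sup>2)" for t
  have \<nu>Q: "Q b b t (cnj k) k = of_real (\<nu> t)" for t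
    unfolding Q_def \<nu>_def of_real_sum by (rule sum.cong) (simp_all add: complex_norm_square mult.commute del: of_real_power)
  have p: "ac_prim (\<lambda>t. exp (of_real (- c) * of_real t) * Q b b t (cnj k) k) 
    (\<lambda>t. (of_real (- c) * exp (of_real (- c) * of_real t)) * Q b b t (cnj k) k + exp (of_real (- c) * of_real t) * ((k - cnj k) * q b b t (cnj k) k))"
    by (rule ac_prim_mult[OF ac_prim_exp Q_deriv]) (use assms in auto)
  have "Re (exp (of_real (- c) * of_real t) * Q b b t (cnj k) k) \<le> Re (exp (of_real (- c) * of_real 0) * Q b b 0 (cnj k) k)"
  proof (rule ac_prim_Re_decreasing[OF p assms(3)])
    fix s :: real
    define w where "w = (\<Sum>m<N. lam m * (cmod (x m b s k))\<^sup>2)"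
    have qw: "q b b s (cnj k) k = \<i> * of_real w"
      unfolding q_def w_def of_real_sum of_real_mult
      by (intro arg_cong[where f = "(*) \<i>"] sum.cong refl) (simp add: complex_norm_square mult_ac del: of_real_power)
    have "k - cnj k = of_real (2 * Im k) * \<i>" by (simp add: complex_eq_iff)
    then have kq: "(k - cnj k) * q b b s (cnj k) k = of_real (- (2 * Im k * w))" unfolding qw by simp
    have "\<bar>w\<bar> \<le> (\<Sum>m<N. L * (cmod (x m b s k))\<^sup>2)"
      unfolding w_def using lam_le_L by (intro order_trans[OF sum_abs] sum_mono) (auto simp: abs_mult intro!: mult_right_mono)
    then have w: "\<bar>w\<bar> \<le> L * \<nu> s" by (simp add: \<nu>_def sum_distrib_left)
    have "- (2 * Im k * w) \<le> 2 * \<bar>Im k\<bar> * \<bar>w\<bar>" using abs_ge_minus_self[of "2 * Im k * w"] by (simp add: abs_mult)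
    also have "\<dots> \<le> 2 * \<bar>Im k\<bar> * (L * \<nu> s)" using w by (intro mult_left_mono) auto
    finally have "- (2 * Im k * w) \<le> c * \<nu> s" by (simp add: c_def mult.assoc)
    then have "exp (- c * s) * (- (2 * Im k * w) - c * \<nu> s) \<le> 0" by (simp add: mult_nonneg_nonpos)
    moreover have "(of_real (- c) * exp (of_real (- c) * of_real s)) * Q b b s (cnj k) k + exp (of_real (- c) * of_real s) * ((k - cnj k) * q b b s (cnj k) k)
      = of_real (exp (- c * s) * (- (2 * Im k * w) - c * \<nu> s))"
      unfolding kq \<nu>Q of_real_mult[symmetric] exp_of_real of_real_add[symmetric] by (simp add: algebra_simps)
    ultimately show "Re ((of_real (- c) * exp (of_real (- c) * of_real s)) * Q b b s (cnj k) k + exp (of_real (- c) * of_real s) * ((k - cnj k) * q b b s (cnj k) k)) \<le> 0"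
      by (simp only: Re_complex_of_real)
  qed
  moreover have "\<nu> 0 = 1"
  proof -
    have "complex_of_real (\<nu> 0) = 1" unfolding \<nu>Q[symmetric] using Q_0[of b b] assms(2) by simp
    then show ?thesis by simp
  qed
  ultimately have "exp (- c * t) * \<nu> t \<le> 1" 
    unfolding \<nu>Q of_real_mult[symmetric] exp_of_real Re_complex_of_real by simp
  then have "\<nu> t \<le> exp (c * t)" by (simp add: exp_minus field_simps)
  also have "\<dots> \<le> (exp (K * L * T))\<^sup>2"
  proof -
    have "\<bar>Im k\<bar> * L * t \<le> K * L * T" using assms L_nonneg by (intro mult_mono) auto
    then show ?thesis by (simp add: c_def exp_double[symmetric] mult.assoc)
  qed
  finally have "\<nu> t \<le> (exp (K * L * T))\<^sup>2" .
  moreover have "(cmod (x m b t k))\<^sup>2 \<le> \<nu> t" unfolding \<nu>_def by (rule member_le_sum) (use assms in auto)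
  ultimately have "(cmod (x m b t k))\<^sup>2 \<le> (exp (K * L * T))\<^sup>2" by linarith
  then show ?thesis by (rule power2_le_imp_le) simp
qed

text \<open>The quotient in Caratheodory's criterion for differentiability. Multiplying
  \<open>Q\<close> from the left by \<open>X(t, k)\<close> and using unitarity gives
  \<open>X(t, k') - X(t, k)\<close> as \<open>k' - k\<close> times the product of
  \<open>X(t, k)\<close> and the integral of \<open>q\<close>. Holomorphy thus reduces to continuity
  of \<open>slope\<close> at \<open>k\<close>, without any iteration scheme.\<close>

definition slope :: "nat \<Rightarrow> nat \<Rightarrow> real \<Rightarrow> complex \<Rightarrow> complex \<Rightarrow> complex" where
  "slope m b t k k' = (\<Sum>a<N. x m a t k * (LINT s:{0..t}|lebesgue. q a b s k k'))"

lemma x_diff: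
  assumes "m < N" "b < N" "0 \<le> t"
  shows "x m b t k' - x m b t k = slope m b t k k' * (k' - k)"
proof -
  have "(\<Sum>a<N. x m a t k * Q a b t k k') = (\<Sum>n<N. (\<Sum>a<N. x m a t k * cnj (x n a t (cnj k))) * x n b t k')"
    unfolding Q_def sum_distrib_left sum_distrib_right by (subst sum.swap) (simp only: mult.assoc)
  also have "\<dots> = (\<Sum>n<N. if n = m then x n b t k' else 0)"
    by (rule sum.cong[OF refl]) (use unitary_right[OF assms(1) _ assms(3), of _ k] in auto)
  also have "\<dots> = x m b t k'" using assms by simp
  finally have 1: "x m b t k' = (\<Sum>a<N. x m a t k * Q a b t k k')" ..
  have "Q a b t k k' = (if a = b then 1 else 0) + (k' - k) * (LINT s:{0..t}|lebesgue. q a b s k k')" if "a < N" for a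
    using ac_primD(3)[OF Q_deriv[OF that assms(2)] assms(3)] Q_0[OF that assms(2)] by simp
  then have "x m b t k' = (\<Sum>a<N. (if a = b then x m a t k else 0) + x m a t k * (LINT s:{0..t}|lebesgue. q a b s k k') * (k' - k))"
    unfolding 1 by (intro sum.cong refl) (simp add: distrib_left mult_ac)
  also have "\<dots> = x m b t k + slope m b t k k' * (k' - k)"
    using assms by (simp add: sum.distrib slope_def sum_distrib_right)
  finally show ?thesis by simp
qed

lemma cmod_q_le:
  assumes "a < N" "b < N" "0 \<le> t" "t \<le> T" "\<bar>Im k\<bar> \<le> K" "\<bar>Im k'\<bar> \<le> K"
  shows "cmod (q a b t k k') \<le> real N * (L * exp (K * L * T) * exp (K * L * T))"
proof -
  have "cmod (q a b t k k') \<le> (\<Sum>m<N. cmod (of_real (lam m) * cnj (x m a t (cnj k)) * x m b t k'))"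
  proof -
    have "cmod (q a b t k k') = cmod (\<Sum>m<N. of_real (lam m) * cnj (x m a t (cnj k)) * x m b t k')"
      unfolding q_def by (simp only: norm_mult norm_ii mult_1)
    then show ?thesis by (simp only: norm_sum)
  qed
  also have "\<dots> \<le> (\<Sum>m<N. L * exp (K * L * T) * exp (K * L * T))"
  proof (rule sum_mono)
    fix m assume m: "m \<in> {..<N}"
    show "cmod (of_real (lam m) * cnj (x m a t (cnj k)) * x m b t k') \<le> L * exp (K * L * T) * exp (K * L * T)"
      unfolding norm_mult complex_mod_cnj norm_of_real
      by (intro mult_mono lam_le_L cmod_x_le) (use m assms L_nonneg in auto)
  qed
  finally show ?thesis by simp
qed

lemma continuous_on_q: 
  assumes "a < N" "b < N" shows "continuous_on {0..} (\<lambda>s. q a b s k k')"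
  unfolding q_def by (intro continuous_intros ac_primD(1)[OF ode]) (use assms in auto)

lemma q_integrable:
  assumes "a < N" "b < N" shows "set_integrable lebesgue {0..t} (\<lambda>s. q a b s k k')"
  by (intro absolutely_integrable_continuous_real continuous_on_subset[OF continuous_on_q]) (use assms in auto)

lemma cmod_slope_le:
  assumes "m < N" "b < N" "0 \<le> t" "\<bar>Im k\<bar> \<le> K" "\<bar>Im k'\<bar> \<le> K"
  shows "cmod (slope m b t k k') \<le> real N * (exp (K * L * t) * (t * (real N * (L * exp (K * L * t) * exp (K * L * t)))))"
proof -
  define M where "M = real N * (L * exp (K * L * t) * exp (K * L * t))"
  have M0: "0 \<le> M" using L_nonneg by (simp add: M_def)
  have J: "cmod (LINT s:{0..t}|lebesgue. q a b s k k') \<le> t * M" if "a < N" for a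
  proof -
    have "cmod (LINT s:{0..t}|lebesgue. q a b s k k') \<le> (LINT s:{0..t}|lebesgue. cmod (q a b s k k'))"
      by (rule set_integral_norm_bound[OF q_integrable[OF that assms(2)]])
    also have "\<dots> \<le> (LINT s:{0..t}|lebesgue. M)"
      by (rule set_integral_mono) 
        (use cmod_q_le[OF that assms(2) _ _ assms(4,5)] assms(3) in \<open>auto simp: M_def intro!: set_integrable_norm q_integrable that assms(2) absolutely_integrable_continuous_real continuous_on_norm continuous_on_subset[OF continuous_on_q]\<close>)
    also have "\<dots> = t * M" using assms(3) by (simp add: set_integral_const)
    finally show ?thesis .
  qed
  have "cmod (slope m b t k k') \<le> (\<Sum>a<N. exp (K * L * t) * (t * M))"
    unfolding slope_def
    by (intro order_trans[OF norm_sum] sum_mono, unfold norm_mult, intro mult_mono J cmod_x_le) (use assms in auto)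
  then show ?thesis by (simp add: M_def)
qed

lemma x_tendsto:
  assumes "m < N" "b < N" "0 \<le> t" and z: "z \<longlonglongrightarrow> k" and K: "\<And>i. \<bar>Im (z i)\<bar> \<le> K" "\<bar>Im k\<bar> \<le> K"
  shows "(\<lambda>i. x m b t (z i)) \<longlonglongrightarrow> x m b t k"
proof -
  define C where "C = real N * (exp (K * L * t) * (t * (real N * (L * exp (K * L * t) * exp (K * L * t)))))"
  have "(\<lambda>i. x m b t (z i) - x m b t k) \<longlonglongrightarrow> 0"
  proof (rule Lim_null_comparison)
    show "\<forall>\<^sub>F i in sequentially. norm (x m b t (z i) - x m b t k) \<le> C * cmod (z i - k)"
      unfolding x_diff[OF assms(1-3)] norm_mult C_def
      by (intro always_eventually allI mult_right_mono cmod_slope_le assms(1-3) K) simp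
    have "(\<lambda>i. cmod (z i - k)) \<longlonglongrightarrow> 0" using z by (simp add: LIM_zero_iff tendsto_norm_zero_iff)
    then show "(\<lambda>i. C * cmod (z i - k)) \<longlonglongrightarrow> 0" by (rule tendsto_mult_right_zero)
  qed
  then show ?thesis by (simp add: LIM_zero_iff)
qed

lemma isCont_slope:
  assumes m: "m < N" and b: "b < N" and t: "0 \<le> t"
  shows "isCont (slope m b t k) k"
  unfolding continuous_at_sequentially o_def
proof (intro allI impI)
  fix z assume z: "z \<longlonglongrightarrow> k"
  obtain K0 where K0: "\<And>i. cmod (z i) \<le> K0" using convergent_imp_Bseq[OF convergentI[OF z]] by (auto simp: Bseq_def)
  \<comment> \<open>A strip containing the whole sequence and its limit; on it \<open>M\<close>
    dominates the integrands.\<close>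
  define K where "K = max K0 (cmod k)"
  have K: "\<bar>Im (z i)\<bar> \<le> K" "\<bar>Im k\<bar> \<le> K" for i 
    using abs_Im_le_cmod[of "z i"] abs_Im_le_cmod[of k] K0[of i] by (auto simp: K_def)
  define M where "M = real N * (L * exp (K * L * t) * exp (K * L * t))"
  have "(\<lambda>i. LINT s:{0..t}|lebesgue. q a b s k (z i)) \<longlonglongrightarrow> (LINT s:{0..t}|lebesgue. q a b s k k)" if a: "a < N" for a
    unfolding set_lebesgue_integral_def
  proof (rule integral_dominated_convergence[where w = "\<lambda>s. indicat_real {0..t} s *\<^sub>R M"])
    show "(\<lambda>s. indicat_real {0..t} s *\<^sub>R q a b s k k) \<in> borel_measurable lebesgue"
      "\<And>i. (\<lambda>s. indicat_real {0..t} s *\<^sub>R q a b s k (z i)) \<in> borel_measurable lebesgue"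
      using q_integrable[OF a b] unfolding set_integrable_def by (auto dest: borel_measurable_integrable)
    have "set_integrable lebesgue {0..t} (\<lambda>_. M)" by (intro absolutely_integrable_continuous_real continuous_intros)
    then show "integrable lebesgue (\<lambda>s. indicat_real {0..t} s *\<^sub>R M)" by (simp add: set_integrable_def)
    show "AE s in lebesgue. (\<lambda>i. indicat_real {0..t} s *\<^sub>R q a b s k (z i)) \<longlonglongrightarrow> indicat_real {0..t} s *\<^sub>R q a b s k k"
    proof (rule AE_I2)
      fix s :: real
      show "(\<lambda>i. indicat_real {0..t} s *\<^sub>R q a b s k (z i)) \<longlonglongrightarrow> indicat_real {0..t} s *\<^sub>R q a b s k k"
      proof (cases "s \<in> {0..t}")
        case True
        then show ?thesis unfolding q_def
          by (intro tendsto_intros x_tendsto[OF _ b _ z K]) auto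
      qed simp
    qed
    show "AE s in lebesgue. norm (indicat_real {0..t} s *\<^sub>R q a b s k (z i)) \<le> indicat_real {0..t} s *\<^sub>R M" for i
      using cmod_q_le[OF a b _ _ K(2) K(1), of _ t i] by (intro AE_I2) (auto simp: indicator_def M_def)
  qed
  then show "(\<lambda>i. slope m b t k (z i)) \<longlonglongrightarrow> slope m b t k k"
    unfolding slope_def by (intro tendsto_intros) auto
qed

lemma x_holomorphic:
  assumes "m < N" "b < N" "0 \<le> t" shows "(x m b t) holomorphic_on S"
proof -
  have "(x m b t has_field_derivative slope m b t k k) (at k)" for k
    unfolding CARAT_DERIV using x_diff[OF assms] isCont_slope[OF assms] by blast
  then show ?thesis unfolding holomorphic_on_def field_differentiable_def
    by (meson has_field_derivative_at_within)
qed

lemma \<psi>_holomorphic: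
  assumes s: "\<sigma> \<in> tuples j N" and t: "0 \<le> t"
  shows "(\<lambda>k. \<psi> \<sigma> t k) holomorphic_on S"
  unfolding \<psi>_def detf_expand
proof (intro holomorphic_intros holomorphic_on_sum holomorphic_on_prod)
  fix p i assume "p \<in> {p. p permutes {0..<j}}" "i \<in> {0..<j}"
  then have "p i \<in> {0..<j}" by (simp only: permutes_in_image mem_Collect_eq)
  then have "p i < N" using jN by simp
  moreover have "\<sigma> i < N" using tuple_less[OF s] \<open>i \<in> {0..<j}\<close> by simp
  ultimately show "x (\<sigma> i) (p i) t holomorphic_on S" by (intro x_holomorphic t)
qed

lemma g_holomorphic: "0 \<le> t \<Longrightarrow> g t holomorphic_on S"
  unfolding g_def \<phi>_def by (intro holomorphic_intros \<psi>_holomorphic idt_tuples jN)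

definition shift_V :: "real \<Rightarrow> nat \<Rightarrow> nat \<Rightarrow> real \<Rightarrow> complex" where
  "shift_V s m l t = V m l (s + t)"

text \<open>The propagator from time \<open>s\<close> to \<open>s + t\<close>, that is
  \<open>X(s + t, k)\<close> times the inverse of \<open>X(s, k)\<close>, the latter written as the
  adjoint at \<open>cnj k\<close> by unitarity.\<close>

definition shift_x :: "real \<Rightarrow> nat \<Rightarrow> nat \<Rightarrow> real \<Rightarrow> complex \<Rightarrow> complex" where
  "shift_x s m c t k = (\<Sum>a<N. x m a (s + t) k * cnj (x c a s (cnj k)))"

text \<open>Restarting at \<open>s\<close> makes every estimate from time 0 available on
  \<open>[s, s + t]\<close>; this is how increments of \<open>g\<close> are controlled.\<close>

lemma canonical_system_shift:
  assumes s: "0 \<le> s"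
  shows "canonical_system N j lam (shift_V s) (shift_x s)"
proof
  show "set_integrable lebesgue {0..T} (\<lambda>t. (cmod (shift_V s m l t))\<^sup>2)" if "m < N" "l < N" "0 \<le> T" for m l T
    unfolding shift_V_def
    by (rule set_integrable_shift(1), rule set_integrable_subset[OF L2[OF that(1,2), of "s + T"]]) (use s that in auto)
  show "ac_prim (\<lambda>t. shift_x s m c t k) (\<lambda>t. \<Sum>n<N. \<i> * ((if n = m then k * of_real (lam m) else 0) + shift_V s m n t) * shift_x s n c t k)"
    if "m < N" "c < N" for m c k
  proof (rule ac_prim_cong)
    show "ac_prim (\<lambda>t. \<Sum>a<N. cnj (x c a s (cnj k)) * x m a (s + t) k) 
      (\<lambda>t. \<Sum>a<N. cnj (x c a s (cnj k)) * (\<Sum>n<N. \<i> * ((if n = m then k * of_real (lam m) else 0) + V m n (s + t)) * x n a (s + t) k))"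
      by (intro ac_prim_sum ac_prim_cmult ac_prim_shift[OF ode s]) (use that in auto)
    fix t :: real
    show "(\<Sum>a<N. cnj (x c a s (cnj k)) * x m a (s + t) k) = shift_x s m c t k" by (simp add: shift_x_def mult.commute)
    have "(\<Sum>n<N. \<i> * ((if n = m then k * of_real (lam m) else 0) + shift_V s m n t) * shift_x s n c t k) 
      = (\<Sum>n<N. \<Sum>a<N. cnj (x c a s (cnj k)) * (\<i> * ((if n = m then k * of_real (lam m) else 0) + V m n (s + t)) * x n a (s + t) k))"
      unfolding shift_x_def shift_V_def sum_distrib_left by (intro sum.cong refl) (simp only: mult_ac)
    also have "\<dots> = (\<Sum>a<N. cnj (x c a s (cnj k)) * (\<Sum>n<N. \<i> * ((if n = m then k * of_real (lam m) else 0) + V m n (s + t)) * x n a (s + t) k))"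
      unfolding sum_distrib_left by (rule sum.swap)
    finally show "(\<Sum>a<N. cnj (x c a s (cnj k)) * (\<Sum>n<N. \<i> * ((if n = m then k * of_real (lam m) else 0) + V m n (s + t)) * x n a (s + t) k))
      = (\<Sum>n<N. \<i> * ((if n = m then k * of_real (lam m) else 0) + shift_V s m n t) * shift_x s n c t k)" ..
  qed
  show "shift_x s m c 0 k = (if m = c then 1 else 0)" if "m < N" "c < N" for m c k
    using unitary_right[OF that s] by (simp add: shift_x_def)
qed (use mono jN herm diag s in \<open>auto simp: shift_V_def\<close>)

lemma shift_compose:
  assumes "m < N" "c < N" "0 \<le> s" 
  shows "(\<Sum>n<N. shift_x s m n t k * x n c s k) = x m c (s + t) k"
proof -
  have "(\<Sum>n<N. shift_x s m n t k * x n c s k) = (\<Sum>a<N. x m a (s + t) k * (\<Sum>n<N. cnj (x n a s (cnj k)) * x n c s k))"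
    unfolding shift_x_def sum_distrib_left sum_distrib_right by (subst sum.swap) (simp only: mult.assoc)
  also have "\<dots> = (\<Sum>a<N. if a = c then x m a (s + t) k else 0)"
    by (rule sum.cong[OF refl]) (use unitary_left[OF _ assms(2,3), of _ k] in auto)
  finally show ?thesis using assms by simp
qed

text \<open>
  On the real axis the propagators are unitary, so by Cauchy-Binet \<open>g (s + t) - g s\<close> is an
  inner product of two vectors of minors, one of norm 1 and one of norm
  \<open>sqrt (2 Re (1 - g'))\<close>, where \<open>g'\<close> belongs to the system started at time \<open>s\<close>.
\<close>

theorem cmod_g_diff:
  assumes s: "0 \<le> s" and t: "0 \<le> t"
  shows "(cmod (g (s + t) (of_real r) - g s (of_real r)))\<^sup>2 
    \<le> 2 * Re (1 - canonical_system.g j lam (shift_x s) t (of_real r))"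
proof -
  interpret S: canonical_system N j lam "shift_V s" "shift_x s" by (rule canonical_system_shift[OF s])
  define k where "k = complex_of_real r"
  have ck: "cnj k = k" by (simp add: k_def)
  define F where "F = (fact j :: real)"
  have F0: "0 < F" by (simp add: F_def)
  have Fc: "(fact j :: complex) = of_real F" by (simp add: F_def)
  define E where "E t = exp (- (\<i> * k * of_real lam0) * of_real t)" for t :: real
  have E1: "cmod (E t) = 1" for t by (simp add: E_def k_def norm_exp_eq_Re)
  have Eadd: "E (s + t) = E s * E t" by (simp add: E_def exp_add[symmetric] algebra_simps)
  \<comment> \<open>The vectors \<open>a\<close> and \<open>u\<close> are the top rows of the
    exterior powers of the shifted propagator and of the identity. Each has squared norm
    \<open>F\<close>, and their inner product, times \<open>E t\<close>, is \<open>F\<close> times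
    the restarted \<open>g\<close>; so expanding the squared distance produces
    \<open>2 Re (1 - g')\<close>.\<close>
  define a where "a \<sigma> = detf j (\<lambda>i c. shift_x s i (\<sigma> c) t k)" for \<sigma>
  define u where "u \<sigma> = detf j (\<lambda>i c. if i = \<sigma> c then 1 else 0)" for \<sigma>
  define T where "T = tuples j N"
  have idt: "\<psi> (idt j) t' k = detf j (\<lambda>i c. x i c t' k)" for t' unfolding \<psi>_def by (rule detf_cong) simp
  have gst: "of_real F * g (s + t) k = E s * (\<Sum>\<sigma>\<in>T. E t * a \<sigma> * \<psi> \<sigma> s k)"
  proof -
    have "detf j (\<lambda>i c. x i c (s + t) k) = detf j (\<lambda>i c. \<Sum>n<N. shift_x s i n t k * x n c s k)"
      by (rule detf_cong) (use shift_compose[OF _ _ s] jN in simp)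
    then have "of_real F * detf j (\<lambda>i c. x i c (s + t) k) = (\<Sum>\<sigma>\<in>T. a \<sigma> * \<psi> \<sigma> s k)"
      using cauchy_binet[where j = j and N = N and A = "\<lambda>i n. shift_x s i n t k" and B = "\<lambda>n c. x n c s k"]
      unfolding a_def \<psi>_def T_def Fc by simp
    then show ?thesis unfolding g_def \<phi>_def idt E_def[symmetric] Eadd
      by (simp add: mult_ac sum_distrib_left[symmetric])
  qed
  have idsum: "(\<Sum>n<N. (if i = n then 1 else 0) * b n) = b i" if "i < N" for i and b :: "nat \<Rightarrow> complex"
  proof -
    have "(\<Sum>n<N. (if i = n then 1 else 0) * b n) = (\<Sum>n<N. if i = n then b n else 0)" by (rule sum.cong) auto
    then show ?thesis using that by simp
  qed
  have gs: "of_real F * g s k = E s * (\<Sum>\<sigma>\<in>T. u \<sigma> * \<psi> \<sigma> s k)"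
  proof -
    have "detf j (\<lambda>i c. x i c s k) = detf j (\<lambda>i c. \<Sum>n<N. (if i = n then 1 else 0) * x n c s k)"
      by (rule detf_cong) (use idsum jN in simp)
    then have "of_real F * detf j (\<lambda>i c. x i c s k) = (\<Sum>\<sigma>\<in>T. u \<sigma> * \<psi> \<sigma> s k)"
      using cauchy_binet[where j = j and N = N and A = "\<lambda>i n. if i = n then 1 else 0" and B = "\<lambda>n c. x n c s k"]
      unfolding u_def \<psi>_def T_def Fc by simp
    then show ?thesis unfolding g_def \<phi>_def idt E_def[symmetric] by (simp add: mult_ac)
  qed
  have cu: "cnj (u \<sigma>) = detf j (\<lambda>i c. if \<sigma> i = c then 1 else 0)" for \<sigma>
    unfolding u_def cnj_detf by (subst detf_transpose[symmetric]) (rule detf_cong, auto)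
  have ca: "cnj (a \<sigma>) = detf j (\<lambda>i c. cnj (shift_x s c (\<sigma> i) t k))" for \<sigma>
    unfolding a_def cnj_detf by (rule detf_transpose[symmetric])
  have aa: "(\<Sum>\<sigma>\<in>T. (cmod (a \<sigma>))\<^sup>2) = F"
  proof -
    have "complex_of_real (\<Sum>\<sigma>\<in>T. (cmod (a \<sigma>))\<^sup>2) = (\<Sum>\<sigma>\<in>T. a \<sigma> * cnj (a \<sigma>))"
      by (simp add: complex_norm_square del: of_real_power)
    also have "\<dots> = of_real F * detf j (\<lambda>i c. \<Sum>n<N. shift_x s i n t k * cnj (shift_x s c n t k))"
      unfolding ca T_def Fc[symmetric] unfolding a_def 
      by (rule cauchy_binet[where j = j and N = N and A = "\<lambda>i n. shift_x s i n t k" and B = "\<lambda>n c. cnj (shift_x s c n t k)"])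
    also have "detf j (\<lambda>i c. \<Sum>n<N. shift_x s i n t k * cnj (shift_x s c n t k)) = detf j (\<lambda>i c. if i = c then 1 else 0)"
      by (rule detf_cong) (use S.unitary_right[OF _ _ t, of _ _ k] ck jN in auto)
    finally show ?thesis by (simp add: detf_identity flip: of_real_sum of_real_power)
  qed
  have uu: "(\<Sum>\<sigma>\<in>T. (cmod (u \<sigma>))\<^sup>2) = F"
  proof -
    have "complex_of_real (\<Sum>\<sigma>\<in>T. (cmod (u \<sigma>))\<^sup>2) = (\<Sum>\<sigma>\<in>T. u \<sigma> * cnj (u \<sigma>))"
      by (simp add: complex_norm_square del: of_real_power)
    also have "\<dots> = of_real F * detf j (\<lambda>i c. \<Sum>n<N. (if i = n then 1 else 0) * (if n = c then 1 else 0))"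
      unfolding cu T_def Fc[symmetric] unfolding u_def 
      by (rule cauchy_binet[where j = j and N = N and A = "\<lambda>i n. if i = n then 1 else 0" and B = "\<lambda>n c. if n = c then 1 else 0"])
    also have "detf j (\<lambda>i c. \<Sum>n<N. (if i = n then 1 else 0) * (if n = c then 1 else 0)) = detf j (\<lambda>i c. if i = c then 1 else 0)"
      by (rule detf_cong, subst idsum) (use jN in auto)
    finally show ?thesis by (simp add: detf_identity flip: of_real_sum of_real_power)
  qed
  have au: "E t * (\<Sum>\<sigma>\<in>T. a \<sigma> * cnj (u \<sigma>)) = of_real F * S.g t k"
  proof -
    have "(\<Sum>\<sigma>\<in>T. a \<sigma> * cnj (u \<sigma>)) = of_real F * detf j (\<lambda>i c. \<Sum>n<N. shift_x s i n t k * (if n = c then 1 else 0))"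
      unfolding cu T_def Fc[symmetric] unfolding a_def 
      by (rule cauchy_binet[where j = j and N = N and A = "\<lambda>i n. shift_x s i n t k" and B = "\<lambda>n c. if n = c then 1 else 0"])
    also have "detf j (\<lambda>i c. \<Sum>n<N. shift_x s i n t k * (if n = c then 1 else 0)) = S.\<psi> (idt j) t k"
      unfolding S.\<psi>_def
    proof (rule detf_cong)
      fix i c assume "i < j" "c < j"
      have "(\<Sum>n<N. shift_x s i n t k * (if n = c then 1 else 0)) = (\<Sum>n<N. if n = c then shift_x s i n t k else 0)"
        by (rule sum.cong) auto
      then show "(\<Sum>n<N. shift_x s i n t k * (if n = c then 1 else 0)) = shift_x s (idt j i) c t k"
        using \<open>i < j\<close> \<open>c < j\<close> jN by simp
    qed
    finally show ?thesis by (simp add: S.g_def S.\<phi>_def E_def lam0_def S.lam0_def mult_ac)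
  qed
  have "F * cmod (g (s + t) k - g s k) = cmod (of_real F * g (s + t) k - of_real F * g s k)"
    using F0 by (simp add: norm_mult flip: right_diff_distrib)
  also have "\<dots> = cmod (E s * (\<Sum>\<sigma>\<in>T. (E t * a \<sigma> - u \<sigma>) * \<psi> \<sigma> s k))"
    unfolding gst gs by (simp only: left_diff_distrib sum_subtractf right_diff_distrib)
  also have "\<dots> \<le> (\<Sum>\<sigma>\<in>T. cmod (E t * a \<sigma> - u \<sigma>) * cmod (\<psi> \<sigma> s k))"
    unfolding norm_mult E1 mult_1 by (rule order_trans[OF norm_sum]) (simp add: norm_mult)
  finally have "(F * cmod (g (s + t) k - g s k))\<^sup>2 \<le> (\<Sum>\<sigma>\<in>T. cmod (E t * a \<sigma> - u \<sigma>) * cmod (\<psi> \<sigma> s k))\<^sup>2"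
    using F0 by (intro power_mono) auto
  also have "\<dots> \<le> (\<Sum>\<sigma>\<in>T. (cmod (E t * a \<sigma> - u \<sigma>))\<^sup>2) * (\<Sum>\<sigma>\<in>T. (cmod (\<psi> \<sigma> s k))\<^sup>2)"
    by (rule Cauchy_Schwarz_ineq_sum)
  also have "(\<Sum>\<sigma>\<in>T. (cmod (\<psi> \<sigma> s k))\<^sup>2) = energy s k"
    unfolding energy_def \<phi>_def norm_mult E_def[symmetric] E1 T_def by simp
  also have "(\<Sum>\<sigma>\<in>T. (cmod (E t * a \<sigma> - u \<sigma>))\<^sup>2) = F * (2 * Re (1 - S.g t k))"
  proof -
    have "(cmod (E t * a \<sigma> - u \<sigma>))\<^sup>2 = (cmod (a \<sigma>))\<^sup>2 + (cmod (u \<sigma>))\<^sup>2 - 2 * Re (E t * (a \<sigma> * cnj (u \<sigma>)))" for \<sigma>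
    proof -
      have "(cmod (E t * a \<sigma> - u \<sigma>))\<^sup>2 = (cmod (E t * a \<sigma>))\<^sup>2 + (cmod (u \<sigma>))\<^sup>2 - 2 * Re ((E t * a \<sigma>) * cnj (u \<sigma>))"
        unfolding cmod_power2 by (simp add: power2_eq_square algebra_simps)
      then show ?thesis by (simp add: norm_mult E1 mult.assoc)
    qed
    then have "(\<Sum>\<sigma>\<in>T. (cmod (E t * a \<sigma> - u \<sigma>))\<^sup>2) = F + F - 2 * Re (E t * (\<Sum>\<sigma>\<in>T. a \<sigma> * cnj (u \<sigma>)))"
      by (simp only: sum.distrib sum_subtractf aa uu sum_distrib_left Re_sum)
    then show ?thesis unfolding au by (simp add: algebra_simps)
  qed
  finally have "F\<^sup>2 * (cmod (g (s + t) k - g s k))\<^sup>2 \<le> F * (2 * Re (1 - S.g t k)) * energy s k" by (simp add: power_mult_distrib)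
  also have "\<dots> \<le> F * (2 * Re (1 - S.g t k)) * F"
  proof (rule mult_left_mono)
    show "energy s k \<le> F" unfolding F_def by (rule energy_decreasing[OF s]) (simp add: k_def)
    have "Re (S.g t k) \<le> 1" using S.cmod_g_le_1[OF t, of k] complex_Re_le_cmod[of "S.g t k"] by (simp add: k_def)
    then show "0 \<le> F * (2 * Re (1 - S.g t k))" using F0 by simp
  qed
  also have "\<dots> = F\<^sup>2 * (2 * Re (1 - S.g t k))" by (simp add: power2_eq_square)
  finally show ?thesis using F0 unfolding k_def by (subst (asm) mult_le_cancel_left_pos) auto
qed

end

lemma nn_integral_le_of_AE_limit:
  fixes u :: "nat \<Rightarrow> 'a \<Rightarrow> ennreal"
  assumes [measurable]: "\<And>n. u n \<in> borel_measurable M" and lim: "AE x in M. (\<lambda>n. u n x) \<longlonglongrightarrow> v x"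
    and le: "\<forall>\<^sub>F n in sequentially. (\<integral>\<^sup>+x. u n x \<partial>M) \<le> B"
  shows "(\<integral>\<^sup>+x. v x \<partial>M) \<le> B"
proof -
  have "(\<integral>\<^sup>+x. v x \<partial>M) = (\<integral>\<^sup>+x. liminf (\<lambda>n. u n x) \<partial>M)"
    by (rule nn_integral_cong_AE) (use lim in \<open>eventually_elim, simp add: lim_imp_Liminf\<close>)
  also have "\<dots> \<le> liminf (\<lambda>n. \<integral>\<^sup>+x. u n x \<partial>M)" by (rule nn_integral_liminf) simp
  also have "\<dots> \<le> limsup (\<lambda>n. \<integral>\<^sup>+x. u n x \<partial>M)" by (rule Liminf_le_Limsup) simp
  also have "\<dots> \<le> B" using le by (rule Limsup_bounded)
  finally show ?thesis .
qed

lemma riesz_C_nonneg: "1 < p \<Longrightarrow> 0 \<le> riesz_C p"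
  using riesz_A_nonneg[of p] riesz_A_nonneg[of 2] by (simp add: riesz_C_def)

context canonical_system begin

lemma potint_nonneg: "0 \<le> potint t"
  unfolding potint_def set_lebesgue_integral_def
proof (rule integral_nonneg_AE, rule AE_I2)
  fix s
  have "0 \<le> (\<Sum>m<j. \<Sum>l=j..<N. (cmod (V m l s))\<^sup>2 / (lam l - lam m))"
    using lam_less by (intro sum_nonneg divide_nonneg_pos) auto
  then show "0 \<le> indicat_real {0..t} s *\<^sub>R (\<Sum>m<j. \<Sum>l=j..<N. (cmod (V m l s))\<^sup>2 / (lam l - lam m))" by simp
qed

lemma potint_shift:
  assumes "0 \<le> s" "0 \<le> t"
  shows "canonical_system.potint N j lam (shift_V s) t = potint (s + t) - potint s"
proof -
  interpret S: canonical_system N j lam "shift_V s" "shift_x s" by (rule canonical_system_shift[OF assms(1)])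
  define p where "p s = (\<Sum>m<j. \<Sum>l=j..<N. (cmod (V m l s))\<^sup>2 / (lam l - lam m))" for s
  have i: "set_integrable lebesgue {0..s + t} p" unfolding p_def[abs_def] by (rule potint_integrable) (use assms in simp)
  have i': "set_integrable lebesgue {s..s + t} p" by (rule set_integrable_subset[OF i]) (use assms in auto)
  have "S.potint t = (LINT r:{0..t}|lebesgue. p (s + r))" by (simp add: S.potint_def p_def shift_V_def)
  also have "\<dots> = (LINT r:{s..s + t}|lebesgue. p r)" by (rule set_integrable_shift(2)[OF i'])
  also have "\<dots> = potint (s + t) - potint s" 
    unfolding lebesgue_set_integral_Icc_diff[OF i assms] by (simp add: potint_def p_def[abs_def])
  finally show ?thesis .
qed

lemma g_continuous_on: "0 \<le> t \<Longrightarrow> continuous_on S (g t)"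
  by (rule holomorphic_on_imp_continuous_on[OF g_holomorphic])

lemma g_half_plane_bound:
  assumes "0 \<le> t" shows "half_plane_bound (g t) (potint t)"
proof
  show "cmod (1 - g t (Complex 0 y)) \<le> potint t / y" if "0 < y" for y
    using cmod_one_minus_g[OF assms, of "Complex 0 y"] that by simp
qed (use assms in \<open>auto simp: uhp_def intro!: g_holomorphic g_continuous_on cmod_g_le_1 potint_nonneg\<close>)

text \<open>The pointwise bound \<open>cmod_g_diff\<close> is integrated with
  \<open>nn_integral_one_minus_Re\<close> for the system restarted at \<open>s\<close>, whose
  \<open>potint\<close> is the increment of the original one; the factors 2 and \<open>pi\<close>
  stem from these two steps.\<close>

lemma g_diff_hardy2:
  assumes s: "0 \<le> s" and t: "0 \<le> t"
  shows "hardy2 (\<lambda>k. g (s + t) k - g s k) 2 (2 * pi * (potint (s + t) - potint s))"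
proof
  interpret S: canonical_system N j lam "shift_V s" "shift_x s" by (rule canonical_system_shift[OF s])
  interpret H: half_plane_bound "S.g t" "S.potint t" by (rule S.g_half_plane_bound[OF t])
  have st: "0 \<le> s + t" using s t by simp
  show "(\<lambda>k. g (s + t) k - g s k) holomorphic_on upper_half" by (intro holomorphic_intros g_holomorphic st s)
  show "continuous_on uhp (\<lambda>k. g (s + t) k - g s k)" by (intro continuous_intros g_continuous_on st s)
  show "\<forall>z\<in>uhp. cmod (g (s + t) z - g s z) \<le> 2"
  proof
    fix z assume "z \<in> uhp"
    then show "cmod (g (s + t) z - g s z) \<le> 2"
      using cmod_g_le_1[OF st, of z] cmod_g_le_1[OF s, of z] norm_triangle_ineq4[of "g (s + t) z" "g s z"] by (simp add: uhp_def)
  qed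
  show "0 \<le> 2 * pi * (potint (s + t) - potint s)"
    using S.potint_nonneg[of t] potint_shift[OF s t] by simp
  have "(\<integral>\<^sup>+r. ennreal ((cmod (g (s + t) (of_real r) - g s (of_real r)))\<^sup>2) \<partial>lebesgue)
     \<le> (\<integral>\<^sup>+r. ennreal 2 * ennreal (Re (1 - S.g t (of_real r))) \<partial>lebesgue)"
  proof (rule nn_integral_mono)
    fix r
    have "0 \<le> Re (1 - S.g t (of_real r))" using H.Re_le1[of r] by simp
    then show "ennreal ((cmod (g (s + t) (of_real r) - g s (of_real r)))\<^sup>2) \<le> ennreal 2 * ennreal (Re (1 - S.g t (of_real r)))"
      using cmod_g_diff[OF s t, of r] by (subst ennreal_mult[symmetric]) (auto intro: ennreal_leI)
  qed
  also have "\<dots> = ennreal 2 * (\<integral>\<^sup>+r. ennreal (Re (1 - S.g t (of_real r))) \<partial>lebesgue)"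
    by (rule nn_integral_cmult) measurable
  also have "\<dots> \<le> ennreal 2 * ennreal (pi * S.potint t)"
    by (intro mult_left_mono H.nn_integral_one_minus_Re) simp
  also have "\<dots> = ennreal (2 * pi * (potint (s + t) - potint s))"
    using S.potint_nonneg[of t] potint_shift[OF s t] by (subst ennreal_mult[symmetric]) (auto simp: mult.assoc)
  finally show "(\<integral>\<^sup>+r. ennreal ((cmod (g (s + t) (of_real r) - g s (of_real r)))\<^sup>2) \<partial>lebesgue) \<le> ennreal (2 * pi * (potint (s + t) - potint s))" .
qed

end

section \<open>The limit of large times\<close>

locale scattering_system = canonical_system +
  fixes J :: real
  assumes potint_tendsto: "(potint \<longlongrightarrow> J) at_top"
begin

lemma potint_mono:
  assumes "0 \<le> s" "s \<le> t" shows "potint s \<le> potint t"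
proof -
  interpret S: canonical_system N j lam "shift_V s" "shift_x s" by (rule canonical_system_shift[OF assms(1)])
  show ?thesis using potint_shift[of s "t - s"] S.potint_nonneg[of "t - s"] assms by simp
qed

lemma potint_le: "0 \<le> s \<Longrightarrow> potint s \<le> J"
  by (rule tendsto_lowerbound[OF potint_tendsto]) (auto intro: potint_mono simp: eventually_at_top_linorder)

lemma J_nonneg: "0 \<le> J" using potint_le[of 0] potint_nonneg[of 0] by simp

lemma g_diff_hardy2':
  assumes "0 \<le> s" "s \<le> t"
  shows "hardy2 (\<lambda>k. g t k - g s k) 2 (2 * pi * (J - potint s))"
proof -
  interpret H: hardy2 "\<lambda>k. g t k - g s k" 2 "2 * pi * (potint t - potint s)"
    using g_diff_hardy2[of s "t - s"] assms by simp
  show ?thesis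
  proof
    have le: "2 * pi * (potint t - potint s) \<le> 2 * pi * (J - potint s)" using potint_le[of t] assms by simp
    show "0 \<le> 2 * pi * (J - potint s)" using potint_le[OF assms(1)] by simp
    show "(\<integral>\<^sup>+r. ennreal ((cmod (g t (of_real r) - g s (of_real r)))\<^sup>2) \<partial>lebesgue) \<le> ennreal (2 * pi * (J - potint s))"
      using H.L2 le by (meson ennreal_leI order_trans)
  qed (use H.hol H.cont H.bd in auto)
qed

lemma g_diff_le:
  assumes "0 \<le> s" "s \<le> t" "z \<in> upper_half"
  shows "(cmod (g t z - g s z))\<^sup>2 \<le> 2 * (J - potint s) / Im z"
proof -
  interpret H: hardy2 "\<lambda>k. g t k - g s k" 2 "2 * pi * (J - potint s)" by (rule g_diff_hardy2'[OF assms(1,2)])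
  have "0 < Im z" using assms by (simp add: upper_half_def)
  from H.pointwise_le[OF this, of "Re z"] show ?thesis by simp
qed

lemma exists_times: "\<exists>T. \<forall>n. real n \<le> T n \<and> T n \<le> T (Suc n) \<and> 2 * pi * (J - potint (T n)) \<le> (1/16)^n"
proof -
  have "\<exists>y. (real n \<le> y \<and> 2 * pi * (J - potint y) \<le> (1/16)^n) \<and> t \<le> y" for n t
  proof -
    have "((\<lambda>t. 2 * pi * (J - potint t)) \<longlongrightarrow> 2 * pi * (J - J)) at_top" by (intro tendsto_intros potint_tendsto)
    then have "\<forall>\<^sub>F t in at_top. 2 * pi * (J - potint t) < (1/16)^n" by (rule order_tendstoD) simp
    then have "\<forall>\<^sub>F y in at_top. (real n \<le> y \<and> 2 * pi * (J - potint y) \<le> (1/16)^n) \<and> t \<le> y"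
      using eventually_ge_at_top[of "real n"] eventually_ge_at_top[of t] by eventually_elim auto
    then show ?thesis by (rule eventually_happens'[rotated]) simp
  qed
  then show ?thesis using dependent_nat_choice[of "\<lambda>n y. real n \<le> y \<and> 2 * pi * (J - potint y) \<le> (1/16)^n" "\<lambda>n x y. x \<le> y"] 
    by (metis (no_types, lifting))
qed

text \<open>Times along which \<open>g\<close> converges at the rate \<open>(1/16)^n\<close>
  demanded by \<open>boundary_values_limit\<close>; \<open>real n \<le> T n\<close> forces them to
  infinity.\<close>

definition T :: "nat \<Rightarrow> real" where
  "T = (SOME T. \<forall>n. real n \<le> T n \<and> T n \<le> T (Suc n) \<and> 2 * pi * (J - potint (T n)) \<le> (1/16)^n)"

lemma T: "real n \<le> T n" "T n \<le> T (Suc n)" "2 * pi * (J - potint (T n)) \<le> (1/16)^n"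
  using someI_ex[OF exists_times] unfolding T_def by blast+

lemma T_nonneg: "0 \<le> T n" using T(1)[of n] by simp

lemma T_at_top: "filterlim T at_top sequentially"
  by (rule filterlim_at_top_mono[OF filterlim_real_sequentially]) (use T(1) in simp)

lemma eventually_T_ge: "\<forall>\<^sub>F n in sequentially. t \<le> T n"
  using T_at_top by (simp add: filterlim_at_top)

text \<open>
  On the real line this limit exists almost everywhere and gives the boundary values. Where the
  sequence diverges, as it may in the lower half-plane, \<open>lim\<close> is junk.
\<close>

definition ginf :: "complex \<Rightarrow> complex" where "ginf k = lim (\<lambda>n. g (T n) k)"

lemma ginf_boundary_values: "boundary_values ginf"
  and ginf_AE: "AE s in lebesgue. (\<lambda>n. g (T n) (of_real s)) \<longlonglongrightarrow> ginf (of_real s)"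
proof -
  have "(\<integral>\<^sup>+r. ennreal ((cmod (g (T (Suc n)) (of_real r) - g (T n) (of_real r)))\<^sup>2) \<partial>lebesgue) \<le> ennreal ((1/16)^n)" for n
  proof -
    interpret H: hardy2 "\<lambda>k. g (T (Suc n)) k - g (T n) k" 2 "2 * pi * (J - potint (T n))"
      by (rule g_diff_hardy2'[OF T_nonneg T(2)])
    show ?thesis using H.L2 T(3)[of n] by (meson ennreal_leI order_trans)
  qed
  moreover have "\<forall>z\<in>uhp. cmod (g (T n) z) \<le> 1" for n using cmod_g_le_1[OF T_nonneg] by (auto simp: uhp_def)
  ultimately have B: "boundary_values (\<lambda>z. lim (\<lambda>n. g (T n) z))" 
    "AE x in lebesgue. (\<lambda>n. g (T n) (of_real x)) \<longlonglongrightarrow> lim (\<lambda>n. g (T n) (of_real x))"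
    using boundary_values_limit[of "\<lambda>n. g (T n)"] g_holomorphic[OF T_nonneg] g_continuous_on[OF T_nonneg] by blast+
  show "boundary_values ginf" using B(1) unfolding ginf_def[abs_def] .
  show "AE s in lebesgue. (\<lambda>n. g (T n) (of_real s)) \<longlonglongrightarrow> ginf (of_real s)" using B(2) unfolding ginf_def .
qed

lemma g_T_tendsto:
  assumes z: "z \<in> upper_half" shows "(\<lambda>n. g (T n) z) \<longlonglongrightarrow> ginf z"
proof -
  have "Cauchy (\<lambda>n. g (T n) z)"
  proof (rule CauchyI')
    fix e :: real assume e: "0 < e"
    have lim: "(\<lambda>n. 2 * (J - potint (T n)) / Im z) \<longlonglongrightarrow> 2 * (J - J) / Im z"
      using z by (intro tendsto_intros filterlim_compose[OF potint_tendsto T_at_top]) (auto simp: upper_half_def)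
    have "\<forall>\<^sub>F n in sequentially. 2 * (J - potint (T n)) / Im z < e\<^sup>2"
      by (rule order_tendstoD(2)[OF lim]) (use e in simp)
    then obtain n0 where n0: "\<And>n. n \<ge> n0 \<Longrightarrow> 2 * (J - potint (T n)) / Im z < e\<^sup>2" by (auto simp: eventually_sequentially)
    have "dist (g (T m) z) (g (T n) z) < e" if "m \<ge> n0" "m < n" for m n
    proof -
      have "T m \<le> T n" using that lift_Suc_mono_le[of T m n] T(2) by simp
      from g_diff_le[OF T_nonneg this z] n0[OF that(1)] have "(cmod (g (T n) z - g (T m) z))\<^sup>2 < e\<^sup>2" by linarith
      then show ?thesis using e power2_less_imp_less[of "cmod (g (T n) z - g (T m) z)" e] by (simp add: dist_norm norm_minus_commute)
    qed
    then show "\<exists>M. \<forall>m\<ge>M. \<forall>n>m. dist (g (T m) z) (g (T n) z) < e" by blast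
  qed
  then show ?thesis unfolding ginf_def by (simp add: Cauchy_convergent_iff convergent_LIMSEQ_iff)
qed

text \<open>Only the later time is sent to infinity along \<open>T\<close>, while the earlier one is
  arbitrary. This upgrades convergence along \<open>T\<close> to convergence for all
  \<open>t\<close>, uniform where \<open>Im z\<close> is bounded below.\<close>

lemma ginf_diff_le:
  assumes "0 \<le> t" "z \<in> upper_half"
  shows "(cmod (g t z - ginf z))\<^sup>2 \<le> 2 * (J - potint t) / Im z"
proof (rule tendsto_upperbound)
  show "(\<lambda>n. (cmod (g t z - g (T n) z))\<^sup>2) \<longlonglongrightarrow> (cmod (g t z - ginf z))\<^sup>2"
    by (intro tendsto_intros g_T_tendsto assms)
  show "\<forall>\<^sub>F n in sequentially. (cmod (g t z - g (T n) z))\<^sup>2 \<le> 2 * (J - potint t) / Im z"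
    using eventually_T_ge[of t] by eventually_elim (subst norm_minus_commute, rule g_diff_le[OF assms(1) _ assms(2)])
qed simp

lemma g_tendsto:
  assumes "z \<in> upper_half" shows "((\<lambda>t. g t z) \<longlongrightarrow> ginf z) at_top"
proof -
  have "((\<lambda>t. (cmod (g t z - ginf z))\<^sup>2) \<longlongrightarrow> 0) at_top"
  proof (rule tendsto_sandwich)
    show "\<forall>\<^sub>F t in at_top. 0 \<le> (cmod (g t z - ginf z))\<^sup>2" by simp
    show "\<forall>\<^sub>F t in at_top. (cmod (g t z - ginf z))\<^sup>2 \<le> 2 * (J - potint t) / Im z"
      using eventually_ge_at_top[of 0] by eventually_elim (rule ginf_diff_le[OF _ assms])
    have "((\<lambda>t. 2 * (J - potint t) / Im z) \<longlongrightarrow> 2 * (J - J) / Im z) at_top"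
      using assms by (intro tendsto_intros potint_tendsto) (auto simp: upper_half_def)
    then show "((\<lambda>t. 2 * (J - potint t) / Im z) \<longlongrightarrow> 0) at_top" by simp
  qed simp
  then have "((\<lambda>t. sqrt ((cmod (g t z - ginf z))\<^sup>2)) \<longlongrightarrow> sqrt 0) at_top" by (rule tendsto_real_sqrt)
  then have "((\<lambda>t. g t z - ginf z) \<longlongrightarrow> 0) at_top" by (simp add: tendsto_norm_zero_iff)
  then show ?thesis by (simp add: LIM_zero_iff)
qed

lemma open_upper_half: "open upper_half"
  unfolding upper_half_def by (rule open_halfspace_Im_gt)

lemma ginf_holomorphic: "ginf holomorphic_on upper_half"
proof (rule holomorphic_uniform_sequence[OF open_upper_half])
  show "g (T n) holomorphic_on upper_half" for n by (rule g_holomorphic[OF T_nonneg])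
  fix z assume z: "z \<in> upper_half"
  \<comment> \<open>The closed ball of this radius stays at height at least \<open>d\<close>, where
    \<open>ginf_diff_le\<close> is uniform.\<close>
  define d where "d = Im z / 2"
  have d: "0 < d" using z by (simp add: d_def upper_half_def)
  have Im: "d \<le> Im w" if "w \<in> cball z d" for w
    using that abs_Im_le_cmod[of "z - w"] by (simp add: d_def dist_norm)
  have sub: "cball z d \<subseteq> upper_half" using Im d by (force simp: upper_half_def)
  have "uniform_limit (cball z d) (\<lambda>n. g (T n)) ginf sequentially"
  proof (rule uniform_limitI)
    fix e :: real assume e: "0 < e"
    have lim: "(\<lambda>n. 2 * (J - potint (T n)) / d) \<longlonglongrightarrow> 2 * (J - J) / d"
      using d by (intro tendsto_intros filterlim_compose[OF potint_tendsto T_at_top]) auto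
    have "\<forall>\<^sub>F n in sequentially. 2 * (J - potint (T n)) / d < e\<^sup>2"
      by (rule order_tendstoD(2)[OF lim]) (use e in simp)
    then show "\<forall>\<^sub>F n in sequentially. \<forall>w\<in>cball z d. dist (g (T n) w) (ginf w) < e"
    proof eventually_elim
      case (elim n)
      show ?case
      proof
        fix w assume w: "w \<in> cball z d"
        have "(cmod (g (T n) w - ginf w))\<^sup>2 \<le> 2 * (J - potint (T n)) / Im w" using ginf_diff_le[OF T_nonneg] sub w by blast
        also have "\<dots> \<le> 2 * (J - potint (T n)) / d" 
          using Im[OF w] d potint_le[OF T_nonneg, of n] by (intro divide_left_mono) auto
        also have "\<dots> < e\<^sup>2" by fact
        finally show "dist (g (T n) w) (ginf w) < e" using e power2_less_imp_less by (fastforce simp: dist_norm)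
      qed
    qed
  qed
  then show "\<exists>d>0. cball z d \<subseteq> upper_half \<and> uniform_limit (cball z d) (\<lambda>n. g (T n)) ginf sequentially"
    using d sub by blast
qed

lemma cmod_ginf_le_1: "z \<in> upper_half \<Longrightarrow> cmod (ginf z) \<le> 1"
  by (rule tendsto_upperbound[OF tendsto_norm[OF g_T_tendsto]]) (auto intro!: always_eventually cmod_g_le_1 T_nonneg simp: upper_half_def less_imp_le)

lemma ginf_Hardy_inf: "ginf \<in> Hardy_inf" "Hardy_inf_norm ginf \<le> 1"
proof -
  have "bounded (ginf ` upper_half)" using cmod_ginf_le_1 by (auto simp: bounded_iff)
  then show "ginf \<in> Hardy_inf" using ginf_holomorphic ginf_boundary_values by (simp add: Hardy_inf_def)
  have "\<i> \<in> upper_half" by (simp add: upper_half_def)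
  then show "Hardy_inf_norm ginf \<le> 1" unfolding Hardy_inf_norm_def
    by (intro cSUP_least cmod_ginf_le_1) auto
qed

lemma g_measurable [measurable]:
  assumes "0 \<le> t" shows "(\<lambda>s. g t (of_real s)) \<in> borel_measurable lebesgue"
  by (rule borel_measurable_on_real_axis(2)[OF g_continuous_on[OF assms]])

lemma ginf_measurable [measurable]: "(\<lambda>s. ginf (of_real s)) \<in> borel_measurable lebesgue"
  unfolding ginf_def by (intro borel_measurable_lim_metric g_measurable T_nonneg)

lemma nn_integral_ginf_diff:
  assumes t: "0 \<le> t"
  shows "(\<integral>\<^sup>+s. ennreal ((cmod (g t (of_real s) - ginf (of_real s)))\<^sup>2) \<partial>lebesgue) \<le> ennreal (2 * pi * (J - potint t))"
proof (rule nn_integral_le_of_AE_limit)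
  show "(\<lambda>s. ennreal ((cmod (g t (of_real s) - g (T n) (of_real s)))\<^sup>2)) \<in> borel_measurable lebesgue" for n
    using g_measurable[OF t] g_measurable[OF T_nonneg] by measurable
  show "AE s in lebesgue. (\<lambda>n. ennreal ((cmod (g t (of_real s) - g (T n) (of_real s)))\<^sup>2)) 
      \<longlonglongrightarrow> ennreal ((cmod (g t (of_real s) - ginf (of_real s)))\<^sup>2)"
    using ginf_AE by eventually_elim (intro tendsto_ennrealI tendsto_intros)
  show "\<forall>\<^sub>F n in sequentially. (\<integral>\<^sup>+s. ennreal ((cmod (g t (of_real s) - g (T n) (of_real s)))\<^sup>2) \<partial>lebesgue) \<le> ennreal (2 * pi * (J - potint t))"
    using eventually_T_ge[of t]
  proof eventually_elim
    case (elim n)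
    interpret H: hardy2 "\<lambda>k. g (T n) k - g t k" 2 "2 * pi * (J - potint t)" by (rule g_diff_hardy2'[OF t elim])
    show ?case using H.L2 by (simp add: norm_minus_commute)
  qed
qed

text \<open>On each horizontal line Fatou passes the height-independent bound of
  \<open>horizontal_le\<close> to the limit. The boundary values follow from those of
  \<open>ginf\<close>, as \<open>g t\<close> is entire.\<close>

lemma ginf_diff_Hardy:
  assumes t: "0 \<le> t"
  shows "(\<lambda>k. g t k - ginf k) \<in> Hardy 2"
proof -
  have "(\<lambda>k. g t k - ginf k) holomorphic_on upper_half"
    by (intro holomorphic_intros g_holomorphic t ginf_holomorphic)
  moreover have "boundary_values (\<lambda>k. g t k - ginf k)"
    using ginf_boundary_values unfolding boundary_values_def
  proof eventually_elim
    case (elim x)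
    have "isCont (g t) (of_real x)" using g_continuous_on[OF t, of UNIV] by (simp add: continuous_on_eq_continuous_at)
    then have "(g t \<longlongrightarrow> g t (of_real x)) (at (of_real x) within S)" for S
      unfolding isCont_def by (rule tendsto_within_subset) simp
    with elim show ?case by (auto intro!: tendsto_diff)
  qed
  moreover have "(SUP y\<in>{0<..}. \<integral>\<^sup>+x. ennreal (cmod (g t (Complex x y) - ginf (Complex x y)) powr 2) \<partial>lebesgue) \<le> ennreal (2 * pi * (J - potint t))"
  proof (rule SUP_least)
    fix y :: real assume "y \<in> {0<..}"
    then have y: "0 < y" by simp
    have "(\<integral>\<^sup>+x. ennreal ((cmod (g t (Complex x y) - ginf (Complex x y)))\<^sup>2) \<partial>lebesgue) \<le> ennreal (2 * pi * (J - potint t))"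
    proof (rule nn_integral_le_of_AE_limit)
      fix n
      have "continuous_on UNIV (\<lambda>x. (cmod (g t (Complex x y) - g (T n) (Complex x y)))\<^sup>2)"
        unfolding Complex_eq
        by (intro continuous_intros continuous_on_compose2[OF g_continuous_on[OF t, of UNIV]] continuous_on_compose2[OF g_continuous_on[OF T_nonneg, of UNIV]]) auto
      then have "(\<lambda>x. (cmod (g t (Complex x y) - g (T n) (Complex x y)))\<^sup>2) \<in> borel_measurable lborel"
        by (simp add: borel_measurable_continuous_onI)
      then have "(\<lambda>x. (cmod (g t (Complex x y) - g (T n) (Complex x y)))\<^sup>2) \<in> borel_measurable lebesgue" by (rule measurable_completion)
      then show "(\<lambda>x. ennreal ((cmod (g t (Complex x y) - g (T n) (Complex x y)))\<^sup>2)) \<in> borel_measurable lebesgue" by measurable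
      show "AE x in lebesgue. (\<lambda>n. ennreal ((cmod (g t (Complex x y) - g (T n) (Complex x y)))\<^sup>2)) 
          \<longlonglongrightarrow> ennreal ((cmod (g t (Complex x y) - ginf (Complex x y)))\<^sup>2)"
        using y by (intro AE_I2 tendsto_ennrealI tendsto_intros g_T_tendsto) (simp add: upper_half_def)
      show "\<forall>\<^sub>F n in sequentially. (\<integral>\<^sup>+x. ennreal ((cmod (g t (Complex x y) - g (T n) (Complex x y)))\<^sup>2) \<partial>lebesgue) \<le> ennreal (2 * pi * (J - potint t))"
        using eventually_T_ge[of t]
      proof eventually_elim
        case (elim n)
        interpret H: hardy2 "\<lambda>k. g (T n) k - g t k" 2 "2 * pi * (J - potint t)" by (rule g_diff_hardy2'[OF t elim])
        show ?case using H.horizontal_le[OF y] by (simp add: norm_minus_commute)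
      qed
    qed
    then show "(\<integral>\<^sup>+x. ennreal (cmod (g t (Complex x y) - ginf (Complex x y)) powr 2) \<partial>lebesgue) \<le> ennreal (2 * pi * (J - potint t))"
      by simp
  qed
  then have "(SUP y\<in>{0<..}. \<integral>\<^sup>+x. ennreal (cmod (g t (Complex x y) - ginf (Complex x y)) powr 2) \<partial>lebesgue) < \<infinity>"
    by (simp add: le_less_trans)
  ultimately show ?thesis unfolding Hardy_def by blast
qed

lemma Hardy_norm_ginf_diff_le:
  assumes t: "0 \<le> t"
  shows "Hardy_norm 2 (\<lambda>k. g t k - ginf k) \<le> sqrt (2 * pi * (J - potint t))"
proof -
  have J: "0 \<le> 2 * pi * (J - potint t)" using potint_le[OF t] by simp
  have m: "(\<lambda>s. (cmod (g t (of_real s) - ginf (of_real s)))\<^sup>2) \<in> borel_measurable lebesgue"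
    using g_measurable[OF t] by measurable
  have "(LINT s|lebesgue. (cmod (g t (of_real s) - ginf (of_real s)))\<^sup>2) = 
      enn2real (\<integral>\<^sup>+s. ennreal ((cmod (g t (of_real s) - ginf (of_real s)))\<^sup>2) \<partial>lebesgue)"
    by (rule integral_eq_nn_integral[OF m]) simp
  also have "\<dots> \<le> 2 * pi * (J - potint t)"
    using nn_integral_ginf_diff[OF t] J by (rule enn2real_leI[rotated])
  finally have "(LINT s|lebesgue. (cmod (g t (of_real s) - ginf (of_real s)))\<^sup>2) \<le> 2 * pi * (J - potint t)" .
  moreover have "0 \<le> (LINT s|lebesgue. (cmod (g t (of_real s) - ginf (of_real s)))\<^sup>2)" by (rule integral_nonneg_AE) simp
  ultimately show ?thesis by (simp add: Hardy_norm_def powr_half_sqrt)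
qed

lemma Hardy_norm_tendsto: "((\<lambda>t. Hardy_norm 2 (\<lambda>k. g t k - ginf k)) \<longlongrightarrow> 0) at_top"
proof (rule tendsto_sandwich)
  show "\<forall>\<^sub>F t in at_top. 0 \<le> Hardy_norm 2 (\<lambda>k. g t k - ginf k)" by (simp add: Hardy_norm_def)
  show "\<forall>\<^sub>F t in at_top. Hardy_norm 2 (\<lambda>k. g t k - ginf k) \<le> sqrt (2 * pi * (J - potint t))"
    using eventually_ge_at_top[of 0] by eventually_elim (rule Hardy_norm_ginf_diff_le)
  have "((\<lambda>t. sqrt (2 * pi * (J - potint t))) \<longlongrightarrow> sqrt (2 * pi * (J - J))) at_top"
    by (intro tendsto_intros potint_tendsto)
  then show "((\<lambda>t. sqrt (2 * pi * (J - potint t))) \<longlongrightarrow> 0) at_top" by simp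
qed simp

lemma ginf_real_le_1: "AE s in lebesgue. cmod (ginf (of_real s)) \<le> 1"
  using ginf_AE
proof eventually_elim
  case (elim s)
  show ?case by (rule tendsto_upperbound[OF tendsto_norm[OF elim]]) (auto intro!: always_eventually cmod_g_le_1 T_nonneg)
qed

section \<open>The logarithmic integral of the limit\<close>

lemma nn_integral_log_ginf:
  assumes e: "0 < e" "e < 1"
  shows "(\<integral>\<^sup>+s. ennreal (- ln (max (cmod (ginf (of_real s))) e)) \<partial>lebesgue) \<le> ennreal (pi * J)"
proof (rule nn_integral_le_of_AE_limit)
  show "(\<lambda>s. ennreal (- ln (max (cmod (g (T n) (of_real s))) e))) \<in> borel_measurable lebesgue" for n
    using g_measurable[OF T_nonneg] by measurable
  show "AE s in lebesgue. (\<lambda>n. ennreal (- ln (max (cmod (g (T n) (of_real s))) e))) \<longlonglongrightarrow> ennreal (- ln (max (cmod (ginf (of_real s))) e))"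
    using ginf_AE by eventually_elim (use e in \<open>intro tendsto_ennrealI tendsto_intros, auto\<close>)
  show "\<forall>\<^sub>F n in sequentially. (\<integral>\<^sup>+s. ennreal (- ln (max (cmod (g (T n) (of_real s))) e)) \<partial>lebesgue) \<le> ennreal (pi * J)"
  proof (rule always_eventually, rule allI)
    fix n
    interpret H: half_plane_bound "g (T n)" "potint (T n)" by (rule g_half_plane_bound[OF T_nonneg])
    have "pi * potint (T n) \<le> pi * J" using potint_le[OF T_nonneg, of n] by simp
    then show "(\<integral>\<^sup>+s. ennreal (- ln (max (cmod (g (T n) (of_real s))) e)) \<partial>lebesgue) \<le> ennreal (pi * J)"
      using H.nn_integral_log[OF e] by (meson ennreal_leI order_trans)
  qed
qed

text \<open>The level \<open>1 / (n + 2)\<close> lies strictly between 0 and 1, as the truncated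
  Jensen bound requires, and tends to 0.\<close>

definition logtrunc :: "nat \<Rightarrow> real \<Rightarrow> ennreal" where
  "logtrunc n s = ennreal (- ln (max (cmod (ginf (of_real s))) (1 / real (n + 2))))"

lemma logtrunc_measurable [measurable]: "logtrunc n \<in> borel_measurable lebesgue"
  unfolding logtrunc_def[abs_def] by measurable

lemma nn_integral_liminf_logtrunc: "(\<integral>\<^sup>+s. liminf (\<lambda>n. logtrunc n s) \<partial>lebesgue) \<le> ennreal (pi * J)"
proof -
  have "(\<integral>\<^sup>+s. liminf (\<lambda>n. logtrunc n s) \<partial>lebesgue) \<le> liminf (\<lambda>n. \<integral>\<^sup>+s. logtrunc n s \<partial>lebesgue)"
    by (rule nn_integral_liminf) simp
  also have "\<dots> \<le> limsup (\<lambda>n. \<integral>\<^sup>+s. logtrunc n s \<partial>lebesgue)" by (rule Liminf_le_Limsup) simp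
  also have "\<dots> \<le> ennreal (pi * J)"
    unfolding logtrunc_def by (intro Limsup_bounded always_eventually allI nn_integral_log_ginf) auto
  finally show ?thesis .
qed

text \<open>At a zero the truncated logarithms grow to infinity, while their lower limit has finite
  integral. This carries content of its own: \<open>ln 0 = 0\<close> by convention, so the integral
  of \<open>ln |g|\<close> alone would not notice zeros.\<close>

lemma ginf_nonzero: "AE s in lebesgue. ginf (of_real s) \<noteq> 0"
proof -
  have "(\<integral>\<^sup>+s. liminf (\<lambda>n. logtrunc n s) \<partial>lebesgue) \<noteq> \<infinity>"
    using nn_integral_liminf_logtrunc by (auto simp: top_unique)
  then have "AE s in lebesgue. liminf (\<lambda>n. logtrunc n s) \<noteq> \<infinity>"
    by (intro nn_integral_PInf_AE) auto
  then show ?thesis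
  proof eventually_elim
    case (elim s)
    show ?case
    proof
      assume z: "ginf (of_real s) = 0"
      have "filterlim (\<lambda>n. ln (real (n + 2))) at_top sequentially" by real_asymp
      then have "(\<lambda>n. ennreal (ln (real (n + 2)))) \<longlonglongrightarrow> \<infinity>" by (simp add: ennreal_tendsto_top_eq_at_top filterlim_at_top)
      moreover have "logtrunc n s = ennreal (ln (real (n + 2)))" for n 
        unfolding logtrunc_def z by (simp add: ln_div)
      ultimately have "(\<lambda>n. logtrunc n s) \<longlonglongrightarrow> \<infinity>" by simp
      then have "liminf (\<lambda>n. logtrunc n s) = \<infinity>" by (rule lim_imp_Liminf[rotated]) simp
      with elim show False by simp
    qed
  qed
qed

lemma nn_integral_ln_ginf: "(\<integral>\<^sup>+s. ennreal (- ln (cmod (ginf (of_real s)))) \<partial>lebesgue) \<le> ennreal (pi * J)"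
proof -
  have "AE s in lebesgue. ennreal (- ln (cmod (ginf (of_real s)))) = liminf (\<lambda>n. logtrunc n s)"
    using ginf_nonzero
  proof eventually_elim
    case (elim s)
    define r where "r = cmod (ginf (of_real s))"
    have r: "0 < r" using elim by (simp add: r_def)
    have "(\<lambda>n. 1 / real (n + 2)) \<longlonglongrightarrow> 0" by real_asymp
    then have "(\<lambda>n. - ln (max r (1 / real (n + 2)))) \<longlonglongrightarrow> - ln (max r 0)"
      using r by (intro tendsto_intros) auto
    then have "(\<lambda>n. logtrunc n s) \<longlonglongrightarrow> ennreal (- ln r)"
      unfolding logtrunc_def r_def[symmetric] using r by (intro tendsto_ennrealI) simp
    then have "liminf (\<lambda>n. logtrunc n s) = ennreal (- ln r)" by (rule lim_imp_Liminf[rotated]) simp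
    then show ?case by (simp add: r_def)
  qed
  then have "(\<integral>\<^sup>+s. ennreal (- ln (cmod (ginf (of_real s)))) \<partial>lebesgue) = (\<integral>\<^sup>+s. liminf (\<lambda>n. logtrunc n s) \<partial>lebesgue)"
    by (rule nn_integral_cong_AE)
  then show ?thesis using nn_integral_liminf_logtrunc by simp
qed

lemma ln_ginf:
  shows "integrable lebesgue (\<lambda>s. ln (cmod (ginf (of_real s))))"
    and "(LINT s|lebesgue. ln (cmod (ginf (of_real s)))) \<le> 0"
    and "- pi * J \<le> (LINT s|lebesgue. ln (cmod (ginf (of_real s))))"
proof -
  have m: "(\<lambda>s. - ln (cmod (ginf (of_real s)))) \<in> borel_measurable lebesgue" by measurable
  have nn: "AE s in lebesgue. 0 \<le> - ln (cmod (ginf (of_real s)))"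
    using ginf_real_le_1 ginf_nonzero by eventually_elim simp
  have fin: "(\<integral>\<^sup>+s. ennreal (- ln (cmod (ginf (of_real s)))) \<partial>lebesgue) < \<infinity>"
    using nn_integral_ln_ginf by (simp add: le_less_trans)
  have "integrable lebesgue (\<lambda>s. - ln (cmod (ginf (of_real s))))"
    by (rule integrableI_nonneg[OF m nn fin])
  then show "integrable lebesgue (\<lambda>s. ln (cmod (ginf (of_real s))))" by simp
  have e: "(LINT s|lebesgue. - ln (cmod (ginf (of_real s)))) = enn2real (\<integral>\<^sup>+s. ennreal (- ln (cmod (ginf (of_real s)))) \<partial>lebesgue)"
    by (rule integral_eq_nn_integral[OF m nn])
  have "enn2real (\<integral>\<^sup>+s. ennreal (- ln (cmod (ginf (of_real s)))) \<partial>lebesgue) \<le> pi * J"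
    using nn_integral_ln_ginf J_nonneg by (intro enn2real_leI) auto
  with e show "- pi * J \<le> (LINT s|lebesgue. ln (cmod (ginf (of_real s))))" by simp
  have "0 \<le> (LINT s|lebesgue. - ln (cmod (ginf (of_real s))))" by (rule integral_nonneg_AE[OF nn])
  then show "(LINT s|lebesgue. ln (cmod (ginf (of_real s)))) \<le> 0" by simp
qed

lemma powr_ginf:
  assumes p: "1 < p"
  shows "integrable lebesgue (\<lambda>s. cmod (1 - ginf (of_real s)) powr p)"
    and "(LINT s|lebesgue. cmod (1 - ginf (of_real s)) powr p) \<le> riesz_C p * J"
proof -
  have C: "0 \<le> riesz_C p * J" using riesz_C_nonneg[OF p] J_nonneg by simp
  have le: "(\<integral>\<^sup>+s. ennreal (cmod (1 - ginf (of_real s)) powr p) \<partial>lebesgue) \<le> ennreal (riesz_C p * J)"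
  proof (rule nn_integral_le_of_AE_limit)
    show "(\<lambda>s. ennreal (cmod (1 - g (T n) (of_real s)) powr p)) \<in> borel_measurable lebesgue" for n
      using g_measurable[OF T_nonneg] by measurable
    show "AE s in lebesgue. (\<lambda>n. ennreal (cmod (1 - g (T n) (of_real s)) powr p)) \<longlonglongrightarrow> ennreal (cmod (1 - ginf (of_real s)) powr p)"
      using ginf_AE by eventually_elim (use p in \<open>intro tendsto_ennrealI tendsto_powr' tendsto_intros, auto\<close>)
    show "\<forall>\<^sub>F n in sequentially. (\<integral>\<^sup>+s. ennreal (cmod (1 - g (T n) (of_real s)) powr p) \<partial>lebesgue) \<le> ennreal (riesz_C p * J)"
    proof (rule always_eventually, rule allI)
      fix n
      interpret H: half_plane_bound "g (T n)" "potint (T n)" by (rule g_half_plane_bound[OF T_nonneg])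
      have "riesz_C p * potint (T n) \<le> riesz_C p * J" using potint_le[OF T_nonneg, of n] riesz_C_nonneg[OF p] by (intro mult_left_mono)
      then show "(\<integral>\<^sup>+s. ennreal (cmod (1 - g (T n) (of_real s)) powr p) \<partial>lebesgue) \<le> ennreal (riesz_C p * J)"
        using H.nn_integral_powr[OF p] by (meson ennreal_leI order_trans)
    qed
  qed
  have m: "(\<lambda>s. cmod (1 - ginf (of_real s)) powr p) \<in> borel_measurable lebesgue" by measurable
  have fin: "(\<integral>\<^sup>+s. ennreal (cmod (1 - ginf (of_real s)) powr p) \<partial>lebesgue) < \<infinity>" using le by (simp add: le_less_trans)
  show "integrable lebesgue (\<lambda>s. cmod (1 - ginf (of_real s)) powr p)"
    by (rule integrableI_nonneg[OF m _ fin]) simp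
  have "(LINT s|lebesgue. cmod (1 - ginf (of_real s)) powr p) = enn2real (\<integral>\<^sup>+s. ennreal (cmod (1 - ginf (of_real s)) powr p) \<partial>lebesgue)"
    by (rule integral_eq_nn_integral[OF m]) simp
  then show "(LINT s|lebesgue. cmod (1 - ginf (of_real s)) powr p) \<le> riesz_C p * J"
    using le C by (simp add: enn2real_leI)
qed

end

section \<open>From matrices to the entrywise system\<close>

lemma mat_adjoint_index:
  fixes A :: "complex mat"
  assumes "A \<in> carrier_mat N N" "m < N" "l < N"
  shows "mat_adjoint A $$ (m, l) = cnj (A $$ (l, m))"
  using assms by (simp add: mat_adjoint_def mat_of_rows_index)

lemma potential_L2:
  assumes P: "potential N V" and ml: "m < N" "l < N" and T: "0 \<le> T"
  shows "set_integrable lebesgue {0..T} (\<lambda>t. (cmod (V t $$ (m, l)))\<^sup>2)"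
proof -
  have mn: "set_integrable lebesgue {0..T} (\<lambda>t. (mat_norm (V t))\<^sup>2)" using P T by (simp add: potential_def)
  have m0: "(\<lambda>t. indicat_real {0..} t *\<^sub>R (V t $$ (m, l))) \<in> borel_measurable lebesgue"
    using P ml by (simp add: potential_def set_borel_measurable_def)
  have "(\<lambda>t. indicat_real {0..T} t * (cmod (indicat_real {0..} t *\<^sub>R (V t $$ (m, l))))\<^sup>2) \<in> borel_measurable lebesgue"
    by (intro borel_measurable_times borel_measurable_indicator borel_measurable_power[OF measurable_compose[OF m0 borel_measurable_norm]]) simp
  also have "(\<lambda>t. indicat_real {0..T} t * (cmod (indicat_real {0..} t *\<^sub>R (V t $$ (m, l))))\<^sup>2) = 
      (\<lambda>t. indicat_real {0..T} t *\<^sub>R (cmod (V t $$ (m, l)))\<^sup>2)" by (auto simp: indicator_def)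
  finally have meas: "(\<lambda>t. indicat_real {0..T} t *\<^sub>R (cmod (V t $$ (m, l)))\<^sup>2) \<in> borel_measurable lebesgue" .
  have le: "(cmod (V t $$ (m, l)))\<^sup>2 \<le> (mat_norm (V t))\<^sup>2" if "0 \<le> t" for t
  proof -
    have c: "V t \<in> carrier_mat N N" using P that by (simp add: potential_def)
    have "(cmod (V t $$ (m, l)))\<^sup>2 \<le> (\<Sum>l<N. (cmod (V t $$ (m, l)))\<^sup>2)" by (rule member_le_sum) (use ml in auto)
    also have "\<dots> \<le> (\<Sum>m<N. \<Sum>l<N. (cmod (V t $$ (m, l)))\<^sup>2)" 
      by (rule member_le_sum[of m "{..<N}" "\<lambda>m. \<Sum>l<N. (cmod (V t $$ (m, l)))\<^sup>2"]) (use ml in \<open>auto intro!: sum_nonneg\<close>)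
    finally show ?thesis using c by (simp add: mat_norm_def sum_nonneg)
  qed
  show ?thesis unfolding set_integrable_def
  proof (rule Bochner_Integration.integrable_bound[OF mn[unfolded set_integrable_def] meas])
    show "AE t in lebesgue. norm (indicat_real {0..T} t *\<^sub>R (cmod (V t $$ (m, l)))\<^sup>2) \<le> norm (indicat_real {0..T} t *\<^sub>R (mat_norm (V t))\<^sup>2)"
      using le by (intro AE_I2) (auto simp: indicator_def)
  qed
qed

lemma canonical_system_of_solution:
  assumes mono: "strict_mono_on {..<N} lam" and jN: "j \<le> N" and P: "potential N V" and X: "solution N lam V X"
  shows "canonical_system N j lam (\<lambda>m l t. V t $$ (m, l)) (\<lambda>m c t k. X t k $$ (m, c))"
proof
  show "cnj (V t $$ (m, l)) = V t $$ (l, m)" if "m < N" "l < N" "0 \<le> t" for m l t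
  proof -
    have "V t \<in> carrier_mat N N" "mat_adjoint (V t) = V t" using P that by (auto simp: potential_def)
    then show ?thesis using mat_adjoint_index[of "V t" N l m] that by simp
  qed
  show "V t $$ (m, m) = 0" if "m < N" "0 \<le> t" for m t using P that by (simp add: potential_def)
  show "set_integrable lebesgue {0..T} (\<lambda>t. (cmod (V t $$ (m, l)))\<^sup>2)" if "m < N" "l < N" "0 \<le> T" for m l T
    by (rule potential_L2[OF P that])
  define F where "F m c k s = (\<i> \<cdot>\<^sub>m ((k \<cdot>\<^sub>m Lambda N lam + V s) * X s k)) $$ (m, c)" for m c k s
  have S: "continuous_on {0..} (\<lambda>t. X t k $$ (m, c))" "\<And>t. 0 \<le> t \<Longrightarrow> set_integrable lebesgue {0..t} (F m c k)"
    "\<And>t. 0 \<le> t \<Longrightarrow> X t k $$ (m, c) = 1\<^sub>m N $$ (m, c) + (LINT s:{0..t}|lebesgue. F m c k s)" if "m < N" "c < N" for m c k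
    using X that unfolding solution_def F_def Let_def by blast+
  \<comment> \<open>A single point is a null set, so the integrated equation at time 0 reduces to
    the initial value.\<close>
  have z: "(LINT s:{0..0}|lebesgue. F m c k s) = 0" if "m < N" "c < N" for m c k
    using ac_primD(3)[OF ac_prim_indefinite[OF S(2)[OF that]], of 0 k] by simp
  show i: "X 0 k $$ (m, c) = (if m = c then 1 else 0)" if "m < N" "c < N" for m c k
    using S(3)[OF that, of 0 k] z[OF that, of k] that by simp
  show "ac_prim (\<lambda>t. X t k $$ (m, c)) (\<lambda>t. \<Sum>n<N. \<i> * ((if n = m then k * of_real (lam m) else 0) + V t $$ (m, n)) * X t k $$ (n, c))"
    if mc: "m < N" "c < N" for m c k
  proof (rule ac_prim_cong)
    show "ac_prim (\<lambda>t. X t k $$ (m, c)) (F m c k)"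
      unfolding ac_prim_def
    proof (intro conjI allI impI)
      fix t :: real assume t: "0 \<le> t"
      show "X t k $$ (m, c) = X 0 k $$ (m, c) + (LINT s:{0..t}|lebesgue. F m c k s)"
        unfolding S(3)[OF mc t] i[OF mc] using mc by simp
    qed (use S(1,2)[OF mc] in auto)
    fix t :: real assume t: "0 \<le> t"
    have c: "V t \<in> carrier_mat N N" "X t k \<in> carrier_mat N N" using P X t by (auto simp: potential_def solution_def)
    have "F m c k t = \<i> * (\<Sum>n<N. (k * Lambda N lam $$ (m, n) + V t $$ (m, n)) * X t k $$ (n, c))"
    proof -
      have L: "Lambda N lam \<in> carrier_mat N N" by (simp add: Lambda_def)
      have "((k \<cdot>\<^sub>m Lambda N lam + V t) * X t k) $$ (m, c) = (\<Sum>n<N. (k \<cdot>\<^sub>m Lambda N lam + V t) $$ (m, n) * X t k $$ (n, c))"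
        using c mc L by (auto simp: scalar_prod_def lessThan_atLeast0 intro!: sum.cong)
      also have "\<dots> = (\<Sum>n<N. (k * Lambda N lam $$ (m, n) + V t $$ (m, n)) * X t k $$ (n, c))"
        using c mc L by (intro sum.cong refl) auto
      finally show ?thesis unfolding F_def using c mc L by simp
    qed
    also have "\<dots> = (\<Sum>n<N. \<i> * ((if n = m then k * of_real (lam m) else 0) + V t $$ (m, n)) * X t k $$ (n, c))"
      unfolding sum_distrib_left using mc by (intro sum.cong refl) (auto simp: Lambda_def mat_diag_def mult.assoc)
    finally show "F m c k t = (\<Sum>n<N. \<i> * ((if n = m then k * of_real (lam m) else 0) + V t $$ (m, n)) * X t k $$ (n, c))" .
  qed simp
qed (use mono jN in auto)

text \<open>Finiteness of \<open>I_func\<close> makes the weighted density integrable on the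
  half-line, so its integrals over \<open>{0..t}\<close> converge to the full one; Tonelli for
  finite sums identifies the latter with \<open>I_func\<close>.\<close>

lemma potint_tendsto_I_func:
  assumes mono: "strict_mono_on {..<N} lam" and jN: "j \<le> N" and P: "potential N V" and X: "solution N lam V X"
    and fin: "I_func N lam j V < \<infinity>"
  shows "(canonical_system.potint N j lam (\<lambda>m l t. V t $$ (m, l)) \<longlongrightarrow> enn2real (I_func N lam j V)) at_top"
proof -
  interpret canonical_system N j lam "\<lambda>m l t. V t $$ (m, l)" "\<lambda>m c t k. X t k $$ (m, c)"
    by (rule canonical_system_of_solution[OF mono jN P X])
  \<comment> \<open>Entries of \<open>V\<close> are assumed measurable on \<open>{0..}\<close> only;
    the indicator makes \<open>h\<close> measurable on the whole line.\<close>
  define h where "h m l t = indicat_real {0..} t * ((cmod (V t $$ (m, l)))\<^sup>2 / (lam l - lam m))" for m l t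
  define p where "p t = (\<Sum>m<j. \<Sum>l=j..<N. (cmod (V t $$ (m, l)))\<^sup>2 / (lam l - lam m))" for t
  have hm [measurable]: "h m l \<in> borel_measurable lebesgue" if "m < j" "l \<in> {j..<N}" for m l
  proof -
    have "(\<lambda>t. indicat_real {0..} t *\<^sub>R (V t $$ (m, l))) \<in> borel_measurable lebesgue"
      using P that jN by (simp add: potential_def set_borel_measurable_def)
    then have "(\<lambda>t. (cmod (indicat_real {0..} t *\<^sub>R (V t $$ (m, l))))\<^sup>2 / (lam l - lam m)) \<in> borel_measurable lebesgue"
      by measurable
    moreover have "(\<lambda>t. (cmod (indicat_real {0..} t *\<^sub>R (V t $$ (m, l))))\<^sup>2 / (lam l - lam m)) = h m l"
      by (auto simp: h_def indicator_def)
    ultimately show ?thesis by simp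
  qed
  have h0: "0 \<le> h m l t" if "m < j" "l \<in> {j..<N}" for m l t
    using lam_less[of m l] that by (simp add: h_def)
  have ph: "indicat_real {0..} t *\<^sub>R p t = (\<Sum>m<j. \<Sum>l=j..<N. h m l t)" for t
    by (simp add: p_def h_def sum_distrib_left)
  have "(\<integral>\<^sup>+t. ennreal (indicat_real {0..} t *\<^sub>R p t) \<partial>lebesgue) = (\<integral>\<^sup>+t. (\<Sum>m<j. \<Sum>l=j..<N. ennreal (h m l t)) \<partial>lebesgue)"
    unfolding ph
  proof (intro nn_integral_cong)
    fix t
    have "ennreal (\<Sum>m<j. \<Sum>l=j..<N. h m l t) = (\<Sum>m<j. ennreal (\<Sum>l=j..<N. h m l t))"
      using h0 by (intro sum_ennreal[symmetric] sum_nonneg) auto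
    also have "\<dots> = (\<Sum>m<j. \<Sum>l=j..<N. ennreal (h m l t))"
      using h0 by (intro sum.cong refl sum_ennreal[symmetric]) auto
    finally show "ennreal (\<Sum>m<j. \<Sum>l=j..<N. h m l t) = (\<Sum>m<j. \<Sum>l=j..<N. ennreal (h m l t))" .
  qed
  also have "\<dots> = (\<Sum>m<j. \<Sum>l=j..<N. \<integral>\<^sup>+t. ennreal (h m l t) \<partial>lebesgue)"
  proof -
    have "(\<integral>\<^sup>+t. (\<Sum>m<j. \<Sum>l=j..<N. ennreal (h m l t)) \<partial>lebesgue) = (\<Sum>m<j. \<integral>\<^sup>+t. (\<Sum>l=j..<N. ennreal (h m l t)) \<partial>lebesgue)"
      using hm by (intro nn_integral_sum borel_measurable_sum measurable_compose_rev[OF measurable_ennreal]) auto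
    also have "\<dots> = (\<Sum>m<j. \<Sum>l=j..<N. \<integral>\<^sup>+t. ennreal (h m l t) \<partial>lebesgue)"
      using hm by (intro sum.cong refl nn_integral_sum measurable_compose_rev[OF measurable_ennreal]) auto
    finally show ?thesis .
  qed
  also have "\<dots> = I_func N lam j V"
    unfolding I_func_def
  proof (intro sum.cong refl)
    fix m l assume ml: "m \<in> {..<j}" "l \<in> {j..<N}"
    then have d: "0 < lam l - lam m" using lam_less[of m l] by simp
    have meas: "(\<lambda>t. ennreal ((cmod (V t $$ (m, l)))\<^sup>2) * indicator {0..} t) \<in> borel_measurable lebesgue"
    proof -
      have "(\<lambda>t. ennreal ((lam l - lam m) * h m l t)) \<in> borel_measurable lebesgue"
      proof -
        have [measurable]: "h m l \<in> borel_measurable lebesgue" using hm[of m l] ml by auto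
        show ?thesis by measurable
      qed
      moreover have "(\<lambda>t. ennreal ((lam l - lam m) * h m l t)) = (\<lambda>t. ennreal ((cmod (V t $$ (m, l)))\<^sup>2) * indicator {0..} t)"
        using d by (auto simp: h_def indicator_def fun_eq_iff)
      ultimately show ?thesis by simp
    qed
    have "(\<integral>\<^sup>+t. ennreal (h m l t) \<partial>lebesgue) = (\<integral>\<^sup>+t. ennreal (1 / \<bar>lam l - lam m\<bar>) * (ennreal ((cmod (V t $$ (m, l)))\<^sup>2) * indicator {0..} t) \<partial>lebesgue)"
      using d by (intro nn_integral_cong) (auto simp: h_def indicator_def ennreal_mult[symmetric])
    also have "\<dots> = ennreal (1 / \<bar>lam l - lam m\<bar>) * (\<integral>\<^sup>+t\<in>{0..}. ennreal ((cmod (V t $$ (m, l)))\<^sup>2) \<partial>lebesgue)"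
      by (rule nn_integral_cmult[OF meas])
    finally show "(\<integral>\<^sup>+t. ennreal (h m l t) \<partial>lebesgue) = ennreal (1 / \<bar>lam l - lam m\<bar>) * (\<integral>\<^sup>+t\<in>{0..}. ennreal ((cmod (V t $$ (m, l)))\<^sup>2) \<partial>lebesgue)" .
  qed
  finally have nn: "(\<integral>\<^sup>+t. ennreal (indicat_real {0..} t *\<^sub>R p t) \<partial>lebesgue) = I_func N lam j V" .
  have pm: "(\<lambda>t. indicat_real {0..} t *\<^sub>R p t) \<in> borel_measurable lebesgue"
    unfolding ph using hm by (intro borel_measurable_sum) auto
  have p0: "0 \<le> indicat_real {0..} t *\<^sub>R p t" for t unfolding ph using h0 by (intro sum_nonneg) auto
  have pint: "set_integrable lebesgue {0..} p" unfolding set_integrable_def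
    by (rule integrableI_nonneg[OF pm]) (use p0 nn fin in auto)
  have "((\<lambda>t. LINT s:{0..t}|lebesgue. p s) \<longlongrightarrow> (LINT s:{0..}|lebesgue. p s)) at_top"
    by (rule tendsto_set_lebesgue_integral_at_top[OF _ pint]) auto
  moreover have "(LINT s:{0..}|lebesgue. p s) = enn2real (I_func N lam j V)"
    unfolding set_lebesgue_integral_def nn[symmetric] by (rule integral_eq_nn_integral[OF pm]) (use p0 in simp)
  ultimately show ?thesis by (simp add: potint_def[abs_def] p_def[abs_def])
qed

theorem theorem3p1:
  shows "\<exists>C :: real \<Rightarrow> real.
    \<forall>(N :: nat) (lam :: nat \<Rightarrow> real) (V :: real \<Rightarrow> complex mat)
      (X :: real \<Rightarrow> complex \<Rightarrow> complex mat) (j :: nat).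
      3 \<le> N \<and> lam 0 = 0 \<and> strict_mono_on {..<N} lam \<and>
      potential N V \<and> solution N lam V X \<and>
      1 < j \<and> j < N \<and> I_func N lam j V < \<infinity> \<longrightarrow>
      (\<exists>ginf :: complex \<Rightarrow> complex.
         (\<forall>k\<in>upper_half. ((\<lambda>t. g_func lam j X t k) \<longlongrightarrow> ginf k) at_top) \<and>
         ginf \<in> Hardy_inf \<and> Hardy_inf_norm ginf \<le> 1 \<and>
         (\<forall>t\<ge>0. (\<lambda>k. g_func lam j X t k - ginf k) \<in> Hardy 2) \<and>
         ((\<lambda>t. Hardy_norm 2 (\<lambda>k. g_func lam j X t k - ginf k)) \<longlongrightarrow> 0) at_top \<and>
         (AE x in lebesgue. ginf (complex_of_real x) \<noteq> 0) \<and>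
         integrable lebesgue (\<lambda>x. ln (cmod (ginf (complex_of_real x)))) \<and>
         (LINT x|lebesgue. ln (cmod (ginf (complex_of_real x)))) \<le> 0 \<and>
         - pi * enn2real (I_func N lam j V)
           \<le> (LINT x|lebesgue. ln (cmod (ginf (complex_of_real x)))) \<and>
         (\<forall>p>1. integrable lebesgue (\<lambda>x. cmod (1 - ginf (complex_of_real x)) powr p) \<and>
            (LINT x|lebesgue. cmod (1 - ginf (complex_of_real x)) powr p)
              \<le> C p * enn2real (I_func N lam j V)))"
proof (intro exI[of _ riesz_C] allI impI, elim conjE)
  fix N :: nat and lam :: "nat \<Rightarrow> real" and V :: "real \<Rightarrow> complex mat"
    and X :: "real \<Rightarrow> complex \<Rightarrow> complex mat" and j :: nat
  assume mono: "strict_mono_on {..<N} lam" and P: "potential N V" and X: "solution N lam V X"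
    and "j < N" and fin: "I_func N lam j V < \<infinity>"
  then have jN: "j \<le> N" by simp
  interpret canonical_system N j lam "\<lambda>m l t. V t $$ (m, l)" "\<lambda>m c t k. X t k $$ (m, c)"
    by (rule canonical_system_of_solution[OF mono jN P X])
  interpret scattering_system N j lam "\<lambda>m l t. V t $$ (m, l)" "\<lambda>m c t k. X t k $$ (m, c)" "enn2real (I_func N lam j V)"
    by unfold_locales (rule potint_tendsto_I_func[OF mono jN P X fin])
  have g: "g_func lam j X t k = g t k" for t k
  proof -
    have "\<psi> (idt j) t k = Delta j X t k" unfolding \<psi>_def Delta_def detf_def[symmetric] by (rule detf_cong) simp
    then show ?thesis by (simp add: g_func_def g_def \<phi>_def lam0_def mult_ac)
  qed
  show "\<exists>ginf :: complex \<Rightarrow> complex.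
         (\<forall>k\<in>upper_half. ((\<lambda>t. g_func lam j X t k) \<longlongrightarrow> ginf k) at_top) \<and>
         ginf \<in> Hardy_inf \<and> Hardy_inf_norm ginf \<le> 1 \<and>
         (\<forall>t\<ge>0. (\<lambda>k. g_func lam j X t k - ginf k) \<in> Hardy 2) \<and>
         ((\<lambda>t. Hardy_norm 2 (\<lambda>k. g_func lam j X t k - ginf k)) \<longlongrightarrow> 0) at_top \<and>
         (AE x in lebesgue. ginf (complex_of_real x) \<noteq> 0) \<and>
         integrable lebesgue (\<lambda>x. ln (cmod (ginf (complex_of_real x)))) \<and>
         (LINT x|lebesgue. ln (cmod (ginf (complex_of_real x)))) \<le> 0 \<and>
         - pi * enn2real (I_func N lam j V)
           \<le> (LINT x|lebesgue. ln (cmod (ginf (complex_of_real x)))) \<and>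
         (\<forall>p>1. integrable lebesgue (\<lambda>x. cmod (1 - ginf (complex_of_real x)) powr p) \<and>
            (LINT x|lebesgue. cmod (1 - ginf (complex_of_real x)) powr p)
              \<le> riesz_C p * enn2real (I_func N lam j V))"
    unfolding g
    by (intro exI[of _ ginf] conjI ballI allI impI g_tendsto ginf_Hardy_inf ginf_diff_Hardy Hardy_norm_tendsto 
        ginf_nonzero ln_ginf powr_ginf)
qed

end
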